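(* Let $k$ be a field and let $Q$ be the quiver with vertex set $\{1,\dots,8\}$ and arrows $a:1\to 4$, $b:2\to 4$, $c:3\to 4$, $d:4\to 5$, $e:5\to 6$, $f:5\to 7$, $g:5\to 8$. Let $\alpha=(1,1,1,8,12,2,7,7)$. Then $\alpha$ is a positive real root for $Q$ which is not a real Schur root, and there does not exist a sequence of real Schur roots $\beta_1,\dots,\beta_n$ ($n\ge 2$) for $Q$ such that $$X_\alpha\cong\sigma_{X_{\beta_n}}\cdots\sigma_{X_{\beta_2}}(X_{\beta_1}),$$ where, for a positive real root $\beta$, $X_\beta$ denotes the unique (up to isomorphism) indecomposable representation of $Q$ over $k$ of dimension vector $\beta$, and $\sigma_S$ denotes the universal extension functor. (The right-hand side is required to be defined, i.e. at each step the representation to which $\sigma_{X_{\beta_i}}$ is applied lies in $\mathfrak{M}^{-X_{\beta_i}}_{-X_{\beta_i}}$.)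
   Context: All representations are finite dimensional over the field $k$; they are identified with $kQ$-modules. A representation $X$ of $Q$ consists of a vector space $X_i$ for each vertex $i$ and a linear map $X_{i}\to X_{j}$ for each arrow $i\to j$; its dimension vector is $(\dim X_i)_i$, with coordinates listed in the order of the vertices $1,\dots,8$. The Ringel form on $\mathbb{Z}^{Q_0}$ is $\langle\alpha,\beta\rangle=\sum_{i\in Q_0}\alpha[i]\beta[i]-\sum_{x: i\to j \text{ in } Q_1}\alpha[i]\beta[j]$, and $(\alpha,\beta)=\langle\alpha,\beta\rangle+\langle\beta,\alpha\rangle$. For each vertex $i$ (there are no loops), $e_i$ is the coordinate vector at $i$ and $s_i(\alpha)=\alpha-(\alpha,e_i)e_i$ is the simple reflection. The Weyl group $W$ is generated by the $s_i$. A (positive) real root is a vector $\alpha>0$ (i.e. nonzero with nonnegative coordinates) of the form $w(e_i)$ with $w\in W$, $i\in Q_0$. By a theorem of Kac and Schofield, for each positive real root $\beta$ there is, up to isomorphism, a unique indecomposable representation $X_\beta$ over $k$ of dimension vector $\beta$. A positive real root $\beta$ is a real Schur root if $\operatorname{End}_{kQ}(X_\beta)=k$; then also $\operatorname{Ext}^1_{kQ}(X_\beta,X_\beta)=0$. Let $S$ be a representation with $\operatorname{End}_{kQ}(S)=k$ and $\operatorname{Ext}^1_{kQ}(S,S)=0$. Let $\mathfrak{M}^{-S}$ be the full subcategory of all representations $X$ with $\operatorname{Hom}_{kQ}(X,S)=0$, $\mathfrak{M}_{-S}$ the full subcategory of all $X$ with $\operatorname{Hom}_{kQ}(S,X)=0$,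 and $\mathfrak{M}^{-S}_{-S}=\mathfrak{M}^{-S}\cap\mathfrak{M}_{-S}$. Let $\mathfrak{M}^S$ be the full subcategory of all $X$ with $\operatorname{Ext}^1_{kQ}(S,X)=0$ such that no (nonzero) direct summand of $X$ embeds into a direct sum of copies of $S$; $\mathfrak{M}_S$ the full subcategory of all $X$ with $\operatorname{Ext}^1_{kQ}(X,S)=0$ such that no (nonzero) direct summand of $X$ is a quotient of a direct sum of copies of $S$; and $\mathfrak{M}^S_S=\mathfrak{M}^S\cap\mathfrak{M}_S$. The universal extension functor $\sigma_S:\mathfrak{M}^{-S}_{-S}\to\mathfrak{M}^S_S/S$ (the target being the quotient of $\mathfrak{M}^S_S$ modulo the maps factoring through direct sums of copies of $S$; $\sigma_S$ is an equivalence by a result of Ringel) acts on objects by performing the following two constructions successively. First construction $\overline{\sigma}_S$: given $X$ with $\operatorname{Hom}_{kQ}(X,S)=0$, choose a basis $E_1,\dots,E_r$ of $\operatorname{Ext}^1_{kQ}(S,X)$ and let $\overline{\sigma}_S(X)=Z$ be the middle term of the exact sequence $0\to X\to Z\to S^{r}\to 0$ given by $E_1,\dots,E_r$. Second construction $\underline{\sigma}_S$: given $Y$ with $\operatorname{Hom}_{kQ}(S,Y)=0$, choose a basis $E'_1,\dots,E'_s$ of $\operatorname{Ext}^1_{kQ}(Y,S)$ and let $\underline{\sigma}_S(Y)=U$ be the middle term of the exact sequence $0\to S^{s}\to U\to Y\to 0$ given by $E'_1,\dots,E'_s$. For $X\in\mathfrak{M}^{-S}_{-S}$, the result of applying both is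 well defined up to isomorphism: since $\operatorname{Ext}^1_{kQ}(S,S)=0$ and $kQ$ is hereditary, one may form the universal extension of $X$ on one side and then, using a basis of the extension group on the other side, the universal extension on the other side (so $\sigma_S(X)$ has a filtration $0\subseteq U_1\subseteq U_2\subseteq\sigma_S(X)$ with $U_1\cong S^{s}$, $U_2/U_1\cong X$, $\sigma_S(X)/U_2\cong S^{r}$, where $r=\dim\operatorname{Ext}^1_{kQ}(S,X)$ and $s=\dim\operatorname{Ext}^1_{kQ}(X,S)$). *)

theory Defs
  imports "Graph_Theory.Digraph" "Jordan_Normal_Form.Matrix"
begin

section \<open>Representations of a quiver\<close>

text \<open>
  A quiver is a finite directed multigraph. A finite dimensional representation over a field
  is given with the spaces \<open>k ^ d\<close> at the vertices, so the linear map of an arrow is a matrix.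
  The values of \<open>vdim\<close> outside the vertices and of \<open>amap\<close> outside the arrows carry no information:
  every notion below looks only at vertices and arrows of the quiver.
\<close>

record ('v, 'a, 'k) quiver_rep =
  vdim :: "'v \<Rightarrow> nat"
  amap :: "'a \<Rightarrow> 'k mat"

definition is_rep :: "('v, 'a) pre_digraph \<Rightarrow> ('v, 'a, 'k) quiver_rep \<Rightarrow> bool" where
  "is_rep Q X \<longleftrightarrow>
     (\<forall>a\<in>arcs Q. amap X a \<in> carrier_mat (vdim X (head Q a)) (vdim X (tail Q a)))"

definition dimvec :: "('v, 'a) pre_digraph \<Rightarrow> ('v, 'a, 'k) quiver_rep \<Rightarrow> 'v \<Rightarrow> int" where
  "dimvec Q X = (\<lambda>i. if i \<in> verts Q then int (vdim X i) else 0)"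

definition qhom :: "('v, 'a) pre_digraph \<Rightarrow> ('v, 'a, 'k::field) quiver_rep
    \<Rightarrow> ('v, 'a, 'k) quiver_rep \<Rightarrow> ('v \<Rightarrow> 'k mat) set" where
  "qhom Q X Y = {f. (\<forall>i\<in>verts Q. f i \<in> carrier_mat (vdim Y i) (vdim X i)) \<and>
     (\<forall>a\<in>arcs Q. amap Y a * f (tail Q a) = f (head Q a) * amap X a)}"

definition qhom_zero :: "('v, 'a) pre_digraph \<Rightarrow> ('v, 'a, 'k::field) quiver_rep
    \<Rightarrow> ('v, 'a, 'k) quiver_rep \<Rightarrow> bool" where
  "qhom_zero Q X Y \<longleftrightarrow> (\<forall>f\<in>qhom Q X Y. \<forall>i\<in>verts Q. f i = 0\<^sub>m (vdim Y i) (vdim X i))"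

definition qiso :: "('v, 'a) pre_digraph \<Rightarrow> ('v, 'a, 'k::field) quiver_rep
    \<Rightarrow> ('v, 'a, 'k) quiver_rep \<Rightarrow> bool" where
  "qiso Q X Y \<longleftrightarrow> (\<exists>f\<in>qhom Q X Y. \<exists>g\<in>qhom Q Y X. \<forall>i\<in>verts Q.
     g i * f i = 1\<^sub>m (vdim X i) \<and> f i * g i = 1\<^sub>m (vdim Y i))"

definition is_zero_rep :: "('v, 'a) pre_digraph \<Rightarrow> ('v, 'a, 'k) quiver_rep \<Rightarrow> bool" where
  "is_zero_rep Q X \<longleftrightarrow> (\<forall>i\<in>verts Q. vdim X i = 0)"

definition direct_sum :: "('v, 'a, 'k::field) quiver_rep \<Rightarrow> ('v, 'a, 'k) quiver_rep
    \<Rightarrow> ('v, 'a, 'k) quiver_rep" where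
  "direct_sum X Y = \<lparr> vdim = (\<lambda>i. vdim X i + vdim Y i),
     amap = (\<lambda>a. diag_block_mat [amap X a, amap Y a]) \<rparr>"

definition direct_power :: "nat \<Rightarrow> ('v, 'a, 'k::field) quiver_rep \<Rightarrow> ('v, 'a, 'k) quiver_rep" where
  "direct_power r X = \<lparr> vdim = (\<lambda>i. r * vdim X i),
     amap = (\<lambda>a. diag_block_mat (replicate r (amap X a))) \<rparr>"

definition indecomposable :: "('v, 'a) pre_digraph \<Rightarrow> ('v, 'a, 'k::field) quiver_rep \<Rightarrow> bool" where
  "indecomposable Q X \<longleftrightarrow> is_rep Q X \<and> \<not> is_zero_rep Q X \<and>
     (\<forall>Y Z. is_rep Q Y \<and> is_rep Q Z \<and> qiso Q X (direct_sum Y Z) \<longrightarrow>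
        is_zero_rep Q Y \<or> is_zero_rep Q Z)"

text \<open>\<open>End(X) = k\<close>: the zero representation is excluded because its endomorphism ring is \<open>0\<close>.\<close>

definition end_is_field :: "('v, 'a) pre_digraph \<Rightarrow> ('v, 'a, 'k::field) quiver_rep \<Rightarrow> bool" where
  "end_is_field Q X \<longleftrightarrow> \<not> is_zero_rep Q X \<and>
     (\<forall>f\<in>qhom Q X X. \<exists>c. \<forall>i\<in>verts Q. f i = c \<cdot>\<^sub>m 1\<^sub>m (vdim X i))"


section \<open>Extensions\<close>

text \<open>
  Given a family \<open>\<xi>\<close> of linear maps \<open>\<xi>\<^sub>a : Y\<^sub>i \<rightarrow> X\<^sub>j\<close> for the arrows \<open>a : i \<rightarrow> j\<close>, \<open>ext_rep X Y \<xi>\<close> is the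
  middle term of the exact sequence \<open>0 \<rightarrow> X \<rightarrow> Z \<rightarrow> Y \<rightarrow> 0\<close> with \<open>Z\<^sub>i = X\<^sub>i \<oplus> Y\<^sub>i\<close> and the obvious
  inclusion and projection. By the lemmas \<open>short_exact_is_standard\<close> and
  \<open>ses_equiv_iff_cohomologous\<close> below, every short exact sequence is equivalent to one
  of this form, and two of them are equivalent iff the two families differ by a family
  \<open>X\<^sub>a h\<^sub>i - h\<^sub>j Y\<^sub>a\<close>. So the vector space \<open>Ext\<^sup>1(Y,X)\<close> of extension classes is the quotient of the
  space of all \<open>\<xi>\<close> by these coboundaries; this is also \<open>Ext\<^sup>1(Y,X)\<close> as computed from the
  standard projective resolution of \<open>Y\<close>.
\<close>

definition cocycles :: "('v, 'a) pre_digraph \<Rightarrow> ('v, 'a, 'k::field) quiver_rep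
    \<Rightarrow> ('v, 'a, 'k) quiver_rep \<Rightarrow> ('a \<Rightarrow> 'k mat) set" where
  "cocycles Q Y X =
     {\<xi>. \<forall>a\<in>arcs Q. \<xi> a \<in> carrier_mat (vdim X (head Q a)) (vdim Y (tail Q a))}"

definition cohomologous :: "('v, 'a) pre_digraph \<Rightarrow> ('v, 'a, 'k::field) quiver_rep
    \<Rightarrow> ('v, 'a, 'k) quiver_rep \<Rightarrow> ('a \<Rightarrow> 'k mat) \<Rightarrow> ('a \<Rightarrow> 'k mat) \<Rightarrow> bool" where
  "cohomologous Q Y X \<xi> \<eta> \<longleftrightarrow>
     (\<exists>h. (\<forall>i\<in>verts Q. h i \<in> carrier_mat (vdim X i) (vdim Y i)) \<and>
          (\<forall>a\<in>arcs Q. \<xi> a - \<eta> a = amap X a * h (tail Q a) - h (head Q a) * amap Y a))"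

definition ext_rep :: "('v, 'a) pre_digraph \<Rightarrow> ('v, 'a, 'k::field) quiver_rep
    \<Rightarrow> ('v, 'a, 'k) quiver_rep \<Rightarrow> ('a \<Rightarrow> 'k mat) \<Rightarrow> ('v, 'a, 'k) quiver_rep" where
  "ext_rep Q X Y \<xi> = \<lparr> vdim = (\<lambda>i. vdim X i + vdim Y i),
     amap = (\<lambda>a. four_block_mat (amap X a) (\<xi> a)
                   (0\<^sub>m (vdim Y (head Q a)) (vdim X (tail Q a))) (amap Y a)) \<rparr>"

definition ext1_zero :: "('v, 'a) pre_digraph \<Rightarrow> ('v, 'a, 'k::field) quiver_rep
    \<Rightarrow> ('v, 'a, 'k) quiver_rep \<Rightarrow> bool" where
  "ext1_zero Q Y X \<longleftrightarrow> (\<forall>\<xi>\<in>cocycles Q Y X.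
     cohomologous Q Y X \<xi> (\<lambda>a. 0\<^sub>m (vdim X (head Q a)) (vdim Y (tail Q a))))"

definition lincomb_cocycles :: "('v, 'a) pre_digraph \<Rightarrow> ('v, 'a, 'k::field) quiver_rep
    \<Rightarrow> ('v, 'a, 'k) quiver_rep \<Rightarrow> 'k list \<Rightarrow> ('a \<Rightarrow> 'k mat) list \<Rightarrow> 'a \<Rightarrow> 'k mat" where
  "lincomb_cocycles Q Y X cs \<xi>s = (\<lambda>a. mat (vdim X (head Q a)) (vdim Y (tail Q a))
     (\<lambda>(p, q). \<Sum>j<length \<xi>s. cs ! j * (\<xi>s ! j) a $$ (p, q)))"

text \<open>The classes of the members of \<open>\<xi>s\<close> form a basis of \<open>Ext\<^sup>1(Y,X)\<close>.\<close>

definition ext1_basis :: "('v, 'a) pre_digraph \<Rightarrow> ('v, 'a, 'k::field) quiver_rep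
    \<Rightarrow> ('v, 'a, 'k) quiver_rep \<Rightarrow> ('a \<Rightarrow> 'k mat) list \<Rightarrow> bool" where
  "ext1_basis Q Y X \<xi>s \<longleftrightarrow> set \<xi>s \<subseteq> cocycles Q Y X \<and>
     (\<forall>\<eta>\<in>cocycles Q Y X. \<exists>!cs. length cs = length \<xi>s \<and>
        cohomologous Q Y X \<eta> (lincomb_cocycles Q Y X cs \<xi>s))"

text \<open>
  For families \<open>\<xi>\<^sub>1, \<dots>, \<xi>\<^sub>r\<close> representing elements of \<open>Ext\<^sup>1(S,X)\<close>, \<open>cocycle_row\<close> is the block row
  \<open>(\<xi>\<^sub>1 \<dots> \<xi>\<^sub>r)\<close>, which represents the corresponding element of \<open>Ext\<^sup>1(S\<^sup>r,X) = Ext\<^sup>1(S,X)\<^sup>r\<close>.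
  Dually, \<open>cocycle_col\<close> represents the element of \<open>Ext\<^sup>1(Y,S\<^sup>r) = Ext\<^sup>1(Y,S)\<^sup>r\<close>.
\<close>

definition cocycle_row :: "('v, 'a) pre_digraph \<Rightarrow> ('v, 'a, 'k::field) quiver_rep
    \<Rightarrow> ('v, 'a, 'k) quiver_rep \<Rightarrow> ('a \<Rightarrow> 'k mat) list \<Rightarrow> 'a \<Rightarrow> 'k mat" where
  "cocycle_row Q S X \<xi>s =
     (\<lambda>a. let m = vdim X (head Q a); n = vdim S (tail Q a) in
        mat m (length \<xi>s * n) (\<lambda>(p, q). (\<xi>s ! (q div n)) a $$ (p, q mod n)))"

definition cocycle_col :: "('v, 'a) pre_digraph \<Rightarrow> ('v, 'a, 'k::field) quiver_rep
    \<Rightarrow> ('v, 'a, 'k) quiver_rep \<Rightarrow> ('a \<Rightarrow> 'k mat) list \<Rightarrow> 'a \<Rightarrow> 'k mat" where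
  "cocycle_col Q Y S \<xi>s =
     (\<lambda>a. let m = vdim S (head Q a); n = vdim Y (tail Q a) in
        mat (length \<xi>s * m) n (\<lambda>(p, q). (\<xi>s ! (p div m)) a $$ (p mod m, q)))"


subsection \<open>Comparison with short exact sequences\<close>

definition short_exact :: "('v, 'a) pre_digraph \<Rightarrow> ('v, 'a, 'k::field) quiver_rep
    \<Rightarrow> ('v \<Rightarrow> 'k mat) \<Rightarrow> ('v, 'a, 'k) quiver_rep \<Rightarrow> ('v \<Rightarrow> 'k mat)
    \<Rightarrow> ('v, 'a, 'k) quiver_rep \<Rightarrow> bool" where
  "short_exact Q X f Z g Y \<longleftrightarrow> f \<in> qhom Q X Z \<and> g \<in> qhom Q Z Y \<and>
     (\<forall>i\<in>verts Q.
        (\<forall>x\<in>carrier_vec (vdim X i). f i *\<^sub>v x = 0\<^sub>v (vdim Z i) \<longrightarrow> x = 0\<^sub>v (vdim X i)) \<and>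
        (\<forall>y\<in>carrier_vec (vdim Y i). \<exists>z\<in>carrier_vec (vdim Z i). g i *\<^sub>v z = y) \<and>
        (\<forall>z\<in>carrier_vec (vdim Z i). g i *\<^sub>v z = 0\<^sub>v (vdim Y i) \<longleftrightarrow>
           (\<exists>x\<in>carrier_vec (vdim X i). f i *\<^sub>v x = z)))"

text \<open>Equivalence of exact sequences \<open>0 \<rightarrow> X \<rightarrow> Z \<rightarrow> Y \<rightarrow> 0\<close> and \<open>0 \<rightarrow> X \<rightarrow> Z' \<rightarrow> Y \<rightarrow> 0\<close>.\<close>

definition ses_equiv :: "('v, 'a) pre_digraph \<Rightarrow> ('v \<Rightarrow> 'k::field mat) \<Rightarrow> ('v, 'a, 'k) quiver_rep
    \<Rightarrow> ('v \<Rightarrow> 'k mat) \<Rightarrow> ('v \<Rightarrow> 'k mat) \<Rightarrow> ('v, 'a, 'k) quiver_rep \<Rightarrow> ('v \<Rightarrow> 'k mat) \<Rightarrow> bool" where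
  "ses_equiv Q f Z g f' Z' g' \<longleftrightarrow>
     (\<exists>h\<in>qhom Q Z Z'. \<forall>i\<in>verts Q. h i * f i = f' i \<and> g' i * h i = g i)"

definition std_incl :: "('v, 'a, 'k::field) quiver_rep \<Rightarrow> ('v, 'a, 'k) quiver_rep \<Rightarrow> 'v \<Rightarrow> 'k mat" where
  "std_incl X Y i = four_block_mat (1\<^sub>m (vdim X i)) (0\<^sub>m (vdim X i) 0)
                      (0\<^sub>m (vdim Y i) (vdim X i)) (0\<^sub>m (vdim Y i) 0)"

definition std_proj :: "('v, 'a, 'k::field) quiver_rep \<Rightarrow> ('v, 'a, 'k) quiver_rep \<Rightarrow> 'v \<Rightarrow> 'k mat" where
  "std_proj X Y i = four_block_mat (0\<^sub>m (vdim Y i) (vdim X i)) (1\<^sub>m (vdim Y i))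
                      (0\<^sub>m 0 (vdim X i)) (0\<^sub>m 0 (vdim Y i))"

lemma std_incl_index:
  "std_incl X Y i \<in> carrier_mat (vdim X i + vdim Y i) (vdim X i)"
  "p < vdim X i + vdim Y i \<Longrightarrow> q < vdim X i \<Longrightarrow> std_incl X Y i $$ (p, q) = (if p = q then 1 else 0)"
  by (auto simp: std_incl_def)

lemma std_proj_index:
  "std_proj X Y i \<in> carrier_mat (vdim Y i) (vdim X i + vdim Y i)"
  "p < vdim Y i \<Longrightarrow> q < vdim X i + vdim Y i \<Longrightarrow>
     std_proj X Y i $$ (p, q) = (if q = vdim X i + p then 1 else 0)"
  by (auto simp: std_proj_def)

lemma unitriangular_iff:
  fixes A :: "'k::field mat"
  assumes A: "A \<in> carrier_mat (vdim X i + vdim Y i) (vdim X i + vdim Y i)"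
  shows "A * std_incl X Y i = std_incl X Y i \<and> std_proj X Y i * A = std_proj X Y i \<longleftrightarrow>
    (\<exists>u\<in>carrier_mat (vdim X i) (vdim Y i).
       A = four_block_mat (1\<^sub>m (vdim X i)) u (0\<^sub>m (vdim Y i) (vdim X i)) (1\<^sub>m (vdim Y i)))"
    (is "?L \<longleftrightarrow> ?R")
proof
  let ?x = "vdim X i" and ?y = "vdim Y i"
  have I: "(A * std_incl X Y i) $$ (p, q) = A $$ (p, q)" if "p < ?x + ?y" "q < ?x" for p q
  proof -
    have "(A * std_incl X Y i) $$ (p, q) = (\<Sum>j<?x + ?y. A $$ (p, j) * (if j = q then 1 else 0))"
      using that A std_incl_index(1)[of X Y i]
      by (auto simp: scalar_prod_def atLeast0LessThan std_incl_index(2) intro!: sum.cong)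
    also have "\<dots> = A $$ (p, q)" using that by (simp add: if_distrib[where f = "\<lambda>c. _ * c"] cong: if_cong)
    finally show ?thesis .
  qed
  have P: "(std_proj X Y i * A) $$ (p, q) = A $$ (?x + p, q)" if "p < ?y" "q < ?x + ?y" for p q
  proof -
    have "(std_proj X Y i * A) $$ (p, q) = (\<Sum>j<?x + ?y. (if j = ?x + p then 1 else 0) * A $$ (j, q))"
      using that A std_proj_index(1)[of X Y i]
      by (auto simp: scalar_prod_def atLeast0LessThan std_proj_index(2) intro!: sum.cong)
    also have "\<dots> = A $$ (?x + p, q)" using that by (simp add: if_distrib[where f = "\<lambda>c. c * _"] cong: if_cong)
    finally show ?thesis .
  qed
  {
    assume L: ?L
    have 1: "A $$ (p, q) = (if p = q then 1 else 0)" if "p < ?x + ?y" "q < ?x" for p q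
      using I[OF that] L std_incl_index(2)[OF that] by simp
    have 2: "A $$ (?x + p, q) = (if q = ?x + p then 1 else 0)" if "p < ?y" "q < ?x + ?y" for p q
      using P[OF that] L std_proj_index(2)[OF that] by simp
    have 3: "A $$ (p, q) = (if q = p then 1 else 0)" if "\<not> p < ?x" "p < ?x + ?y" "q < ?x + ?y" for p q
      using 2[of "p - ?x" q] that by auto
    show ?R
    proof (rule bexI)
      show "mat ?x ?y (\<lambda>(p, q). A $$ (p, ?x + q)) \<in> carrier_mat ?x ?y" by simp
      show "A = four_block_mat (1\<^sub>m ?x) (mat ?x ?y (\<lambda>(p, q). A $$ (p, ?x + q))) (0\<^sub>m ?y ?x) (1\<^sub>m ?y)"
        using A 1 3 by (intro eq_matI) auto
    qed
  }
  {
    assume ?R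
    then obtain u where u: "u \<in> carrier_mat ?x ?y"
      and Au: "A = four_block_mat (1\<^sub>m ?x) u (0\<^sub>m ?y ?x) (1\<^sub>m ?y)" by auto
    have "A * std_incl X Y i = std_incl X Y i"
    proof (rule eq_matI)
      fix p q assume "p < dim_row (std_incl X Y i)" "q < dim_col (std_incl X Y i)"
      then have pq: "p < ?x + ?y" "q < ?x" using std_incl_index(1)[of X Y i] by auto
      show "(A * std_incl X Y i) $$ (p, q) = std_incl X Y i $$ (p, q)"
        unfolding I[OF pq] std_incl_index(2)[OF pq] using pq u by (auto simp: Au)
    qed (use A std_incl_index(1)[of X Y i] in auto)
    moreover have "std_proj X Y i * A = std_proj X Y i"
    proof (rule eq_matI)
      fix p q assume "p < dim_row (std_proj X Y i)" "q < dim_col (std_proj X Y i)"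
      then have pq: "p < ?y" "q < ?x + ?y" using std_proj_index(1)[of X Y i] by auto
      show "(std_proj X Y i * A) $$ (p, q) = std_proj X Y i $$ (p, q)"
        unfolding P[OF pq] std_proj_index(2)[OF pq] using pq u by (auto simp: Au)
    qed (use A std_proj_index(1)[of X Y i] in auto)
    ultimately show ?L ..
  }
qed

lemma unitriangular_intertwines_iff:
  fixes A :: "'k::field mat"
  assumes "A \<in> carrier_mat m n" "B \<in> carrier_mat m' n'" "\<xi> \<in> carrier_mat m n'" "\<eta> \<in> carrier_mat m n'"
    "u \<in> carrier_mat n n'" "v \<in> carrier_mat m m'"
  shows "four_block_mat A \<eta> (0\<^sub>m m' n) B * four_block_mat (1\<^sub>m n) u (0\<^sub>m n' n) (1\<^sub>m n') =
         four_block_mat (1\<^sub>m m) v (0\<^sub>m m' m) (1\<^sub>m m') * four_block_mat A \<xi> (0\<^sub>m m' n) B \<longleftrightarrow>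
         \<xi> - \<eta> = A * u - v * B"
proof -
  have l: "four_block_mat A \<eta> (0\<^sub>m m' n) B * four_block_mat (1\<^sub>m n) u (0\<^sub>m n' n) (1\<^sub>m n')
      = four_block_mat A (A * u + \<eta>) (0\<^sub>m m' n) B"
    using assms by (subst mult_four_block_mat[of _ m n _ n' _ m' _ _ n _ n']) auto
  have r: "four_block_mat (1\<^sub>m m) v (0\<^sub>m m' m) (1\<^sub>m m') * four_block_mat A \<xi> (0\<^sub>m m' n) B
      = four_block_mat A (\<xi> + v * B) (0\<^sub>m m' n) B"
    using assms by (subst mult_four_block_mat[of _ m m _ m' _ m' _ _ n _ n']) auto
  have e: "four_block_mat A C (0\<^sub>m m' n) B = four_block_mat A D (0\<^sub>m m' n) B \<longleftrightarrow> C = D"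
    if C: "C \<in> carrier_mat m n'" and D: "D \<in> carrier_mat m n'" for C D
  proof
    assume eq: "four_block_mat A C (0\<^sub>m m' n) B = four_block_mat A D (0\<^sub>m m' n) B"
    show "C = D"
    proof (rule eq_matI)
      fix p q assume "p < dim_row D" "q < dim_col D"
      then show "C $$ (p, q) = D $$ (p, q)"
        using assms C D arg_cong[OF eq, of "\<lambda>M. M $$ (p, n + q)"] by auto
    qed (use C D in auto)
  qed simp
  have "four_block_mat A (A * u + \<eta>) (0\<^sub>m m' n) B = four_block_mat A (\<xi> + v * B) (0\<^sub>m m' n) B \<longleftrightarrow>
      A * u + \<eta> = \<xi> + v * B"
    using assms by (intro e) auto
  also have "\<dots> \<longleftrightarrow> \<xi> - \<eta> = A * u - v * B" (is "?l \<longleftrightarrow> ?r")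
  proof -
    define a where "a = A * u"
    define b where "b = v * B"
    have ab: "a \<in> carrier_mat m n'" "b \<in> carrier_mat m n'"
      using assms by (auto simp: a_def b_def)
    have "a + \<eta> = \<xi> + b \<longleftrightarrow> (\<forall>p<m. \<forall>q<n'. a $$ (p, q) + \<eta> $$ (p, q) = \<xi> $$ (p, q) + b $$ (p, q))"
      using assms ab by (auto simp: mat_eq_iff)
    also have "\<dots> \<longleftrightarrow> (\<forall>p<m. \<forall>q<n'. \<xi> $$ (p, q) - \<eta> $$ (p, q) = a $$ (p, q) - b $$ (p, q))"
      by (auto simp: algebra_simps add_eq_0_iff2)
    also have "\<dots> \<longleftrightarrow> \<xi> - \<eta> = a - b"
      using assms ab by (auto simp: mat_eq_iff)
    finally show ?thesis unfolding a_def b_def .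
  qed
  finally show ?thesis unfolding l r .
qed

theorem ses_equiv_iff_cohomologous:
  fixes X Y :: "('v, 'a, 'k::field) quiver_rep"
  assumes Q: "wf_digraph Q" and X: "is_rep Q X" and Y: "is_rep Q Y"
    and \<xi>: "\<xi> \<in> cocycles Q Y X" and \<eta>: "\<eta> \<in> cocycles Q Y X"
  shows "ses_equiv Q (std_incl X Y) (ext_rep Q X Y \<xi>) (std_proj X Y)
           (std_incl X Y) (ext_rep Q X Y \<eta>) (std_proj X Y) \<longleftrightarrow> cohomologous Q Y X \<xi> \<eta>"
    (is "?L \<longleftrightarrow> ?R")
proof -
  interpret wf_digraph Q by (rule Q)
  let ?b = "\<lambda>u i. four_block_mat (1\<^sub>m (vdim X i)) (u i) (0\<^sub>m (vdim Y i) (vdim X i)) (1\<^sub>m (vdim Y i))"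
  have key: "amap (ext_rep Q X Y \<eta>) a * ?b u (tail Q a) = ?b u (head Q a) * amap (ext_rep Q X Y \<xi>) a
      \<longleftrightarrow> \<xi> a - \<eta> a = amap X a * u (tail Q a) - u (head Q a) * amap Y a"
    if a: "a \<in> arcs Q" and u: "\<forall>i\<in>verts Q. u i \<in> carrier_mat (vdim X i) (vdim Y i)" for a u
    unfolding ext_rep_def quiver_rep.simps
    by (rule unitriangular_intertwines_iff)
      (use a u X Y \<xi> \<eta> in \<open>auto simp: is_rep_def cocycles_def\<close>)
  show ?thesis
  proof
    assume ?L
    then obtain h where h: "h \<in> qhom Q (ext_rep Q X Y \<xi>) (ext_rep Q X Y \<eta>)"
      and hi: "\<forall>i\<in>verts Q. h i * std_incl X Y i = std_incl X Y i \<and> std_proj X Y i * h i = std_proj X Y i"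
      unfolding ses_equiv_def by auto
    have "\<forall>i\<in>verts Q. \<exists>u. u \<in> carrier_mat (vdim X i) (vdim Y i) \<and> h i = ?b (\<lambda>_. u) i"
    proof
      fix i assume i: "i \<in> verts Q"
      then have "h i \<in> carrier_mat (vdim X i + vdim Y i) (vdim X i + vdim Y i)"
        using h by (auto simp: qhom_def ext_rep_def)
      from unitriangular_iff[OF this] hi i
      show "\<exists>u. u \<in> carrier_mat (vdim X i) (vdim Y i) \<and> h i = ?b (\<lambda>_. u) i" by auto
    qed
    then obtain u where u: "\<forall>i\<in>verts Q. u i \<in> carrier_mat (vdim X i) (vdim Y i)"
      and hu: "\<forall>i\<in>verts Q. h i = ?b u i" by metis
    have "\<forall>a\<in>arcs Q. \<xi> a - \<eta> a = amap X a * u (tail Q a) - u (head Q a) * amap Y a"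
    proof
      fix a assume a: "a \<in> arcs Q"
      then have "amap (ext_rep Q X Y \<eta>) a * h (tail Q a) = h (head Q a) * amap (ext_rep Q X Y \<xi>) a"
        using h by (auto simp: qhom_def)
      then show "\<xi> a - \<eta> a = amap X a * u (tail Q a) - u (head Q a) * amap Y a"
        using key[OF a u] hu a by simp
    qed
    with u show ?R unfolding cohomologous_def by blast
  next
    assume ?R
    then obtain u where u: "\<forall>i\<in>verts Q. u i \<in> carrier_mat (vdim X i) (vdim Y i)"
      and ua: "\<forall>a\<in>arcs Q. \<xi> a - \<eta> a = amap X a * u (tail Q a) - u (head Q a) * amap Y a"
      unfolding cohomologous_def by blast
    have c: "?b u i \<in> carrier_mat (vdim X i + vdim Y i) (vdim X i + vdim Y i)" if "i \<in> verts Q" for i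
      using u that by auto
    define h where "h = ?b u"
    have "h \<in> qhom Q (ext_rep Q X Y \<xi>) (ext_rep Q X Y \<eta>)"
      unfolding qhom_def h_def using key[OF _ u] ua c by (auto simp: ext_rep_def)
    moreover have "h i * std_incl X Y i = std_incl X Y i \<and> std_proj X Y i * h i = std_proj X Y i"
      if i: "i \<in> verts Q" for i
      unfolding h_def using unitriangular_iff[OF c[OF i]] u i by blast
    ultimately show ?L unfolding ses_equiv_def by blast
  qed
qed

lemma mat_mult_unit_vec_index:
  fixes A :: "'k::field mat"
  assumes "A \<in> carrier_mat m n" "p < m" "q < n"
  shows "(A *\<^sub>v unit_vec n q) $ p = A $$ (p, q)"
  using assms by simp

lemma mult_mat_vec_cols_eqI:
  fixes A :: "'k::field mat"
  assumes "A \<in> carrier_mat m n" "B \<in> carrier_mat m n"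
    and "\<And>q. q < n \<Longrightarrow> A *\<^sub>v unit_vec n q = B *\<^sub>v unit_vec n q"
  shows "A = B"
proof (rule eq_matI)
  fix p q assume "p < dim_row B" "q < dim_col B"
  then have pq: "p < m" "q < n" using assms by auto
  show "A $$ (p, q) = B $$ (p, q)"
    using arg_cong[OF assms(3)[OF pq(2)], of "\<lambda>v. v $ p"] pq assms(1,2)
    by (simp add: mat_mult_unit_vec_index)
qed (use assms in auto)

lemma mat_of_column_choice:
  fixes A :: "'k::field mat"
  assumes A: "A \<in> carrier_mat m n" and B: "B \<in> carrier_mat m l"
    and ex: "\<And>q. q < l \<Longrightarrow> \<exists>z\<in>carrier_vec n. A *\<^sub>v z = B *\<^sub>v unit_vec l q"
  shows "\<exists>C\<in>carrier_mat n l. A * C = B"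
proof -
  from ex obtain z where z: "\<And>q. q < l \<Longrightarrow> z q \<in> carrier_vec n \<and> A *\<^sub>v z q = B *\<^sub>v unit_vec l q"
    by metis
  let ?C = "mat n l (\<lambda>(p, q). z q $ p)"
  have "?C *\<^sub>v unit_vec l q = z q" if "q < l" for q
    using z[OF that] that by (intro eq_vecI) auto
  then have "A * ?C = B"
    using A B z by (intro mult_mat_vec_cols_eqI[of _ m l])
      (auto simp: assoc_mult_mat_vec[OF A, of ?C l])
  then show ?thesis by (intro bexI[of _ ?C]) auto
qed

theorem short_exact_is_standard:
  fixes X Y Z :: "('v, 'a, 'k::field) quiver_rep"
  assumes Q: "wf_digraph Q" and X: "is_rep Q X" and Y: "is_rep Q Y" and Z: "is_rep Q Z"
    and se: "short_exact Q X f Z g Y"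
  shows "\<exists>\<xi>\<in>cocycles Q Y X.
    ses_equiv Q (std_incl X Y) (ext_rep Q X Y \<xi>) (std_proj X Y) f Z g"
proof -
  interpret wf_digraph Q by (rule Q)
  have fc: "f i \<in> carrier_mat (vdim Z i) (vdim X i)" and gc: "g i \<in> carrier_mat (vdim Y i) (vdim Z i)"
    if "i \<in> verts Q" for i
    using se that by (auto simp: short_exact_def qhom_def)
  have ex: "g i *\<^sub>v z = 0\<^sub>v (vdim Y i) \<longleftrightarrow> (\<exists>x\<in>carrier_vec (vdim X i). f i *\<^sub>v x = z)"
    if "i \<in> verts Q" "z \<in> carrier_vec (vdim Z i)" for i z
    using se that by (auto simp: short_exact_def)
  have "\<exists>s\<in>carrier_mat (vdim Z i) (vdim Y i). g i * s = 1\<^sub>m (vdim Y i)" if "i \<in> verts Q" for i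
    using se that by (intro mat_of_column_choice[OF gc]) (auto simp: short_exact_def)
  then obtain s where sc: "\<And>i. i \<in> verts Q \<Longrightarrow> s i \<in> carrier_mat (vdim Z i) (vdim Y i)"
    and gs: "\<And>i. i \<in> verts Q \<Longrightarrow> g i * s i = 1\<^sub>m (vdim Y i)" by metis
  have gf: "g i * f i = 0\<^sub>m (vdim Y i) (vdim X i)" if i: "i \<in> verts Q" for i
  proof (rule mult_mat_vec_cols_eqI)
    show "g i * f i \<in> carrier_mat (vdim Y i) (vdim X i)" using fc[OF i] gc[OF i] by auto
    fix q assume q: "q < vdim X i"
    have "g i *\<^sub>v (f i *\<^sub>v unit_vec (vdim X i) q) = 0\<^sub>v (vdim Y i)"
      using ex[OF i, of "f i *\<^sub>v unit_vec (vdim X i) q"] fc[OF i] by auto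
    then show "(g i * f i) *\<^sub>v unit_vec (vdim X i) q = 0\<^sub>m (vdim Y i) (vdim X i) *\<^sub>v unit_vec (vdim X i) q"
      using assoc_mult_mat_vec[OF gc[OF i] fc[OF i], of "unit_vec (vdim X i) q"]
      by (auto intro!: eq_vecI)
  qed auto
  let ?D = "\<lambda>a. amap Z a * s (tail Q a) - s (head Q a) * amap Y a"
  have "\<exists>\<xi>\<in>carrier_mat (vdim X (head Q a)) (vdim Y (tail Q a)). f (head Q a) * \<xi> = ?D a"
    if a: "a \<in> arcs Q" for a
  proof (rule mat_of_column_choice)
    let ?t = "tail Q a" and ?h = "head Q a"
    have t: "?t \<in> verts Q" and h: "?h \<in> verts Q" using a by auto
    have Za: "amap Z a \<in> carrier_mat (vdim Z ?h) (vdim Z ?t)"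
      and Ya: "amap Y a \<in> carrier_mat (vdim Y ?h) (vdim Y ?t)"
      using Z Y a by (auto simp: is_rep_def)
    show "f ?h \<in> carrier_mat (vdim Z ?h) (vdim X ?h)" by (rule fc[OF h])
    show D: "?D a \<in> carrier_mat (vdim Z ?h) (vdim Y ?t)"
      using Za Ya sc[OF t] sc[OF h] by auto
    have "g ?h * ?D a = g ?h * (amap Z a * s ?t) - g ?h * (s ?h * amap Y a)"
      using Za Ya sc[OF t] sc[OF h] gc[OF h] by (intro mult_minus_distrib_mat) auto
    also have "g ?h * (amap Z a * s ?t) = (g ?h * amap Z a) * s ?t"
      using Za sc[OF t] gc[OF h] by (intro assoc_mult_mat[symmetric]) auto
    also have "g ?h * amap Z a = amap Y a * g ?t"
      using se a by (auto simp: short_exact_def qhom_def)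
    also have "amap Y a * g ?t * s ?t = amap Y a * (g ?t * s ?t)"
      using Ya sc[OF t] gc[OF t] by (intro assoc_mult_mat) auto
    also have "\<dots> = amap Y a" using gs[OF t] Ya by simp
    also have "g ?h * (s ?h * amap Y a) = (g ?h * s ?h) * amap Y a"
      using Ya sc[OF h] gc[OF h] by (intro assoc_mult_mat[symmetric]) auto
    also have "\<dots> = amap Y a" using gs[OF h] Ya by simp
    finally have gD: "g ?h * ?D a = 0\<^sub>m (vdim Y ?h) (vdim Y ?t)" using Ya by simp
    fix q assume q: "q < vdim Y ?t"
    have "g ?h *\<^sub>v (?D a *\<^sub>v unit_vec (vdim Y ?t) q) = (g ?h * ?D a) *\<^sub>v unit_vec (vdim Y ?t) q"
      using assoc_mult_mat_vec[OF gc[OF h] D, of "unit_vec (vdim Y ?t) q"] by simp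
    also have "\<dots> = 0\<^sub>v (vdim Y ?h)" unfolding gD by (auto intro!: eq_vecI)
    finally show "\<exists>z\<in>carrier_vec (vdim X ?h). f ?h *\<^sub>v z = ?D a *\<^sub>v unit_vec (vdim Y ?t) q"
      using ex[OF h, of "?D a *\<^sub>v unit_vec (vdim Y ?t) q"] D by auto
  qed
  then obtain \<xi> where \<xi>c: "\<And>a. a \<in> arcs Q \<Longrightarrow> \<xi> a \<in> carrier_mat (vdim X (head Q a)) (vdim Y (tail Q a))"
    and f\<xi>: "\<And>a. a \<in> arcs Q \<Longrightarrow> f (head Q a) * \<xi> a = ?D a" by metis
  have \<xi>: "\<xi> \<in> cocycles Q Y X" using \<xi>c by (auto simp: cocycles_def)
  define h where "h = (\<lambda>i. four_block_mat (f i) (s i) (0\<^sub>m 0 (vdim X i)) (0\<^sub>m 0 (vdim Y i)))"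
  have hc: "h i \<in> carrier_mat (vdim Z i) (vdim X i + vdim Y i)" if "i \<in> verts Q" for i
    using fc[OF that] sc[OF that] by (auto simp: h_def)
  have "h \<in> qhom Q (ext_rep Q X Y \<xi>) Z"
    unfolding qhom_def
  proof (intro CollectI conjI ballI)
    fix i assume "i \<in> verts Q"
    then show "h i \<in> carrier_mat (vdim Z i) (vdim (ext_rep Q X Y \<xi>) i)"
      using hc by (auto simp: ext_rep_def)
  next
    fix a assume a: "a \<in> arcs Q"
    let ?t = "tail Q a" and ?w = "head Q a"
    have t: "?t \<in> verts Q" and w: "?w \<in> verts Q" using a by auto
    have Za: "amap Z a \<in> carrier_mat (vdim Z ?w) (vdim Z ?t)"
      and Ya: "amap Y a \<in> carrier_mat (vdim Y ?w) (vdim Y ?t)"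
      and Xa: "amap X a \<in> carrier_mat (vdim X ?w) (vdim X ?t)"
      using X Z Y a by (auto simp: is_rep_def)
    have Zb: "amap Z a = four_block_mat (amap Z a) (0\<^sub>m (vdim Z ?w) 0) (0\<^sub>m 0 (vdim Z ?t)) (0\<^sub>m 0 0)"
      using Za by (intro eq_matI) auto
    have "amap Z a * h ?t = four_block_mat (amap Z a * f ?t) (amap Z a * s ?t)
        (0\<^sub>m 0 (vdim X ?t)) (0\<^sub>m 0 (vdim Y ?t))"
      unfolding h_def using Za fc[OF t] sc[OF t]
      by (subst Zb, subst mult_four_block_mat[of _ "vdim Z ?w" "vdim Z ?t" _ 0 _ 0 _ _ "vdim X ?t" _ "vdim Y ?t"])
        auto
    moreover have "h ?w * amap (ext_rep Q X Y \<xi>) a = four_block_mat (f ?w * amap X a)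
        (f ?w * \<xi> a + s ?w * amap Y a) (0\<^sub>m 0 (vdim X ?t)) (0\<^sub>m 0 (vdim Y ?t))"
      using Xa Ya \<xi>c[OF a] fc[OF w] sc[OF w] unfolding h_def ext_rep_def quiver_rep.simps
      by (subst mult_four_block_mat[of _ "vdim Z ?w" "vdim X ?w" _ "vdim Y ?w" _ 0 _ _ "vdim X ?t" _ "vdim Y ?t"])
        auto
    moreover have "amap Z a * f ?t = f ?w * amap X a"
      using se a by (auto simp: short_exact_def qhom_def)
    moreover have "f ?w * \<xi> a + s ?w * amap Y a = amap Z a * s ?t"
      unfolding f\<xi>[OF a] using Za Ya sc[OF t] sc[OF w] by (intro eq_matI) auto
    ultimately show "amap Z a * h ?t = h ?w * amap (ext_rep Q X Y \<xi>) a" by simp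
  qed
  moreover have "h i * std_incl X Y i = f i \<and> g i * h i = std_proj X Y i" if i: "i \<in> verts Q" for i
  proof
    have fb: "f i = four_block_mat (f i) (0\<^sub>m (vdim Z i) 0) (0\<^sub>m 0 (vdim X i)) (0\<^sub>m 0 0)"
      using fc[OF i] by (intro eq_matI) auto
    have "h i * std_incl X Y i =
        four_block_mat (f i) (0\<^sub>m (vdim Z i) 0) (0\<^sub>m 0 (vdim X i)) (0\<^sub>m 0 0)"
      unfolding h_def std_incl_def using fc[OF i] sc[OF i]
      by (subst mult_four_block_mat[of _ "vdim Z i" "vdim X i" _ "vdim Y i" _ 0 _ _ "vdim X i" _ 0]) auto
    then show "h i * std_incl X Y i = f i" by (rule trans[OF _ fb[symmetric]])
    have gb: "g i = four_block_mat (g i) (0\<^sub>m (vdim Y i) 0) (0\<^sub>m 0 (vdim Z i)) (0\<^sub>m 0 0)"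
      using gc[OF i] by (intro eq_matI) auto
    show "g i * h i = std_proj X Y i"
      unfolding h_def std_proj_def using fc[OF i] sc[OF i] gc[OF i] gf[OF i] gs[OF i]
      by (subst gb, subst mult_four_block_mat[of _ "vdim Y i" "vdim Z i" _ 0 _ 0 _ _ "vdim X i" _ "vdim Y i"])
        auto
  qed
  ultimately have "ses_equiv Q (std_incl X Y) (ext_rep Q X Y \<xi>) (std_proj X Y) f Z g"
    unfolding ses_equiv_def by blast
  with \<xi> show ?thesis by blast
qed


section \<open>Universal extensions\<close>

text \<open>\<open>M_up Q S\<close> is \<open>\<MM>\<^sup>-\<^sup>S\<close> and \<open>M_down Q S\<close> is \<open>\<MM>\<^sub>-\<^sub>S\<close>.\<close>

definition M_up :: "('v, 'a) pre_digraph \<Rightarrow> ('v, 'a, 'k::field) quiver_rep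
    \<Rightarrow> ('v, 'a, 'k) quiver_rep set" where
  "M_up Q S = {X. is_rep Q X \<and> qhom_zero Q X S}"

definition M_down :: "('v, 'a) pre_digraph \<Rightarrow> ('v, 'a, 'k::field) quiver_rep
    \<Rightarrow> ('v, 'a, 'k) quiver_rep set" where
  "M_down Q S = {X. is_rep Q X \<and> qhom_zero Q S X}"

definition M_up_down :: "('v, 'a) pre_digraph \<Rightarrow> ('v, 'a, 'k::field) quiver_rep
    \<Rightarrow> ('v, 'a, 'k) quiver_rep set" where
  "M_up_down Q S = M_up Q S \<inter> M_down Q S"

text \<open>
  The universal extensions are determined up to isomorphism only, so they are relations:
  \<open>over_ext Q S X Z\<close> says that \<open>Z\<close> is isomorphic to \<open>\<sigma>\<close> with a line above, applied to \<open>X\<close>;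
  \<open>under_ext\<close> is the second construction, and \<open>universal_ext Q S X U\<close> says that
  \<open>\<sigma>\<^sub>S(X)\<close> is defined and isomorphic to \<open>U\<close>.
\<close>

definition over_ext :: "('v, 'a) pre_digraph \<Rightarrow> ('v, 'a, 'k::field) quiver_rep
    \<Rightarrow> ('v, 'a, 'k) quiver_rep \<Rightarrow> ('v, 'a, 'k) quiver_rep \<Rightarrow> bool" where
  "over_ext Q S X Z \<longleftrightarrow> X \<in> M_up Q S \<and> is_rep Q Z \<and>
     (\<exists>\<xi>s. ext1_basis Q S X \<xi>s \<and>
        qiso Q Z (ext_rep Q X (direct_power (length \<xi>s) S) (cocycle_row Q S X \<xi>s)))"

definition under_ext :: "('v, 'a) pre_digraph \<Rightarrow> ('v, 'a, 'k::field) quiver_rep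
    \<Rightarrow> ('v, 'a, 'k) quiver_rep \<Rightarrow> ('v, 'a, 'k) quiver_rep \<Rightarrow> bool" where
  "under_ext Q S Y U \<longleftrightarrow> Y \<in> M_down Q S \<and> is_rep Q U \<and>
     (\<exists>\<xi>s. ext1_basis Q Y S \<xi>s \<and>
        qiso Q U (ext_rep Q (direct_power (length \<xi>s) S) Y (cocycle_col Q Y S \<xi>s)))"

definition universal_ext :: "('v, 'a) pre_digraph \<Rightarrow> ('v, 'a, 'k::field) quiver_rep
    \<Rightarrow> ('v, 'a, 'k) quiver_rep \<Rightarrow> ('v, 'a, 'k) quiver_rep \<Rightarrow> bool" where
  "universal_ext Q S X U \<longleftrightarrow>
     is_rep Q S \<and> end_is_field Q S \<and> ext1_zero Q S S \<and> X \<in> M_up_down Q S \<and>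
     (\<exists>Z. over_ext Q S X Z \<and> under_ext Q S Z U)"


section \<open>Roots\<close>

definition ringel_form :: "('v, 'a) pre_digraph \<Rightarrow> ('v \<Rightarrow> int) \<Rightarrow> ('v \<Rightarrow> int) \<Rightarrow> int" where
  "ringel_form Q \<alpha> \<beta> =
     (\<Sum>i\<in>verts Q. \<alpha> i * \<beta> i) - (\<Sum>a\<in>arcs Q. \<alpha> (tail Q a) * \<beta> (head Q a))"

definition sym_form :: "('v, 'a) pre_digraph \<Rightarrow> ('v \<Rightarrow> int) \<Rightarrow> ('v \<Rightarrow> int) \<Rightarrow> int" where
  "sym_form Q \<alpha> \<beta> = ringel_form Q \<alpha> \<beta> + ringel_form Q \<beta> \<alpha>"

definition coord_vec :: "'v \<Rightarrow> 'v \<Rightarrow> int" where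
  "coord_vec i = (\<lambda>j. if j = i then 1 else 0)"

definition reflection :: "('v, 'a) pre_digraph \<Rightarrow> 'v \<Rightarrow> ('v \<Rightarrow> int) \<Rightarrow> 'v \<Rightarrow> int" where
  "reflection Q i \<alpha> = (\<lambda>j. \<alpha> j - sym_form Q \<alpha> (coord_vec i) * coord_vec i j)"

text \<open>For a quiver without loops the \<open>reflection Q i\<close> are involutions, hence closure under
  composition already gives the group they generate.\<close>

inductive_set weyl_group :: "('v, 'a) pre_digraph \<Rightarrow> (('v \<Rightarrow> int) \<Rightarrow> 'v \<Rightarrow> int) set"
  for Q :: "('v, 'a) pre_digraph" where
  weyl_id: "id \<in> weyl_group Q"
| weyl_step: "w \<in> weyl_group Q \<Longrightarrow> i \<in> verts Q \<Longrightarrow> reflection Q i \<circ> w \<in> weyl_group Q"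

definition positive_real_root :: "('v, 'a) pre_digraph \<Rightarrow> ('v \<Rightarrow> int) \<Rightarrow> bool" where
  "positive_real_root Q \<alpha> \<longleftrightarrow> (\<exists>w\<in>weyl_group Q. \<exists>i\<in>verts Q. \<alpha> = w (coord_vec i)) \<and>
     (\<forall>i. \<alpha> i \<ge> 0) \<and> (\<exists>i. \<alpha> i \<noteq> 0)"

text \<open>\<open>is_root_rep Q \<beta> X\<close> is \<open>X \<cong> X\<^sub>\<beta>\<close>; the existence of \<open>X\<^sub>\<beta>\<close> and its uniqueness up to isomorphism
  for positive real roots \<open>\<beta>\<close> are the theorem of Kac and Schofield.\<close>

definition is_root_rep :: "('v, 'a) pre_digraph \<Rightarrow> ('v \<Rightarrow> int) \<Rightarrow> ('v, 'a, 'k::field) quiver_rep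
    \<Rightarrow> bool" where
  "is_root_rep Q \<beta> X \<longleftrightarrow> indecomposable Q X \<and> dimvec Q X = \<beta>"

definition real_schur_root :: "'k::field itself \<Rightarrow> ('v, 'a) pre_digraph \<Rightarrow> ('v \<Rightarrow> int) \<Rightarrow> bool" where
  "real_schur_root K Q \<beta> \<longleftrightarrow> positive_real_root Q \<beta> \<and>
     (\<exists>X :: ('v, 'a, 'k) quiver_rep. is_root_rep Q \<beta> X \<and> end_is_field Q X)"


section \<open>The quiver and the root\<close>

definition quiver8 :: "(nat, nat \<times> nat) pre_digraph" where
  "quiver8 = \<lparr> verts = {1..8},
     arcs = {(1, 4), (2, 4), (3, 4), (4, 5), (5, 6), (5, 7), (5, 8)},
     tail = fst, head = snd \<rparr>"

definition alpha8 :: "nat \<Rightarrow> int" where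
  "alpha8 i = (if i \<in> {1..8} then [1, 1, 1, 8, 12, 2, 7, 7] ! (i - 1) else 0)"

end

theory Submission
  imports Defs
begin

text \<open>
  Counting dimensions gives \<open>dim Ext\<^sup>1(S,X) = -\<langle>S,X\<rangle>\<close> if \<open>Hom(S,X) = 0\<close>, and pulling back along
  \<open>X \<rightarrow> Z\<close>, where \<open>Z\<close> is the first universal extension, identifies \<open>Ext\<^sup>1(Z,S)\<close> with
  \<open>Ext\<^sup>1(X,S)\<close>. So \<open>\<sigma>\<^sub>S\<close> acts on dimension vectors as the reflection at \<open>b = dim S\<close>. If it leads
  to \<open>\<alpha>\<close> from a different vector \<open>\<alpha> - m b\<close>, where \<open>m = (\<alpha>,b) > 0\<close> and \<open>\<langle>\<alpha>,b\<rangle>\<close> and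
  \<open>\<langle>b,\<alpha>\<rangle>\<close> are nonnegative, a finite search leaves only
  \<open>b = (0,0,0,1,2,0,1,1)\<close> and \<open>\<alpha> - 5 b = (1,1,1,3,2,2,2,2)\<close>. Then the map \<open>4 \<rightarrow> 5\<close> of \<open>X\<close> has a kernel,
  which gives a nonzero map from \<open>S\<close> to \<open>X\<close>, a contradiction. Hence every term of the sequence, in
  particular the first, has dimension vector \<open>\<alpha>\<close>.

  To see that \<open>\<alpha>\<close> is not a Schur root, write \<open>A : X\<^sub>4 \<rightarrow> X\<^sub>5\<close>, \<open>B, C, D\<close> for the maps from \<open>X\<^sub>5\<close> to
  \<open>X\<^sub>6, X\<^sub>7, X\<^sub>8\<close>. A nonzero vector killed by \<open>B\<close>, \<open>C\<close> and \<open>D\<close> yields a nilpotent endomorphism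
  supported at \<open>5\<close>, so assume there is none. There is a nonzero solution of \<open>A u = x + y\<close>, \<open>B x = B y = 0\<close>, \<open>C x = 0\<close>, \<open>D y = 0\<close>,
  and for suitable row vectors \<open>u \<phi>\<^sub>4\<close>, \<open>x p + y q\<close>, \<open>(C y) \<phi>\<^sub>7\<close>, \<open>(D x) \<phi>\<^sub>8\<close> are the components at
  \<open>4, 5, 7, 8\<close> of a nonzero endomorphism that vanishes at the other vertices.
\<close>

section \<open>Counting unknowns and equations\<close>

text \<open>Gaussian elimination by induction on the equations. An equation with zero coefficients
  is dropped; any other is solved for an unknown with nonzero coefficient and substituted into the
  rest. This removes one equation and one unknown, so the strict inequality persists.\<close>

lemma homogeneous_system_nontrivial_solution:
  fixes a :: "'j \<Rightarrow> 'i \<Rightarrow> 'k::field"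
  assumes "finite J" "finite I" "card J < card I"
  shows "\<exists>x. (\<exists>i\<in>I. x i \<noteq> 0) \<and> (\<forall>j\<in>J. (\<Sum>i\<in>I. a j i * x i) = 0)"
  using assms
proof (induction J arbitrary: I a rule: finite_induct)
  case empty
  then have "I \<noteq> {}" by auto
  then show ?case by (intro exI[of _ "\<lambda>_. 1"]) auto
next
  case (insert j J)
  show ?case
  proof (cases "\<forall>i\<in>I. a j i = 0")
    case True
    have "card J < card I" using insert.prems insert.hyps by simp
    from insert.IH[OF insert.prems(1) this, of a]
    obtain x where "\<exists>i\<in>I. x i \<noteq> 0" "\<forall>m\<in>J. (\<Sum>i\<in>I. a m i * x i) = 0" by blast
    moreover have "(\<Sum>i\<in>I. a j i * x i) = 0" using True by simp
    ultimately show ?thesis by blast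
  next
    case False
    then obtain l where l: "l \<in> I" "a j l \<noteq> 0" by blast
    define I' where "I' = I - {l}"
    have I: "I = insert l I'" "l \<notin> I'" "finite I'" "card J < card I'"
      using l insert.prems insert.hyps by (auto simp: I'_def)
    obtain x where x: "\<exists>i\<in>I'. x i \<noteq> 0"
      and eq: "\<And>m. m \<in> J \<Longrightarrow> (\<Sum>i\<in>I'. (a m i - a m l / a j l * a j i) * x i) = 0"
      using insert.IH[OF I(3,4), of "\<lambda>m i. a m i - a m l / a j l * a j i"] by blast
    \<comment> \<open>The eliminated unknown \<open>l\<close> receives the value dictated by
      equation \<open>j\<close>.\<close>
    define y where "y = x(l := - (\<Sum>i\<in>I'. a j i * x i) / a j l)"
    have s: "(\<Sum>i\<in>I. a m i * y i) = a m l * y l + (\<Sum>i\<in>I'. a m i * x i)" for m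
      unfolding I(1) using I(2,3) by (auto simp: y_def intro!: sum.cong)
    have "(\<Sum>i\<in>I. a j i * y i) = 0" unfolding s using l by (simp add: y_def)
    moreover have "(\<Sum>i\<in>I. a m i * y i) = 0" if "m \<in> J" for m
    proof -
      have "(\<Sum>i\<in>I'. a m i * x i) - a m l / a j l * (\<Sum>i\<in>I'. a j i * x i) = 0"
        using eq[OF that] by (simp only: left_diff_distrib sum_subtractf sum_distrib_left mult.assoc)
      then show ?thesis unfolding s by (simp add: y_def)
    qed
    moreover have "\<exists>i\<in>I. y i \<noteq> 0" using x I(1,2) unfolding y_def by (metis fun_upd_other insertCI)
    ultimately show ?thesis by (intro exI[of _ y] conjI ballI) auto
  qed
qed

lemma card_le_if_linear_injective:
  fixes a :: "'j \<Rightarrow> 'i \<Rightarrow> 'k::field"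
  assumes "finite J" "finite I"
    and "\<And>x. (\<And>j. j \<in> J \<Longrightarrow> (\<Sum>i\<in>I. a j i * x i) = 0) \<Longrightarrow> \<forall>i\<in>I. x i = 0"
  shows "card I \<le> card J"
proof (rule ccontr)
  assume "\<not> card I \<le> card J"
  then have "card J < card I" by simp
  from homogeneous_system_nontrivial_solution[OF assms(1,2) this, of a]
  obtain x where "\<exists>i\<in>I. x i \<noteq> 0" "\<forall>j\<in>J. (\<Sum>i\<in>I. a j i * x i) = 0" by blast
  then show False using assms(3)[of x] by blast
qed

text \<open>The transpose of a surjective matrix is injective: a functional that vanishes on all
  columns vanishes on the image, hence on every unit vector.\<close>

lemma card_le_if_linear_surjective:
  fixes a :: "'j \<Rightarrow> 'i \<Rightarrow> 'k::field"
  assumes J: "finite J" and I: "finite I"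
    and surj: "\<And>y. \<exists>x. \<forall>j\<in>J. (\<Sum>i\<in>I. a j i * x i) = y j"
  shows "card J \<le> card I"
proof (rule card_le_if_linear_injective[OF I J, where a = "\<lambda>i j. a j i"])
  fix y assume y: "\<And>i. i \<in> I \<Longrightarrow> (\<Sum>j\<in>J. a j i * y j) = 0"
  show "\<forall>j\<in>J. y j = 0"
  proof
    fix l assume l: "l \<in> J"
    obtain x where x: "\<forall>j\<in>J. (\<Sum>i\<in>I. a j i * x i) = (if j = l then 1 else 0)"
      using surj[of "\<lambda>j. if j = l then 1 else 0"] by blast
    have "y l = (\<Sum>j\<in>J. (if j = l then y j else 0))"
      using l J by simp
    also have "\<dots> = (\<Sum>j\<in>J. (\<Sum>i\<in>I. a j i * x i) * y j)"
      using x by (intro sum.cong) auto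
    also have "\<dots> = (\<Sum>i\<in>I. x i * (\<Sum>j\<in>J. a j i * y j))"
      unfolding sum_distrib_left sum_distrib_right
      by (subst sum.swap) (simp only: mult_ac)
    also have "\<dots> = 0" using y by simp
    finally show "y l = 0" .
  qed
qed

section \<open>Universal extensions act on dimension vectors by reflections\<close>

lemma index_mult_mat_sum:
  fixes A B :: "'k::semiring_0 mat"
  assumes "A \<in> carrier_mat m n" "B \<in> carrier_mat n l" "p < m" "q < l"
  shows "(A * B) $$ (p, q) = (\<Sum>j<n. A $$ (p, j) * B $$ (j, q))"
  using assms by (auto simp: scalar_prod_def atLeast0LessThan intro!: sum.cong)

text \<open>The left-hand side bundles \<open>(c, h) \<mapsto> \<Sum> c\<^sub>j \<xi>\<^sub>j + (X\<^sub>a h\<^sub>i - h\<^sub>j Y\<^sub>a)\<^sub>a\<close> into one linear map between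
  coordinate spaces, so that dimensions can be compared.\<close>

lemma lincomb_plus_coboundary_index:
  fixes X Y :: "('v, 'a, 'k::field) quiver_rep"
  assumes Q: "wf_digraph Q" and fin: "finite (verts Q)"
    and X: "is_rep Q X" and Y: "is_rep Q Y"
    and h: "\<And>i. i \<in> verts Q \<Longrightarrow> h i \<in> carrier_mat (vdim X i) (vdim Y i)"
    and a: "a \<in> arcs Q" and p: "p < vdim X (head Q a)" and q: "q < vdim Y (tail Q a)"
  shows "(\<Sum>u\<in>{..<length \<xi>s} <+> (SIGMA i:verts Q. {..<vdim X i} \<times> {..<vdim Y i}).
      (case u of Inl j \<Rightarrow> (\<xi>s ! j) a $$ (p, q)
       | Inr (i, p', q') \<Rightarrow>
           (if i = tail Q a \<and> q' = q then amap X a $$ (p, p') else 0)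
           - (if i = head Q a \<and> p' = p then amap Y a $$ (q', q) else 0)) *
      (case u of Inl j \<Rightarrow> cs ! j | Inr (i, p', q') \<Rightarrow> h i $$ (p', q')))
    = (lincomb_cocycles Q Y X cs \<xi>s a + (amap X a * h (tail Q a) - h (head Q a) * amap Y a)) $$ (p, q)"
    (is "?L = ?R")
proof -
  interpret wf_digraph Q by (rule Q)
  let ?t = "tail Q a" and ?w = "head Q a"
  have t: "?t \<in> verts Q" and w: "?w \<in> verts Q" using a by auto
  have Xa: "amap X a \<in> carrier_mat (vdim X ?w) (vdim X ?t)"
    and Ya: "amap Y a \<in> carrier_mat (vdim Y ?w) (vdim Y ?t)"
    using X Y a by (auto simp: is_rep_def)
  let ?f = "\<lambda>i p' q'. (if i = ?t \<and> q' = q then amap X a $$ (p, p') else 0) * h i $$ (p', q')"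
  let ?g = "\<lambda>i p' q'. (if i = ?w \<and> p' = p then amap Y a $$ (q', q) else 0) * h i $$ (p', q')"
  let ?S = "SIGMA i:verts Q. {..<vdim X i} \<times> {..<vdim Y i}"
  have S: "(\<Sum>(i, p', q')\<in>?S. F i p' q') = (\<Sum>i\<in>verts Q. \<Sum>p'<vdim X i. \<Sum>q'<vdim Y i. F i p' q')"
    for F :: "'v \<Rightarrow> nat \<Rightarrow> nat \<Rightarrow> 'k"
    using fin sum.Sigma[of "verts Q" "\<lambda>i. {..<vdim X i} \<times> {..<vdim Y i}" "\<lambda>i (p', q'). F i p' q'"]
    by (simp add: sum.cartesian_product)
  have f: "(\<Sum>(i, p', q')\<in>?S. ?f i p' q') = (amap X a * h ?t) $$ (p, q)"
  proof -
    have "(\<Sum>(i, p', q')\<in>?S. ?f i p' q') =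
        (\<Sum>i\<in>verts Q. if i = ?t then (\<Sum>p'<vdim X ?t. amap X a $$ (p, p') * h ?t $$ (p', q)) else 0)"
      unfolding S using q
      by (intro sum.cong) (auto simp: if_distrib[of "\<lambda>c. c * _"] cong: if_cong)
    then show ?thesis
      using fin t by (simp add: index_mult_mat_sum[OF Xa h[OF t] p q])
  qed
  have g: "(\<Sum>(i, p', q')\<in>?S. ?g i p' q') = (h ?w * amap Y a) $$ (p, q)"
  proof -
    have "(\<Sum>(i, p', q')\<in>?S. ?g i p' q') =
        (\<Sum>i\<in>verts Q. if i = ?w then (\<Sum>q'<vdim Y ?w. h ?w $$ (p, q') * amap Y a $$ (q', q)) else 0)"
      unfolding S using p
      by (intro sum.cong refl, subst sum.swap)
        (auto simp: if_distrib[of "\<lambda>c. c * _"] if_distrib[of "\<lambda>c. _ * c"] mult.commute cong: if_cong)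
    then show ?thesis
      using fin w by (simp add: index_mult_mat_sum[OF h[OF w] Ya p q])
  qed
  have "?L = (\<Sum>j<length \<xi>s. cs ! j * (\<xi>s ! j) a $$ (p, q)) +
      (\<Sum>(i, p', q')\<in>?S. ?f i p' q' - ?g i p' q')"
    using fin by (simp add: sum.Plus algebra_simps split_def)
  also have "(\<Sum>(i, p', q')\<in>?S. ?f i p' q' - ?g i p' q') =
      (\<Sum>(i, p', q')\<in>?S. ?f i p' q') - (\<Sum>(i, p', q')\<in>?S. ?g i p' q')"
    by (simp add: sum_subtractf split_def)
  finally show ?thesis
    unfolding f g using p q Xa Ya h[OF t] h[OF w] by (simp add: lincomb_cocycles_def)
qed

lemma lincomb_cocycles_carrier:
  "lincomb_cocycles Q Y X cs \<xi>s a \<in> carrier_mat (vdim X (head Q a)) (vdim Y (tail Q a))"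
  by (simp add: lincomb_cocycles_def)

text \<open>Coefficients and a family \<open>h\<close> are sent to the combination plus the
  coboundary of \<open>h\<close>. This map onto the cocycles is surjective because the classes span,
  and injective because they are independent and a family with zero coboundary is a morphism.
  Comparing dimensions gives the Ringel form.\<close>

theorem length_ext1_basis:
  fixes X Y :: "('v, 'a, 'k::field) quiver_rep"
  assumes Q: "fin_digraph Q" and X: "is_rep Q X" and Y: "is_rep Q Y"
    and hom0: "qhom_zero Q Y X" and basis: "ext1_basis Q Y X \<xi>s"
  shows "int (length \<xi>s) = - ringel_form Q (dimvec Q Y) (dimvec Q X)"
proof -
  interpret fin_digraph Q by (rule Q)
  note wf = wf_digraph_axioms
  \<comment> \<open>\<open>I\<close> indexes the unknowns (the coefficients and the entries of
    \<open>h\<close>), \<open>J\<close> the entries of a cocycle, and \<open>M\<close> is the matrix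
    of the map between the two coordinate spaces.\<close>
  define I where "I = {..<length \<xi>s} <+> (SIGMA i:verts Q. {..<vdim X i} \<times> {..<vdim Y i})"
  define J where "J = (SIGMA a:arcs Q. {..<vdim X (head Q a)} \<times> {..<vdim Y (tail Q a)})"
  have fin: "finite I" "finite J" by (auto simp: I_def J_def)
  define M where "M = (\<lambda>(a, p, q) u. case u of Inl j \<Rightarrow> (\<xi>s ! j) a $$ (p, q)
       | Inr (i, p', q') \<Rightarrow>
           (if i = tail Q a \<and> q' = q then amap X a $$ (p, p') else 0)
           - (if i = head Q a \<and> p' = p then amap Y a $$ (q', q) else 0))"
  define D where "D = (\<lambda>(h :: 'v \<Rightarrow> 'k mat) a. amap X a * h (tail Q a) - h (head Q a) * amap Y a)"
  define vars where "vars = (\<lambda>(cs :: 'k list) (h :: 'v \<Rightarrow> 'k mat) u. case u of Inl j \<Rightarrow> cs ! j | Inr (i, p', q') \<Rightarrow> h i $$ (p', q'))"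
  have key: "(\<Sum>u\<in>I. M (a, p, q) u * vars cs h u) = (lincomb_cocycles Q Y X cs \<xi>s a + D h a) $$ (p, q)"
    if "(a, p, q) \<in> J" "\<And>i. i \<in> verts Q \<Longrightarrow> h i \<in> carrier_mat (vdim X i) (vdim Y i)" for a p q cs h
    unfolding I_def M_def D_def vars_def prod.case
    by (rule lincomb_plus_coboundary_index[OF wf finite_verts X Y that(2)]) (use that(1) in \<open>auto simp: J_def\<close>)
  have Dc: "D h a \<in> carrier_mat (vdim X (head Q a)) (vdim Y (tail Q a))"
    if "a \<in> arcs Q" "\<And>i. i \<in> verts Q \<Longrightarrow> h i \<in> carrier_mat (vdim X i) (vdim Y i)" for a h
    using that(2)[OF head_in_verts[OF that(1)]] Y that(1)
    by (auto simp: D_def is_rep_def intro!: minus_carrier_mat)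
  note lc = lincomb_cocycles_carrier[of Q Y X _ \<xi>s]
  \<comment> \<open>Turns existence and uniqueness of coefficients into statements about a linear
    system, so that the two cardinality lemmas apply.\<close>
  have coh: "cohomologous Q Y X \<eta> (lincomb_cocycles Q Y X cs \<xi>s) \<longleftrightarrow>
      (\<exists>h. (\<forall>i\<in>verts Q. h i \<in> carrier_mat (vdim X i) (vdim Y i)) \<and>
        (\<forall>(a, p, q)\<in>J. (\<Sum>u\<in>I. M (a, p, q) u * vars cs h u) = \<eta> a $$ (p, q)))"
    if \<eta>: "\<eta> \<in> cocycles Q Y X" for \<eta> cs
    unfolding cohomologous_def
  proof (intro ex_cong1 conj_cong refl)
    fix h :: "'v \<Rightarrow> 'k mat" assume h: "\<forall>i\<in>verts Q. h i \<in> carrier_mat (vdim X i) (vdim Y i)"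
    have "\<eta> a - lincomb_cocycles Q Y X cs \<xi>s a = D h a \<longleftrightarrow>
      (\<forall>p<vdim X (head Q a). \<forall>q<vdim Y (tail Q a). (\<Sum>u\<in>I. M (a, p, q) u * vars cs h u) = \<eta> a $$ (p, q))"
      if a: "a \<in> arcs Q" for a
    proof -
      have "\<eta> a \<in> carrier_mat (vdim X (head Q a)) (vdim Y (tail Q a))" using \<eta> a by (auto simp: cocycles_def)
      moreover have "D h a \<in> carrier_mat (vdim X (head Q a)) (vdim Y (tail Q a))" using Dc a h by blast
      moreover have "(\<Sum>u\<in>I. M (a, p, q) u * vars cs h u) = (lincomb_cocycles Q Y X cs \<xi>s a + D h a) $$ (p, q)"
        if "p < vdim X (head Q a)" "q < vdim Y (tail Q a)" for p q
        using that a h by (intro key) (auto simp: J_def)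
      ultimately show ?thesis
        using lc[of cs a] by (auto simp: mat_eq_iff algebra_simps)
    qed
    then show "(\<forall>a\<in>arcs Q. \<eta> a - lincomb_cocycles Q Y X cs \<xi>s a = amap X a * h (tail Q a) - h (head Q a) * amap Y a)
      \<longleftrightarrow> (\<forall>(a, p, q)\<in>J. (\<Sum>u\<in>I. M (a, p, q) u * vars cs h u) = \<eta> a $$ (p, q))"
      unfolding J_def D_def by auto
  qed
  have "card J \<le> card I"
  proof (rule card_le_if_linear_surjective[OF fin(2,1), of M])
    fix y :: "'a \<times> nat \<times> nat \<Rightarrow> 'k"
    define \<eta> where "\<eta> = (\<lambda>a. mat (vdim X (head Q a)) (vdim Y (tail Q a)) (\<lambda>(p, q). y (a, p, q)))"
    have \<eta>: "\<eta> \<in> cocycles Q Y X" by (auto simp: \<eta>_def cocycles_def)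
    then obtain cs where "cohomologous Q Y X \<eta> (lincomb_cocycles Q Y X cs \<xi>s)"
      using basis unfolding ext1_basis_def by blast
    then obtain h where "\<forall>(a, p, q)\<in>J. (\<Sum>u\<in>I. M (a, p, q) u * vars cs h u) = \<eta> a $$ (p, q)"
      using coh[OF \<eta>] by blast
    then show "\<exists>x. \<forall>j\<in>J. (\<Sum>u\<in>I. M j u * x u) = y j"
      by (intro exI[of _ "vars cs h"]) (auto simp: J_def \<eta>_def)
  qed
  moreover have "card I \<le> card J"
  proof (rule card_le_if_linear_injective[OF fin(2,1), of M])
    fix x assume x: "\<And>j. j \<in> J \<Longrightarrow> (\<Sum>u\<in>I. M j u * x u) = 0"
    define cs where "cs = map (\<lambda>j. x (Inl j)) [0..<length \<xi>s]"
    define h where "h = (\<lambda>i. mat (vdim X i) (vdim Y i) (\<lambda>(p, q). x (Inr (i, p, q))))"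
    define z where "z = (\<lambda>a. 0\<^sub>m (vdim X (head Q a)) (vdim Y (tail Q a)) :: 'k mat)"
    have z: "z \<in> cocycles Q Y X" by (auto simp: z_def cocycles_def)
    have h: "h i \<in> carrier_mat (vdim X i) (vdim Y i)" for i by (simp add: h_def)
    have xv: "x u = vars cs h u" if "u \<in> I" for u
      using that by (auto simp: I_def vars_def cs_def h_def)
    have sys: "\<forall>(a, p, q)\<in>J. (\<Sum>u\<in>I. M (a, p, q) u * vars cs h u) = z a $$ (p, q)"
      using x xv by (auto simp: J_def z_def cong: sum.cong)
    have "cohomologous Q Y X z (lincomb_cocycles Q Y X cs \<xi>s)"
      unfolding coh[OF z] using h sys by blast
    \<comment> \<open>The zero cocycle is represented both by \<open>cs\<close> and by zero
      coefficients; uniqueness then forces \<open>cs\<close> to vanish.\<close>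
    moreover have "cohomologous Q Y X z (lincomb_cocycles Q Y X (replicate (length \<xi>s) 0) \<xi>s)"
      unfolding coh[OF z]
      by (intro exI[of _ "\<lambda>i. 0\<^sub>m (vdim X i) (vdim Y i)"] conjI)
        (auto simp: I_def J_def vars_def z_def intro!: sum.neutral)
    moreover have "length cs = length \<xi>s" by (simp add: cs_def)
    ultimately have cs: "cs = replicate (length \<xi>s) 0"
      using basis z unfolding ext1_basis_def by (metis length_replicate)
    \<comment> \<open>With vanishing coefficients the system says that the coboundary of
      \<open>h\<close> is zero, which is exactly commutation with all arrows.\<close>
    have "h \<in> qhom Q Y X"
    proof -
      have "amap X a * h (tail Q a) = h (head Q a) * amap Y a" if a: "a \<in> arcs Q" for a
      proof -
        have "D h a $$ (p, q) = 0" if "p < vdim X (head Q a)" "q < vdim Y (tail Q a)" for p q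
        proof -
          have J: "(a, p, q) \<in> J" using that a by (auto simp: J_def)
          then have "(lincomb_cocycles Q Y X cs \<xi>s a + D h a) $$ (p, q) = 0"
            using sys key[OF J, of h cs] h that by (auto simp: z_def)
          moreover have "lincomb_cocycles Q Y X cs \<xi>s a $$ (p, q) = 0"
            using that by (auto simp: lincomb_cocycles_def cs intro!: sum.neutral)
          ultimately show ?thesis
            using that Dc[OF a, of h] h lc[of cs a] by auto
        qed
        moreover have "amap X a \<in> carrier_mat (vdim X (head Q a)) (vdim X (tail Q a))"
          "amap Y a \<in> carrier_mat (vdim Y (head Q a)) (vdim Y (tail Q a))"
          using X Y a by (auto simp: is_rep_def)
        ultimately show ?thesis
          using h[of "tail Q a"] h[of "head Q a"]
          by (intro eq_matI) (auto simp: D_def)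
      qed
      then show ?thesis using h by (auto simp: qhom_def)
    qed
    then have h0: "h i = 0\<^sub>m (vdim X i) (vdim Y i)" if "i \<in> verts Q" for i
      using hom0 that by (auto simp: qhom_zero_def)
    show "\<forall>u\<in>I. x u = 0"
      using xv by (auto simp: I_def vars_def cs h0)
  qed
  ultimately have "card I = card J" by simp
  moreover have "card I = length \<xi>s + (\<Sum>i\<in>verts Q. vdim X i * vdim Y i)"
    by (simp add: I_def card_Plus)
  moreover have "card J = (\<Sum>a\<in>arcs Q. vdim X (head Q a) * vdim Y (tail Q a))"
    by (simp add: J_def)
  ultimately have "int (length \<xi>s) =
      (\<Sum>a\<in>arcs Q. int (vdim Y (tail Q a)) * int (vdim X (head Q a)))
      - (\<Sum>i\<in>verts Q. int (vdim Y i) * int (vdim X i))"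
    by (simp add: mult.commute flip: of_nat_sum of_nat_mult of_nat_add)
  then show ?thesis
    by (simp add: ringel_form_def dimvec_def cong: sum.cong)
qed

section \<open>Restriction of extension classes along a short exact sequence\<close>

lemma mat_mult_assoc_dim:
  fixes A B C :: "'k::semiring_0 mat"
  shows "dim_col A = dim_row B \<Longrightarrow> dim_col B = dim_row C \<Longrightarrow> (A * B) * C = A * (B * C)"
  by (rule assoc_mult_mat) auto

text \<open>As for associativity above, side conditions on dimensions introduce no extra size
  variables, so the simplifier can discharge them while rewriting.\<close>

lemma mat_distrib_dim:
  fixes A B C :: "'k::ring mat"
  shows "dim_row B = dim_row C \<Longrightarrow> dim_col B = dim_col C \<Longrightarrow> dim_col A = dim_row B \<Longrightarrow> A * (B + C) = A * B + A * C"
    and "dim_row B = dim_row C \<Longrightarrow> dim_col B = dim_col C \<Longrightarrow> dim_col A = dim_row B \<Longrightarrow> A * (B - C) = A * B - A * C"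
    and "dim_row A = dim_row B \<Longrightarrow> dim_col A = dim_col B \<Longrightarrow> dim_col A = dim_row C \<Longrightarrow> (A + B) * C = A * C + B * C"
    and "dim_row A = dim_row B \<Longrightarrow> dim_col A = dim_col B \<Longrightarrow> dim_col A = dim_row C \<Longrightarrow> (A - B) * C = A * C - B * C"
  by (rule mult_add_distrib_mat mult_minus_distrib_mat add_mult_distrib_mat minus_mult_distrib_mat; auto)+

text \<open>The computation at a single arrow for the pullback theorem below. The suffixes
  \<open>t\<close> and \<open>w\<close> stand for its tail and head, \<open>A\<close> is the map of
  \<open>S\<close>, and \<open>st'\<close> is the section at the tail, while \<open>st\<close> is a
  dimension. On \<open>X\<close> the difference \<open>d\<close> is the coboundary of
  \<open>k\<close>; what is left after extending \<open>k\<close> by the retraction comes from the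
  quotient \<open>W\<close>, where it is the coboundary of \<open>m\<close>.\<close>

lemma split_coboundary_identity:
  fixes d :: "'k::field mat"
  assumes c: "d \<in> carrier_mat s zt" "A \<in> carrier_mat s st" "kt \<in> carrier_mat st xt" "kw \<in> carrier_mat s xw"
    "Xa \<in> carrier_mat xw xt" "Za \<in> carrier_mat zw zt" "Wa \<in> carrier_mat ww wt"
    "jt \<in> carrier_mat zt xt" "jw \<in> carrier_mat zw xw" "rt \<in> carrier_mat xt zt" "rw \<in> carrier_mat xw zw"
    "st' \<in> carrier_mat zt wt" "pt \<in> carrier_mat wt zt" "pw \<in> carrier_mat ww zw"
    "mt \<in> carrier_mat st wt" "mw \<in> carrier_mat s ww"
    and j: "Za * jt = jw * Xa" and p: "Wa * pt = pw * Za"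
    and rj: "rt * jt = 1\<^sub>m xt" "rw * jw = 1\<^sub>m xw" and split: "jt * rt + st' * pt = 1\<^sub>m zt"
    and dj: "d * jt = A * kt - kw * Xa"
    and dm: "(d - (A * (kt * rt) - (kw * rw) * Za)) * st' = A * mt - mw * Wa"
  shows "d = A * (kt * rt + mt * pt) - (kw * rw + mw * pw) * Za"
proof -
  note dims = c[THEN carrier_matD(1)] c[THEN carrier_matD(2)]
  define d' where "d' = d - (A * (kt * rt) - (kw * rw) * Za)"
  have d'c: "d' \<in> carrier_mat s zt" using c by (auto simp: d'_def intro!: minus_carrier_mat)
  have "d' * jt = d * jt - (A * (kt * (rt * jt)) - kw * (rw * (Za * jt)))"
    by (simp add: d'_def dims mat_distrib_dim mat_mult_assoc_dim)
  also have "rw * (Za * jt) = (rw * jw) * Xa" unfolding j by (simp add: dims mat_mult_assoc_dim)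
  finally have d'j: "d' * jt = 0\<^sub>m s xt"
    using c mult_carrier_mat[OF c(4,5)] unfolding rj dj
    by (simp add: minus_r_inv_mat[OF minus_carrier_mat])
  \<comment> \<open>The splitting decomposes \<open>d'\<close> into a part through \<open>X\<close>,
    which vanishes because \<open>d'\<close> kills the image of \<open>jt\<close>, and a part
    through \<open>W\<close>.\<close>
  have "d' = d' * (jt * rt + st' * pt)" unfolding split using d'c by simp
  also have "\<dots> = (d' * jt) * rt + (d' * st') * pt"
    using d'c by (simp add: dims mat_distrib_dim mat_mult_assoc_dim)
  also have "\<dots> = (A * mt - mw * Wa) * pt"
    unfolding d'j using dm c by (auto simp: d'_def)
  also have "\<dots> = A * (mt * pt) - mw * (pw * Za)"
    unfolding p[symmetric] by (simp add: dims mat_distrib_dim mat_mult_assoc_dim)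
  finally have e: "d' = A * (mt * pt) - mw * (pw * Za)" .
  have d: "d = d' + (A * (kt * rt) - (kw * rw) * Za)"
    unfolding d'_def using c by (intro eq_matI) auto
  have r: "A * (kt * rt + mt * pt) - (kw * rw + mw * pw) * Za
      = (A * (kt * rt) + A * (mt * pt)) - ((kw * rw) * Za + mw * (pw * Za))"
    by (simp add: dims mat_distrib_dim mat_mult_assoc_dim)
  have cc: "A * (mt * pt) \<in> carrier_mat s zt" "A * (kt * rt) \<in> carrier_mat s zt"
    "mw * (pw * Za) \<in> carrier_mat s zt" "(kw * rw) * Za \<in> carrier_mat s zt"
    using c by auto
  have "(U - V) + (U' - V') = (U' + U) - (V' + V)"
    if "U \<in> carrier_mat s zt" "U' \<in> carrier_mat s zt" "V \<in> carrier_mat s zt" "V' \<in> carrier_mat s zt"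
    for U U' V V' :: "'k mat"
    using that by (intro eq_matI) auto
  from this[OF cc] show ?thesis unfolding r e[symmetric] d[symmetric] .
qed

text \<open>The splitting is one of vector spaces at each vertex; \<open>\<rho>\<close> and \<open>\<sigma>\<close> need not be morphisms of representations.\<close>

definition split_exact :: "('v, 'a) pre_digraph \<Rightarrow> ('v, 'a, 'k::field) quiver_rep \<Rightarrow> ('v \<Rightarrow> 'k mat)
    \<Rightarrow> ('v \<Rightarrow> 'k mat) \<Rightarrow> ('v, 'a, 'k) quiver_rep \<Rightarrow> ('v \<Rightarrow> 'k mat) \<Rightarrow> ('v \<Rightarrow> 'k mat)
    \<Rightarrow> ('v, 'a, 'k) quiver_rep \<Rightarrow> bool" where
  "split_exact Q X j \<rho> Z \<pi> \<sigma> W \<longleftrightarrow> j \<in> qhom Q X Z \<and> \<pi> \<in> qhom Q Z W \<and>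
     (\<forall>i\<in>verts Q. \<rho> i \<in> carrier_mat (vdim X i) (vdim Z i) \<and> \<sigma> i \<in> carrier_mat (vdim Z i) (vdim W i) \<and>
        \<rho> i * j i = 1\<^sub>m (vdim X i) \<and> j i * \<rho> i + \<sigma> i * \<pi> i = 1\<^sub>m (vdim Z i))"

text \<open>Exactness of Ext^1(W,S) -> Ext^1(Z,S) -> Ext^1(X,S) in the middle: when the first term
  is zero, restriction to \<open>X\<close> is injective. The other direction restricts the family
  \<open>h\<close> along \<open>j\<close>.\<close>

theorem cohomologous_pullback_iff:
  fixes X Z W S :: "('v, 'a, 'k::field) quiver_rep"
  assumes Q: "wf_digraph Q" and reps: "is_rep Q X" "is_rep Q Z" "is_rep Q W" "is_rep Q S"
    and se: "split_exact Q X j \<rho> Z \<pi> \<sigma> W" and W: "ext1_zero Q W S"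
    and \<xi>: "\<xi> \<in> cocycles Q Z S" and \<eta>: "\<eta> \<in> cocycles Q Z S"
  shows "cohomologous Q X S (\<lambda>a. \<xi> a * j (tail Q a)) (\<lambda>a. \<eta> a * j (tail Q a)) \<longleftrightarrow> cohomologous Q Z S \<xi> \<eta>"
proof -
  interpret wf_digraph Q by (rule Q)
  have jc: "j i \<in> carrier_mat (vdim Z i) (vdim X i)" and pc: "\<pi> i \<in> carrier_mat (vdim W i) (vdim Z i)"
    and rc: "\<rho> i \<in> carrier_mat (vdim X i) (vdim Z i)" and sc: "\<sigma> i \<in> carrier_mat (vdim Z i) (vdim W i)"
    and rj: "\<rho> i * j i = 1\<^sub>m (vdim X i)" and sp: "j i * \<rho> i + \<sigma> i * \<pi> i = 1\<^sub>m (vdim Z i)"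
    if "i \<in> verts Q" for i
    using se that by (auto simp: split_exact_def qhom_def)
  have jh: "amap Z a * j (tail Q a) = j (head Q a) * amap X a"
    and ph: "amap W a * \<pi> (tail Q a) = \<pi> (head Q a) * amap Z a"
    and ac: "amap X a \<in> carrier_mat (vdim X (head Q a)) (vdim X (tail Q a))"
      "amap Z a \<in> carrier_mat (vdim Z (head Q a)) (vdim Z (tail Q a))"
      "amap W a \<in> carrier_mat (vdim W (head Q a)) (vdim W (tail Q a))"
      "amap S a \<in> carrier_mat (vdim S (head Q a)) (vdim S (tail Q a))"
    and xc: "\<xi> a \<in> carrier_mat (vdim S (head Q a)) (vdim Z (tail Q a))"
      "\<eta> a \<in> carrier_mat (vdim S (head Q a)) (vdim Z (tail Q a))"
    and v: "tail Q a \<in> verts Q" "head Q a \<in> verts Q"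
    if "a \<in> arcs Q" for a
    using se reps \<xi> \<eta> that by (auto simp: split_exact_def qhom_def is_rep_def cocycles_def)
  have dist: "\<xi> a * j (tail Q a) - \<eta> a * j (tail Q a) = (\<xi> a - \<eta> a) * j (tail Q a)" if "a \<in> arcs Q" for a
    using xc[OF that] jc[OF v(1)[OF that]] by (simp add: minus_mult_distrib_mat)
  show ?thesis
  proof
    assume "cohomologous Q Z S \<xi> \<eta>"
    then obtain h where hc: "\<And>i. i \<in> verts Q \<Longrightarrow> h i \<in> carrier_mat (vdim S i) (vdim Z i)"
      and h: "\<And>a. a \<in> arcs Q \<Longrightarrow> \<xi> a - \<eta> a = amap S a * h (tail Q a) - h (head Q a) * amap Z a"
      by (auto simp: cohomologous_def)
    show "cohomologous Q X S (\<lambda>a. \<xi> a * j (tail Q a)) (\<lambda>a. \<eta> a * j (tail Q a))"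
      unfolding cohomologous_def
    proof (intro exI[of _ "\<lambda>i. h i * j i"] conjI ballI)
      fix i assume "i \<in> verts Q"
      then show "h i * j i \<in> carrier_mat (vdim S i) (vdim X i)" using hc jc by (meson mult_carrier_mat)
    next
      fix a assume a: "a \<in> arcs Q"
      note c = hc[OF v(1)[OF a]] hc[OF v(2)[OF a]] jc[OF v(1)[OF a]] jc[OF v(2)[OF a]] ac[OF a]
      note dims = c[THEN carrier_matD(1)] c[THEN carrier_matD(2)]
      have "(\<xi> a - \<eta> a) * j (tail Q a) =
          amap S a * (h (tail Q a) * j (tail Q a)) - h (head Q a) * (amap Z a * j (tail Q a))"
        unfolding h[OF a] by (simp add: dims mat_distrib_dim mat_mult_assoc_dim)
      then show "\<xi> a * j (tail Q a) - \<eta> a * j (tail Q a) =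
          amap S a * (h (tail Q a) * j (tail Q a)) - h (head Q a) * j (head Q a) * amap X a"
        unfolding dist[OF a] jh[OF a] by (simp add: dims mat_mult_assoc_dim)
    qed
  next
    assume "cohomologous Q X S (\<lambda>a. \<xi> a * j (tail Q a)) (\<lambda>a. \<eta> a * j (tail Q a))"
    then obtain k where kc: "\<And>i. i \<in> verts Q \<Longrightarrow> k i \<in> carrier_mat (vdim S i) (vdim X i)"
      and k: "\<And>a. a \<in> arcs Q \<Longrightarrow> (\<xi> a - \<eta> a) * j (tail Q a) = amap S a * k (tail Q a) - k (head Q a) * amap X a"
      using dist by (auto simp: cohomologous_def)
    \<comment> \<open>After the coboundary of \<open>k\<close> extended by the retraction is
      subtracted, the difference descends to this cocycle on the quotient \<open>W\<close>, where
      all classes are trivial.\<close>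
    define \<omega> where "\<omega> = (\<lambda>a. ((\<xi> a - \<eta> a) - (amap S a * (k (tail Q a) * \<rho> (tail Q a))
        - (k (head Q a) * \<rho> (head Q a)) * amap Z a)) * \<sigma> (tail Q a))"
    have wc: "\<omega> a \<in> carrier_mat (vdim S (head Q a)) (vdim W (tail Q a))" if a: "a \<in> arcs Q" for a
    proof -
      note c = kc[OF v(2)[OF a]] rc[OF v(2)[OF a]] ac[OF a] sc[OF v(1)[OF a]]
      show ?thesis unfolding \<omega>_def by (intro mult_carrier_mat[OF minus_carrier_mat c(7)] minus_carrier_mat
            mult_carrier_mat[OF mult_carrier_mat[OF c(1,2)] c(4)])
    qed
    have "\<omega> \<in> cocycles Q W S" using wc by (auto simp: cocycles_def)
    with W have "cohomologous Q W S \<omega> (\<lambda>a. 0\<^sub>m (vdim S (head Q a)) (vdim W (tail Q a)))"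
      by (auto simp: ext1_zero_def)
    then obtain m where mc: "\<And>i. i \<in> verts Q \<Longrightarrow> m i \<in> carrier_mat (vdim S i) (vdim W i)"
      and m: "\<And>a. a \<in> arcs Q \<Longrightarrow> \<omega> a - 0\<^sub>m (vdim S (head Q a)) (vdim W (tail Q a)) =
         amap S a * m (tail Q a) - m (head Q a) * amap W a"
      unfolding cohomologous_def by blast
    show "cohomologous Q Z S \<xi> \<eta>"
      unfolding cohomologous_def
    proof (intro exI[of _ "\<lambda>i. k i * \<rho> i + m i * \<pi> i"] conjI ballI)
      fix i assume "i \<in> verts Q"
      then show "k i * \<rho> i + m i * \<pi> i \<in> carrier_mat (vdim S i) (vdim Z i)"
        using kc rc mc pc by (meson mult_carrier_mat add_carrier_mat)
    next
      fix a assume a: "a \<in> arcs Q"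
      have m': "\<omega> a = amap S a * m (tail Q a) - m (head Q a) * amap W a"
      proof -
        have "\<omega> a - 0\<^sub>m (vdim S (head Q a)) (vdim W (tail Q a)) = \<omega> a"
          using wc[OF a] by (intro eq_matI) auto
        then show ?thesis using m[OF a] by simp
      qed
      show "\<xi> a - \<eta> a = amap S a * (k (tail Q a) * \<rho> (tail Q a) + m (tail Q a) * \<pi> (tail Q a)) -
          (k (head Q a) * \<rho> (head Q a) + m (head Q a) * \<pi> (head Q a)) * amap Z a"
        by (rule split_coboundary_identity[OF minus_carrier_mat[OF xc(2)[OF a]] ac(4)[OF a]
              kc[OF v(1)[OF a]] kc[OF v(2)[OF a]] ac(1-3)[OF a] jc[OF v(1)[OF a]] jc[OF v(2)[OF a]]
              rc[OF v(1)[OF a]] rc[OF v(2)[OF a]] sc[OF v(1)[OF a]] pc[OF v(1)[OF a]] pc[OF v(2)[OF a]]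
              mc[OF v(1)[OF a]] mc[OF v(2)[OF a]] jh[OF a] ph[OF a] rj[OF v(1)[OF a]] rj[OF v(2)[OF a]]
              sp[OF v(1)[OF a]] k[OF a] m'[unfolded \<omega>_def]])
    qed
  qed
qed

lemma cohomologous_cong:
  assumes "\<And>a. a \<in> arcs Q \<Longrightarrow> \<xi> a = \<xi>' a" "\<And>a. a \<in> arcs Q \<Longrightarrow> \<eta> a = \<eta>' a"
  shows "cohomologous Q Y X \<xi> \<eta> \<longleftrightarrow> cohomologous Q Y X \<xi>' \<eta>'"
  unfolding cohomologous_def using assms by simp

text \<open>Restriction to \<open>X\<close> is linear, injective by the preceding theorem, and
  surjective because every cocycle on \<open>X\<close> extends to \<open>Z\<close>. An isomorphism
  carries bases to bases.\<close>

lemma ext1_basis_pullback: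
  fixes X Z W S :: "('v, 'a, 'k::field) quiver_rep"
  assumes Q: "wf_digraph Q" and reps: "is_rep Q X" "is_rep Q Z" "is_rep Q W" "is_rep Q S"
    and se: "split_exact Q X j \<rho> Z \<pi> \<sigma> W" and W: "ext1_zero Q W S"
    and basis: "ext1_basis Q Z S \<xi>s"
  shows "ext1_basis Q X S (map (\<lambda>\<xi> a. \<xi> a * j (tail Q a)) \<xi>s)"
proof -
  interpret wf_digraph Q by (rule Q)
  let ?\<xi>s = "map (\<lambda>\<xi> a. \<xi> a * j (tail Q a)) \<xi>s"
  have jc: "j i \<in> carrier_mat (vdim Z i) (vdim X i)" and rc: "\<rho> i \<in> carrier_mat (vdim X i) (vdim Z i)"
    and rj: "\<rho> i * j i = 1\<^sub>m (vdim X i)" if "i \<in> verts Q" for i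
    using se that by (auto simp: split_exact_def qhom_def)
  have \<xi>c: "(\<xi>s ! l) a \<in> carrier_mat (vdim S (head Q a)) (vdim Z (tail Q a))"
    if "a \<in> arcs Q" "l < length \<xi>s" for a l
    using basis that nth_mem[OF that(2)] unfolding ext1_basis_def cocycles_def by blast
  have lin: "lincomb_cocycles Q X S cs ?\<xi>s a = lincomb_cocycles Q Z S cs \<xi>s a * j (tail Q a)"
    if a: "a \<in> arcs Q" for a cs
  proof (rule eq_matI)
    let ?s = "vdim S (head Q a)" and ?z = "vdim Z (tail Q a)" and ?x = "vdim X (tail Q a)"
    have jc': "j (tail Q a) \<in> carrier_mat ?z ?x" using jc a by simp
    note lc = lincomb_cocycles_carrier[of Q Z S cs \<xi>s a]
    fix p q assume "p < dim_row (lincomb_cocycles Q Z S cs \<xi>s a * j (tail Q a))"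
      "q < dim_col (lincomb_cocycles Q Z S cs \<xi>s a * j (tail Q a))"
    then have pq: "p < ?s" "q < ?x" using lc jc' by auto
    have "lincomb_cocycles Q X S cs ?\<xi>s a $$ (p, q) =
        (\<Sum>l<length \<xi>s. cs ! l * (\<Sum>u<?z. (\<xi>s ! l) a $$ (p, u) * j (tail Q a) $$ (u, q)))"
      using pq index_mult_mat_sum[OF \<xi>c[OF a] jc' pq] by (simp add: lincomb_cocycles_def)
    also have "\<dots> = (\<Sum>u<?z. (\<Sum>l<length \<xi>s. cs ! l * (\<xi>s ! l) a $$ (p, u)) * j (tail Q a) $$ (u, q))"
      unfolding sum_distrib_left sum_distrib_right by (subst sum.swap) (simp only: mult.assoc)
    also have "\<dots> = (lincomb_cocycles Q Z S cs \<xi>s a * j (tail Q a)) $$ (p, q)"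
      using pq index_mult_mat_sum[OF lc jc' pq] by (simp add: lincomb_cocycles_def)
    finally show "lincomb_cocycles Q X S cs ?\<xi>s a $$ (p, q) =
      (lincomb_cocycles Q Z S cs \<xi>s a * j (tail Q a)) $$ (p, q)" .
  qed (use lincomb_cocycles_carrier[of Q Z S cs \<xi>s a] jc[of "tail Q a"] a in \<open>auto simp: lincomb_cocycles_def\<close>)
  show ?thesis
    unfolding ext1_basis_def
  proof (intro conjI ballI)
    show "set ?\<xi>s \<subseteq> cocycles Q X S"
    proof
      fix \<zeta> assume "\<zeta> \<in> set ?\<xi>s"
      then obtain \<xi> where \<xi>: "\<xi> \<in> set \<xi>s" and \<zeta>: "\<zeta> = (\<lambda>a. \<xi> a * j (tail Q a))" by auto
      have "\<xi> a \<in> carrier_mat (vdim S (head Q a)) (vdim Z (tail Q a))" if "a \<in> arcs Q" for a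
        using \<xi> basis that unfolding ext1_basis_def cocycles_def by blast
      then show "\<zeta> \<in> cocycles Q X S"
        unfolding cocycles_def \<zeta> using jc mult_carrier_mat tail_in_verts by blast
    qed
    fix \<eta> assume \<eta>: "\<eta> \<in> cocycles Q X S"
    have \<eta>c: "\<eta> a \<in> carrier_mat (vdim S (head Q a)) (vdim X (tail Q a))" if "a \<in> arcs Q" for a
      using \<eta> that by (auto simp: cocycles_def)
    \<comment> \<open>Extension by the vertexwise retraction. Any matrices of the right sizes form a
      cocycle, so \<open>\<rho>\<close> may be a mere family of linear maps.\<close>
    define \<zeta> where "\<zeta> = (\<lambda>a. \<eta> a * \<rho> (tail Q a))"
    have \<zeta>: "\<zeta> \<in> cocycles Q Z S"
      unfolding cocycles_def \<zeta>_def using \<eta>c rc mult_carrier_mat tail_in_verts by blast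
    have \<zeta>j: "\<eta> a = \<zeta> a * j (tail Q a)" if a: "a \<in> arcs Q" for a
    proof -
      have t: "tail Q a \<in> verts Q" using a by simp
      show ?thesis
        unfolding \<zeta>_def using assoc_mult_mat[OF \<eta>c[OF a] rc[OF t] jc[OF t]] rj[OF t] \<eta>c[OF a] by simp
    qed
    have "lincomb_cocycles Q Z S cs \<xi>s \<in> cocycles Q Z S" for cs
      by (auto simp: cocycles_def lincomb_cocycles_def)
    from cohomologous_pullback_iff[OF Q reps se W \<zeta> this]
    have "cohomologous Q X S \<eta> (lincomb_cocycles Q X S cs ?\<xi>s) \<longleftrightarrow>
        cohomologous Q Z S \<zeta> (lincomb_cocycles Q Z S cs \<xi>s)" for cs
      by (subst cohomologous_cong[where \<xi>' = "\<lambda>a. \<zeta> a * j (tail Q a)"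
            and \<eta>' = "\<lambda>a. lincomb_cocycles Q Z S cs \<xi>s a * j (tail Q a)"]) (use \<zeta>j lin in auto)
    then show "\<exists>!cs. length cs = length ?\<xi>s \<and> cohomologous Q X S \<eta> (lincomb_cocycles Q X S cs ?\<xi>s)"
      using basis \<zeta> unfolding ext1_basis_def by simp
  qed
qed

section \<open>Vertexwise split sequences from block matrices and isomorphisms\<close>

lemma sum_delta_shift:
  fixes f :: "nat \<Rightarrow> 'k::comm_monoid_add"
  shows "(\<Sum>l<w. if q = x + l then f l else 0) = (if x \<le> q \<and> q < x + w then f (q - x) else 0)"
proof (cases "x \<le> q \<and> q < x + w")
  case True
  then have "(\<Sum>l<w. if q = x + l then f l else 0) = (\<Sum>l<w. if l = q - x then f l else 0)"
    by (intro sum.cong) auto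
  with True show ?thesis by auto
qed (auto intro!: sum.neutral)

text \<open>Formulated for any \<open>Z\<close> whose arrows have upper triangular block form, so
  that it covers both \<open>ext_rep\<close> and the decomposition of a direct power into its first
  summand and the rest.\<close>

lemma split_exact_block:
  fixes X Z W :: "('v, 'a, 'k::field) quiver_rep"
  assumes Q: "wf_digraph Q" and reps: "is_rep Q X" "is_rep Q W" and \<xi>: "\<xi> \<in> cocycles Q W X"
    and dimZ: "\<And>i. i \<in> verts Q \<Longrightarrow> vdim Z i = vdim X i + vdim W i"
    and mapZ: "\<And>a. a \<in> arcs Q \<Longrightarrow> amap Z a =
      four_block_mat (amap X a) (\<xi> a) (0\<^sub>m (vdim W (head Q a)) (vdim X (tail Q a))) (amap W a)"
  shows "\<exists>j \<rho> \<pi> \<sigma>. split_exact Q X j \<rho> Z \<pi> \<sigma> W"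
proof -
  interpret wf_digraph Q by (rule Q)
  define j \<rho> where "j = (\<lambda>i. mat (vdim X i + vdim W i) (vdim X i) (\<lambda>(p, q). if p = q then 1 else 0) :: 'k mat)"
    and "\<rho> = (\<lambda>i. mat (vdim X i) (vdim X i + vdim W i) (\<lambda>(p, q). if p = q then 1 else 0) :: 'k mat)"
  define \<pi> \<sigma> where "\<pi> = (\<lambda>i. mat (vdim W i) (vdim X i + vdim W i) (\<lambda>(p, q). if q = vdim X i + p then 1 else 0) :: 'k mat)"
    and "\<sigma> = (\<lambda>i. mat (vdim X i + vdim W i) (vdim W i) (\<lambda>(p, q). if p = vdim X i + q then 1 else 0) :: 'k mat)"
  note defs = j_def \<rho>_def \<pi>_def \<sigma>_def
  have c: "j i \<in> carrier_mat (vdim X i + vdim W i) (vdim X i)" "\<rho> i \<in> carrier_mat (vdim X i) (vdim X i + vdim W i)"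
    "\<pi> i \<in> carrier_mat (vdim W i) (vdim X i + vdim W i)" "\<sigma> i \<in> carrier_mat (vdim X i + vdim W i) (vdim W i)" for i
    by (auto simp: defs)
  note ite = if_distrib[of "\<lambda>c. c * _"] if_distrib[of "\<lambda>c. _ * c"]
  have ac: "amap X a \<in> carrier_mat (vdim X (head Q a)) (vdim X (tail Q a))"
    "amap W a \<in> carrier_mat (vdim W (head Q a)) (vdim W (tail Q a))"
    "\<xi> a \<in> carrier_mat (vdim X (head Q a)) (vdim W (tail Q a))" if "a \<in> arcs Q" for a
    using reps \<xi> that by (auto simp: is_rep_def cocycles_def)
  have zc: "amap Z a \<in> carrier_mat (vdim X (head Q a) + vdim W (head Q a)) (vdim X (tail Q a) + vdim W (tail Q a))"
    if "a \<in> arcs Q" for a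
    unfolding mapZ[OF that] using ac[OF that] by auto
  have "amap Z a * j (tail Q a) = j (head Q a) * amap X a" if a: "a \<in> arcs Q" for a
  proof (rule eq_matI)
    fix p q assume "p < dim_row (j (head Q a) * amap X a)" "q < dim_col (j (head Q a) * amap X a)"
    then have pq: "p < vdim X (head Q a) + vdim W (head Q a)" "q < vdim X (tail Q a)" using ac[OF a] by (auto simp: defs)
    have "(amap Z a * j (tail Q a)) $$ (p, q) = amap Z a $$ (p, q)"
      unfolding index_mult_mat_sum[OF zc[OF a] c(1) pq] using pq by (simp add: j_def ite cong: if_cong)
    moreover have "(j (head Q a) * amap X a) $$ (p, q) = (if p < vdim X (head Q a) then amap X a $$ (p, q) else 0)"
      unfolding index_mult_mat_sum[OF c(1) ac(1)[OF a] pq] using pq by (simp add: j_def ite cong: if_cong)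
    ultimately show "(amap Z a * j (tail Q a)) $$ (p, q) = (j (head Q a) * amap X a) $$ (p, q)"
      using pq ac[OF a] by (auto simp: mapZ[OF a])
  qed (use zc[OF a] ac[OF a] in \<open>auto simp: defs\<close>)
  moreover have "amap W a * \<pi> (tail Q a) = \<pi> (head Q a) * amap Z a" if a: "a \<in> arcs Q" for a
  proof (rule eq_matI)
    fix p q assume "p < dim_row (\<pi> (head Q a) * amap Z a)" "q < dim_col (\<pi> (head Q a) * amap Z a)"
    then have pq: "p < vdim W (head Q a)" "q < vdim X (tail Q a) + vdim W (tail Q a)" using zc[OF a] by (auto simp: defs)
    have "(\<pi> (head Q a) * amap Z a) $$ (p, q) = amap Z a $$ (vdim X (head Q a) + p, q)"
      unfolding index_mult_mat_sum[OF c(3) zc[OF a] pq] using pq by (simp add: \<pi>_def ite cong: if_cong)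
    moreover have "(amap W a * \<pi> (tail Q a)) $$ (p, q) =
        (if vdim X (tail Q a) \<le> q then amap W a $$ (p, q - vdim X (tail Q a)) else 0)"
      unfolding index_mult_mat_sum[OF ac(2)[OF a] c(3) pq] using pq
      by (simp add: \<pi>_def ite sum_delta_shift cong: if_cong)
    ultimately show "(amap W a * \<pi> (tail Q a)) $$ (p, q) = (\<pi> (head Q a) * amap Z a) $$ (p, q)"
      using pq ac[OF a] by (auto simp: mapZ[OF a])
  qed (use zc[OF a] ac[OF a] in \<open>auto simp: defs\<close>)
  moreover have "\<rho> i * j i = 1\<^sub>m (vdim X i)" for i
  proof (rule eq_matI)
    fix p q assume "p < dim_row (1\<^sub>m (vdim X i) :: 'k mat)" "q < dim_col (1\<^sub>m (vdim X i) :: 'k mat)"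
    then have pq: "p < vdim X i" "q < vdim X i" by auto
    show "(\<rho> i * j i) $$ (p, q) = 1\<^sub>m (vdim X i) $$ (p, q)"
      unfolding index_mult_mat_sum[OF c(2,1) pq] using pq by (simp add: \<rho>_def j_def ite cong: if_cong)
  qed (auto simp: defs)
  moreover have "j i * \<rho> i + \<sigma> i * \<pi> i = 1\<^sub>m (vdim X i + vdim W i)" for i
  proof (rule eq_matI)
    fix p q assume "p < dim_row (1\<^sub>m (vdim X i + vdim W i) :: 'k mat)" "q < dim_col (1\<^sub>m (vdim X i + vdim W i) :: 'k mat)"
    then have pq: "p < vdim X i + vdim W i" "q < vdim X i + vdim W i" by auto
    have "(j i * \<rho> i) $$ (p, q) = (if p < vdim X i \<and> p = q then 1 else 0)"
      unfolding index_mult_mat_sum[OF c(1,2) pq] using pq by (auto simp: j_def \<rho>_def ite cong: if_cong)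
    moreover have "(\<sigma> i * \<pi> i) $$ (p, q) = (\<Sum>l<vdim W i. if p = vdim X i + l then (if q = vdim X i + l then 1 else 0) else 0)"
      unfolding index_mult_mat_sum[OF c(4,3) pq] using pq by (intro sum.cong) (auto simp: \<sigma>_def \<pi>_def)
    moreover have "\<dots> = (if vdim X i \<le> p \<and> p = q then 1 else 0)"
      unfolding sum_delta_shift using pq by auto
    moreover have "(j i * \<rho> i + \<sigma> i * \<pi> i) $$ (p, q) = (j i * \<rho> i) $$ (p, q) + (\<sigma> i * \<pi> i) $$ (p, q)"
      by (rule index_add_mat(1)) (use pq in \<open>auto simp: \<sigma>_def \<pi>_def\<close>)
    ultimately show "(j i * \<rho> i + \<sigma> i * \<pi> i) $$ (p, q) = 1\<^sub>m (vdim X i + vdim W i) $$ (p, q)"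
      using pq by auto
  qed (auto simp: defs)
  ultimately have "split_exact Q X j \<rho> Z \<pi> \<sigma> W"
    using c by (auto simp: split_exact_def qhom_def dimZ)
  then show ?thesis by blast
qed

lemma qhom_compose:
  fixes X Y Z :: "('v, 'a, 'k::field) quiver_rep"
  assumes Q: "wf_digraph Q" and reps: "is_rep Q X" "is_rep Q Y" "is_rep Q Z"
    and f: "f \<in> qhom Q X Y" and g: "g \<in> qhom Q Y Z"
  shows "(\<lambda>i. g i * f i) \<in> qhom Q X Z"
proof -
  interpret wf_digraph Q by (rule Q)
  have fc: "f i \<in> carrier_mat (vdim Y i) (vdim X i)" and gc: "g i \<in> carrier_mat (vdim Z i) (vdim Y i)"
    if "i \<in> verts Q" for i
    using that f g by (auto simp: qhom_def)
  have "amap Z a * (g (tail Q a) * f (tail Q a)) = g (head Q a) * f (head Q a) * amap X a" if a: "a \<in> arcs Q" for a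
  proof -
    have v: "tail Q a \<in> verts Q" "head Q a \<in> verts Q" using a by auto
    have ac: "amap X a \<in> carrier_mat (vdim X (head Q a)) (vdim X (tail Q a))"
      "amap Y a \<in> carrier_mat (vdim Y (head Q a)) (vdim Y (tail Q a))"
      "amap Z a \<in> carrier_mat (vdim Z (head Q a)) (vdim Z (tail Q a))"
      using reps a by (auto simp: is_rep_def)
    note c = fc[OF v(1)] fc[OF v(2)] gc[OF v(1)] gc[OF v(2)] ac
    note dims = c[THEN carrier_matD(1)] c[THEN carrier_matD(2)]
    have h: "amap Z a * g (tail Q a) = g (head Q a) * amap Y a" "amap Y a * f (tail Q a) = f (head Q a) * amap X a"
      using f g a by (auto simp: qhom_def)
    have "amap Z a * (g (tail Q a) * f (tail Q a)) = (amap Z a * g (tail Q a)) * f (tail Q a)"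
      by (simp add: dims mat_mult_assoc_dim)
    also have "\<dots> = g (head Q a) * (amap Y a * f (tail Q a))"
      unfolding h(1) by (simp add: dims mat_mult_assoc_dim)
    also have "\<dots> = g (head Q a) * f (head Q a) * amap X a"
      unfolding h(2) by (simp add: dims mat_mult_assoc_dim)
    finally show ?thesis .
  qed
  moreover have "g i * f i \<in> carrier_mat (vdim Z i) (vdim X i)" if "i \<in> verts Q" for i
    using mult_carrier_mat[OF gc[OF that] fc[OF that]] .
  ultimately show ?thesis by (simp add: qhom_def)
qed

text \<open>\<open>over_ext\<close> fixes the middle term only up to isomorphism, so the splitting
  of the standard block extension has to be transported to \<open>Z\<close>.\<close>

lemma split_exact_qiso:
  fixes X Z E W :: "('v, 'a, 'k::field) quiver_rep"
  assumes Q: "wf_digraph Q" and reps: "is_rep Q X" "is_rep Q Z" "is_rep Q E" "is_rep Q W"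
    and se: "split_exact Q X j \<rho> E \<pi> \<sigma> W"
    and f: "f \<in> qhom Q E Z" and g: "g \<in> qhom Q Z E"
    and gf: "\<And>i. i \<in> verts Q \<Longrightarrow> g i * f i = 1\<^sub>m (vdim E i)"
    and fg: "\<And>i. i \<in> verts Q \<Longrightarrow> f i * g i = 1\<^sub>m (vdim Z i)"
  shows "split_exact Q X (\<lambda>i. f i * j i) (\<lambda>i. \<rho> i * g i) Z (\<lambda>i. \<pi> i * g i) (\<lambda>i. f i * \<sigma> i) W"
  unfolding split_exact_def
proof (intro conjI ballI)
  have "j \<in> qhom Q X E" "\<pi> \<in> qhom Q E W" using se by (auto simp: split_exact_def)
  then show "(\<lambda>i. f i * j i) \<in> qhom Q X Z" "(\<lambda>i. \<pi> i * g i) \<in> qhom Q Z W"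
    using qhom_compose[OF Q reps(1,3,2) _ f] qhom_compose[OF Q reps(2,3,4) g] by auto
  fix i assume i: "i \<in> verts Q"
  have c: "j i \<in> carrier_mat (vdim E i) (vdim X i)" "\<pi> i \<in> carrier_mat (vdim W i) (vdim E i)"
    "\<rho> i \<in> carrier_mat (vdim X i) (vdim E i)" "\<sigma> i \<in> carrier_mat (vdim E i) (vdim W i)"
    "f i \<in> carrier_mat (vdim Z i) (vdim E i)" "g i \<in> carrier_mat (vdim E i) (vdim Z i)"
    and rj: "\<rho> i * j i = 1\<^sub>m (vdim X i)" and sp: "j i * \<rho> i + \<sigma> i * \<pi> i = 1\<^sub>m (vdim E i)"
    using se f g i by (auto simp: split_exact_def qhom_def)
  note dims = c[THEN carrier_matD(1)] c[THEN carrier_matD(2)]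
  show "\<rho> i * g i \<in> carrier_mat (vdim X i) (vdim Z i)" using c by auto
  show "f i * \<sigma> i \<in> carrier_mat (vdim Z i) (vdim W i)" using c by auto
  have "(\<rho> i * g i) * (f i * j i) = \<rho> i * ((g i * f i) * j i)" by (simp add: dims mat_mult_assoc_dim)
  also have "\<dots> = 1\<^sub>m (vdim X i)" unfolding gf[OF i] using c rj by simp
  finally show "(\<rho> i * g i) * (f i * j i) = 1\<^sub>m (vdim X i)" .
  have "(f i * j i) * (\<rho> i * g i) + (f i * \<sigma> i) * (\<pi> i * g i) = f i * ((j i * \<rho> i + \<sigma> i * \<pi> i) * g i)"
    by (simp add: dims mat_distrib_dim mat_mult_assoc_dim)
  also have "\<dots> = 1\<^sub>m (vdim Z i)" unfolding sp using c fg[OF i] by simp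
  finally show "(f i * j i) * (\<rho> i * g i) + (f i * \<sigma> i) * (\<pi> i * g i) = 1\<^sub>m (vdim Z i)" .
qed

section \<open>Direct powers and dimension vectors of universal extensions\<close>

lemma is_rep_direct_power:
  assumes "is_rep Q S"
  shows "is_rep Q (direct_power r S)"
  unfolding is_rep_def
proof
  fix a assume "a \<in> arcs Q"
  with assms have "amap S a \<in> carrier_mat (vdim S (head Q a)) (vdim S (tail Q a))" by (auto simp: is_rep_def)
  then show "amap (direct_power r S) a \<in> carrier_mat (vdim (direct_power r S) (head Q a)) (vdim (direct_power r S) (tail Q a))"
    by (intro carrier_matI) (auto simp: direct_power_def dim_diag_block_mat sum_list_replicate)
qed

lemma is_rep_ext_rep:
  assumes "is_rep Q X" "is_rep Q Y"
  shows "is_rep Q (ext_rep Q X Y \<xi>)"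
  using assms by (auto simp: is_rep_def ext_rep_def)

text \<open>Induction along 0 -> S -> S^(r+1) -> S^r -> 0: by the induction hypothesis restriction
  to the first summand is injective on extension classes, and it lands in Ext^1(S,S) = 0.\<close>

lemma ext1_zero_direct_power:
  fixes S :: "('v, 'a, 'k::field) quiver_rep"
  assumes Q: "wf_digraph Q" and S: "is_rep Q S" and SS: "ext1_zero Q S S"
  shows "ext1_zero Q (direct_power r S) S"
proof (induction r)
  case 0
  show ?case
    unfolding ext1_zero_def cohomologous_def
  proof (intro ballI exI[of _ "\<lambda>i. 0\<^sub>m (vdim S i) 0"] conjI)
    fix \<xi> a assume "\<xi> \<in> cocycles Q (direct_power 0 S) S" and a: "a \<in> arcs Q"
    then have "\<xi> a \<in> carrier_mat (vdim S (head Q a)) 0" by (auto simp: cocycles_def direct_power_def)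
    moreover have "amap S a \<in> carrier_mat (vdim S (head Q a)) (vdim S (tail Q a))" using S a by (auto simp: is_rep_def)
    ultimately show "\<xi> a - 0\<^sub>m (vdim S (head Q a)) (vdim (direct_power 0 S) (tail Q a)) =
        amap S a * 0\<^sub>m (vdim S (tail Q a)) 0 - 0\<^sub>m (vdim S (head Q a)) 0 * amap (direct_power 0 S) a"
      by (intro eq_matI) (auto simp: direct_power_def)
  qed (auto simp: direct_power_def)
next
  case (Suc r)
  interpret wf_digraph Q by (rule Q)
  let ?W = "direct_power r S" and ?Z = "direct_power (Suc r) S"
  have reps: "is_rep Q S" "is_rep Q ?Z" "is_rep Q ?W" "is_rep Q S" using S is_rep_direct_power by auto
  have "\<exists>j \<rho> \<pi> \<sigma>. split_exact Q S j \<rho> ?Z \<pi> \<sigma> ?W"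
  proof (rule split_exact_block[OF Q reps(1,3)])
    show "(\<lambda>a. 0\<^sub>m (vdim S (head Q a)) (vdim ?W (tail Q a))) \<in> cocycles Q ?W S" by (simp add: cocycles_def)
    fix a assume a: "a \<in> arcs Q"
    have "amap S a \<in> carrier_mat (vdim S (head Q a)) (vdim S (tail Q a))"
      "amap ?W a \<in> carrier_mat (vdim ?W (head Q a)) (vdim ?W (tail Q a))"
      using reps a by (auto simp: is_rep_def)
    then show "amap ?Z a = four_block_mat (amap S a) (0\<^sub>m (vdim S (head Q a)) (vdim ?W (tail Q a)))
        (0\<^sub>m (vdim ?W (head Q a)) (vdim S (tail Q a))) (amap ?W a)"
      by (simp add: direct_power_def Let_def)
  qed (simp add: direct_power_def)
  then obtain j \<rho> \<pi> \<sigma> where se: "split_exact Q S j \<rho> ?Z \<pi> \<sigma> ?W" by blast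
  have jc: "j i \<in> carrier_mat (vdim ?Z i) (vdim S i)" if "i \<in> verts Q" for i
    using se that by (auto simp: split_exact_def qhom_def)
  show ?case
    unfolding ext1_zero_def
  proof
    fix \<xi> assume \<xi>: "\<xi> \<in> cocycles Q ?Z S"
    let ?\<eta> = "\<lambda>a. 0\<^sub>m (vdim S (head Q a)) (vdim ?Z (tail Q a)) :: 'k mat"
    have \<eta>: "?\<eta> \<in> cocycles Q ?Z S" by (simp add: cocycles_def)
    have "\<xi> a * j (tail Q a) \<in> carrier_mat (vdim S (head Q a)) (vdim S (tail Q a))" if "a \<in> arcs Q" for a
      using \<xi> jc[OF tail_in_verts[OF that]] that by (auto simp: cocycles_def)
    then have "(\<lambda>a. \<xi> a * j (tail Q a)) \<in> cocycles Q S S" by (simp add: cocycles_def)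
    with SS have "cohomologous Q S S (\<lambda>a. \<xi> a * j (tail Q a)) (\<lambda>a. 0\<^sub>m (vdim S (head Q a)) (vdim S (tail Q a)))"
      by (auto simp: ext1_zero_def)
    moreover have "0\<^sub>m (vdim S (head Q a)) (vdim S (tail Q a)) = ?\<eta> a * j (tail Q a)" if "a \<in> arcs Q" for a
      using jc[OF tail_in_verts[OF that]] by simp
    ultimately have "cohomologous Q S S (\<lambda>a. \<xi> a * j (tail Q a)) (\<lambda>a. ?\<eta> a * j (tail Q a))"
      by (subst cohomologous_cong[where \<eta>' = "\<lambda>a. 0\<^sub>m (vdim S (head Q a)) (vdim S (tail Q a))"]) auto
    then show "cohomologous Q ?Z S \<xi> ?\<eta>"
      using cohomologous_pullback_iff[OF Q reps se Suc.IH \<xi> \<eta>] by blast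
  qed
qed

lemma left_invertible_imp_le:
  fixes A B :: "'k::field mat"
  assumes A: "A \<in> carrier_mat n m" and B: "B \<in> carrier_mat m n" and BA: "B * A = 1\<^sub>m m"
  shows "m \<le> n"
proof -
  have "card {..<m} \<le> card {..<n}"
  proof (rule card_le_if_linear_injective[where a = "\<lambda>j i. A $$ (j, i)"])
    fix x assume x: "\<And>j. j \<in> {..<n} \<Longrightarrow> (\<Sum>i<m. A $$ (j, i) * x i) = 0"
    have "A *\<^sub>v vec m x = 0\<^sub>v n"
      using A x by (intro eq_vecI) (auto simp: scalar_prod_def atLeast0LessThan)
    then have "vec m x = B *\<^sub>v 0\<^sub>v n"
      using assoc_mult_mat_vec[OF B A, of "vec m x"] BA by simp
    then have v: "vec m x = 0\<^sub>v m" using B by auto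
    show "\<forall>i\<in>{..<m}. x i = 0"
    proof
      fix i assume "i \<in> {..<m}"
      then show "x i = 0" using arg_cong[OF v, of "\<lambda>v. v $ i"] by simp
    qed
  qed auto
  then show ?thesis by simp
qed

lemma qiso_vdim_eq:
  assumes "qiso Q X Y" "i \<in> verts Q"
  shows "vdim X i = vdim Y i"
proof -
  obtain f g where fg: "f \<in> qhom Q X Y" "g \<in> qhom Q Y X"
    "g i * f i = 1\<^sub>m (vdim X i)" "f i * g i = 1\<^sub>m (vdim Y i)"
    using assms unfolding qiso_def by blast
  then have "f i \<in> carrier_mat (vdim Y i) (vdim X i)" "g i \<in> carrier_mat (vdim X i) (vdim Y i)"
    using assms(2) by (auto simp: qhom_def)
  with fg show ?thesis by (meson left_invertible_imp_le order_antisym)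
qed

lemma qiso_dimvec_eq: "qiso Q X Y \<Longrightarrow> dimvec Q X = dimvec Q Y"
  by (auto simp: dimvec_def qiso_vdim_eq)

text \<open>The two constructions add r and s copies of \<open>S\<close>, where r and s are minus
  the two values of the Ringel form. Both inequalities say that these lengths are
  nonnegative.\<close>

theorem dimvec_universal_ext:
  fixes S X U :: "('v, 'a, 'k::field) quiver_rep"
  assumes Q: "fin_digraph Q" and U: "universal_ext Q S X U"
  shows "ringel_form Q (dimvec Q S) (dimvec Q X) \<le> 0" "ringel_form Q (dimvec Q X) (dimvec Q S) \<le> 0"
    "dimvec Q U = (\<lambda>i. dimvec Q X i - sym_form Q (dimvec Q X) (dimvec Q S) * dimvec Q S i)"
proof -
  interpret fin_digraph Q by (rule Q)
  note wf = wf_digraph_axioms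
  obtain Z where S: "is_rep Q S" and SS: "ext1_zero Q S S" and X: "is_rep Q X"
    and XS: "qhom_zero Q X S" and SX: "qhom_zero Q S X"
    and Z: "over_ext Q S X Z" and ZU: "under_ext Q S Z U"
    using U by (auto simp: universal_ext_def M_up_down_def M_up_def M_down_def)
  obtain \<xi>s where \<xi>s: "ext1_basis Q S X \<xi>s" and repZ: "is_rep Q Z"
    and isoZ: "qiso Q Z (ext_rep Q X (direct_power (length \<xi>s) S) (cocycle_row Q S X \<xi>s))"
    using Z by (auto simp: over_ext_def)
  obtain \<eta>s where \<eta>s: "ext1_basis Q Z S \<eta>s"
    and isoU: "qiso Q U (ext_rep Q (direct_power (length \<eta>s) S) Z (cocycle_col Q Z S \<eta>s))"
    using ZU by (auto simp: under_ext_def)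
  let ?W = "direct_power (length \<xi>s) S"
  let ?E = "ext_rep Q X ?W (cocycle_row Q S X \<xi>s)"
  have repW: "is_rep Q ?W" by (rule is_rep_direct_power[OF S])
  have repE: "is_rep Q ?E" by (rule is_rep_ext_rep[OF X repW])
  have "\<exists>j \<rho> \<pi> \<sigma>. split_exact Q X j \<rho> ?E \<pi> \<sigma> ?W"
    by (rule split_exact_block[OF wf X repW, where \<xi> = "cocycle_row Q S X \<xi>s"])
      (auto simp: cocycles_def cocycle_row_def Let_def direct_power_def ext_rep_def)
  then obtain j \<rho> \<pi> \<sigma> where se: "split_exact Q X j \<rho> ?E \<pi> \<sigma> ?W" by blast
  obtain f g where fg: "f \<in> qhom Q ?E Z" "g \<in> qhom Q Z ?E"
    "\<And>i. i \<in> verts Q \<Longrightarrow> g i * f i = 1\<^sub>m (vdim ?E i)" "\<And>i. i \<in> verts Q \<Longrightarrow> f i * g i = 1\<^sub>m (vdim Z i)"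
    using isoZ unfolding qiso_def by blast
  have r: "int (length \<xi>s) = - ringel_form Q (dimvec Q S) (dimvec Q X)"
    by (rule length_ext1_basis[OF Q X S SX \<xi>s])
  \<comment> \<open>The second construction uses a basis of Ext^1(Z,S). Restricting it along X -> Z
    gives a basis of Ext^1(X,S), whose length depends only on \<open>X\<close> and
    \<open>S\<close>.\<close>
  have "ext1_basis Q X S (map (\<lambda>\<xi> a. \<xi> a * (f (tail Q a) * j (tail Q a))) \<eta>s)"
    by (rule ext1_basis_pullback[OF wf X repZ repW S split_exact_qiso[OF wf X repZ repE repW se fg]
          ext1_zero_direct_power[OF wf S SS] \<eta>s])
  from length_ext1_basis[OF Q S X XS this]
  have s: "int (length \<eta>s) = - ringel_form Q (dimvec Q X) (dimvec Q S)" by simp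
  show "ringel_form Q (dimvec Q S) (dimvec Q X) \<le> 0" "ringel_form Q (dimvec Q X) (dimvec Q S) \<le> 0"
    using r s by linarith+
  have "dimvec Q U i = dimvec Q X i + (int (length \<xi>s) + int (length \<eta>s)) * dimvec Q S i" for i
    unfolding qiso_dimvec_eq[OF isoU]
    using qiso_vdim_eq[OF isoZ, of i] by (auto simp: dimvec_def ext_rep_def direct_power_def algebra_simps)
  then show "dimvec Q U = (\<lambda>i. dimvec Q X i - sym_form Q (dimvec Q X) (dimvec Q S) * dimvec Q S i)"
    unfolding r s sym_form_def fun_eq_iff by (simp add: algebra_simps)
qed

section \<open>The root and its possible reductions\<close>

lemma fin_digraph_quiver8: "fin_digraph quiver8"
  by unfold_locales (auto simp: quiver8_def)

lemma ringel_form_quiver8: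
  "ringel_form quiver8 \<alpha> \<beta> = \<alpha> 1 * \<beta> 1 + \<alpha> 2 * \<beta> 2 + \<alpha> 3 * \<beta> 3 + \<alpha> 4 * \<beta> 4
     + \<alpha> 5 * \<beta> 5 + \<alpha> 6 * \<beta> 6 + \<alpha> 7 * \<beta> 7 + \<alpha> 8 * \<beta> 8
     - (\<alpha> 1 * \<beta> 4 + \<alpha> 2 * \<beta> 4 + \<alpha> 3 * \<beta> 4 + \<alpha> 4 * \<beta> 5 + \<alpha> 5 * \<beta> 6 + \<alpha> 5 * \<beta> 7 + \<alpha> 5 * \<beta> 8)"
proof -
  have "{1..8::nat} = {1, 2, 3, 4, 5, 6, 7, 8}" by auto
  then show ?thesis by (simp add: ringel_form_def quiver8_def)
qed

lemma reflection_quiver8: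
  assumes "i \<in> verts quiver8"
  shows "reflection quiver8 i \<alpha> = \<alpha>(i := - \<alpha> i +
    (if i = 4 then \<alpha> 1 + \<alpha> 2 + \<alpha> 3 + \<alpha> 5 else if i = 5 then \<alpha> 4 + \<alpha> 6 + \<alpha> 7 + \<alpha> 8
     else if i < 4 then \<alpha> 4 else \<alpha> 5))"
proof -
  have "i \<in> {1, 2, 3, 4, 5, 6, 7, 8}" using assms by (auto simp: quiver8_def)
  then show ?thesis
    by (auto simp: reflection_def sym_form_def ringel_form_quiver8 coord_vec_def fun_eq_iff)
qed

text \<open>Stated on the diagonal: the quadratic form is invariant under reflections, whereas the
  nonsymmetric bilinear form is not.\<close>

lemma ringel_form_reflection_quiver8:
  assumes "i \<in> verts quiver8"
  shows "ringel_form quiver8 (reflection quiver8 i \<alpha>) (reflection quiver8 i \<alpha>) = ringel_form quiver8 \<alpha> \<alpha>"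
proof -
  have "i \<in> {1, 2, 3, 4, 5, 6, 7, 8}" using assms by (auto simp: quiver8_def)
  then show ?thesis
    unfolding reflection_quiver8[OF assms]
    by (auto simp: ringel_form_quiver8 algebra_simps)
qed

lemma positive_real_root_quiver8:
  assumes "positive_real_root quiver8 \<beta>"
  shows "ringel_form quiver8 \<beta> \<beta> = 1" "\<And>i. 0 \<le> \<beta> i"
proof -
  obtain w i where w: "w \<in> weyl_group quiver8" and i: "i \<in> verts quiver8" and \<beta>: "\<beta> = w (coord_vec i)"
    using assms by (auto simp: positive_real_root_def)
  have "i \<in> {1, 2, 3, 4, 5, 6, 7, 8}" using i by (auto simp: quiver8_def)
  then have "ringel_form quiver8 (coord_vec i) (coord_vec i) = 1"
    by (auto simp: ringel_form_quiver8 coord_vec_def)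
  moreover from w have "ringel_form quiver8 (w \<alpha>) (w \<alpha>) = ringel_form quiver8 \<alpha> \<alpha>" for \<alpha>
    by induction (auto simp: ringel_form_reflection_quiver8)
  ultimately show "ringel_form quiver8 \<beta> \<beta> = 1" unfolding \<beta> by simp
  show "\<And>i. 0 \<le> \<beta> i" using assms by (auto simp: positive_real_root_def)
qed

text \<open>When \<open>(\<alpha>, b) = 1\<close>, this equation and \<open>r = \<langle>\<alpha>, b\<rangle>\<close> determine \<open>b\<^sub>4\<close> and \<open>t = b\<^sub>7 + b\<^sub>8\<close> from
  \<open>b\<^sub>5\<close>, \<open>b\<^sub>6\<close> and \<open>B = b\<^sub>1 + b\<^sub>2 + b\<^sub>3\<close>, which equals \<open>b\<^sub>1\<^sup>2 + b\<^sub>2\<^sup>2 + b\<^sub>3\<^sup>2\<close> as these entries are \<open>0\<close> or \<open>1\<close>.\<close>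

lemma no_reduction_by_one:
  "\<forall>B\<in>set [0..3]. \<forall>b5\<in>set [0..12]. \<forall>b6\<in>set [0..2]. \<forall>r\<in>set [0..1].
     let t15 = 31 * B + 5 + 30 * b6 + 4 * b5 - r; t = t15 div 15; b4 = 1 + 6 * B + 8 * b6 - 2 * t in
     t15 mod 15 = 0 \<longrightarrow>
     (\<forall>b7\<in>set [0..7]. B + b4 * b4 + b5 * b5 + b6 * b6 + b7 * b7 + (t - b7) * (t - b7)
        - b4 * (B + b5) - b5 * (b6 + t) \<noteq> (1::int) \<or> t - b7 > 7 \<or> t < b7 \<or> b4 < 0)"
  by code_simp

text \<open>The search for \<open>m \<ge> 2\<close>, where the entries at 1, 2, 3 vanish and each
  other entry is at most half of that of \<open>alpha8\<close>. The conditions are, in order, that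
  \<open>b\<close> has quadratic form 1, that both Ringel forms with \<open>alpha8\<close> are
  nonnegative, and that their sum is at least 2.\<close>

lemma reductions_by_more:
  "\<forall>b4\<in>set [0..4]. \<forall>b5\<in>set [0..6]. \<forall>b6\<in>set [0..1]. \<forall>b7\<in>set [0..3]. \<forall>b8\<in>set [0..3].
     b4 * b4 + b5 * b5 + b6 * b6 + b7 * b7 + b8 * b8 - b4 * b5 - b5 * (b6 + b7 + b8) = (1::int) \<longrightarrow>
     0 \<le> - 4 * b4 - 4 * b5 + 2 * b6 + 7 * b7 + 7 * b8 \<longrightarrow>
     0 \<le> 5 * b4 + 4 * b5 - 10 * b6 - 5 * b7 - 5 * b8 \<longrightarrow>
     2 \<le> b4 - 8 * b6 + 2 * b7 + 2 * b8 \<longrightarrow>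
     (b4, b5, b6, b7, b8) = (1, 2, 0, 1, 1)"
  by code_simp


text \<open>Nonnegativity of \<open>alpha8 - m b\<close> bounds every entry of \<open>b\<close>,
  since \<open>m\<close> is positive. The resulting finite search is split at \<open>m = 1\<close>,
  where the entries at 1, 2, 3 may be nonzero.\<close>

lemma numerical_reduction_of_alpha8:
  fixes b :: "nat \<Rightarrow> int"
  assumes nonneg: "\<And>i. 0 \<le> b i" and real: "ringel_form quiver8 b b = 1"
    and l: "0 \<le> ringel_form quiver8 b alpha8" and r: "0 \<le> ringel_form quiver8 alpha8 b"
    and m: "m = sym_form quiver8 alpha8 b" and m0: "m \<noteq> 0"
    and le: "\<And>i. i \<in> {1..8} \<Longrightarrow> m * b i \<le> alpha8 i"
  shows "m = 5 \<and> b 1 = 0 \<and> b 2 = 0 \<and> b 3 = 0 \<and> b 4 = 1 \<and> b 5 = 2"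
proof -
  have lf: "ringel_form quiver8 b alpha8 =
      - 7 * (b 1 + b 2 + b 3) - 4 * b 4 - 4 * b 5 + 2 * b 6 + 7 * b 7 + 7 * b 8"
    and rf: "ringel_form quiver8 alpha8 b =
      b 1 + b 2 + b 3 + 5 * b 4 + 4 * b 5 - 10 * b 6 - 5 * b 7 - 5 * b 8"
    by (simp_all add: ringel_form_quiver8 alpha8_def algebra_simps)
  have ms: "m = - 6 * (b 1 + b 2 + b 3) + b 4 - 8 * b 6 + 2 * b 7 + 2 * b 8"
    unfolding m sym_form_def lf rf by simp
  have "0 \<le> m" unfolding m sym_form_def using l r by simp
  with m0 have m1: "1 \<le> m" by simp
  have le': "m * b 1 \<le> 1" "m * b 2 \<le> 1" "m * b 3 \<le> 1" "m * b 4 \<le> 8" "m * b 5 \<le> 12" "m * b 6 \<le> 2"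
    "m * b 7 \<le> 7" "m * b 8 \<le> 7"
    using le[of 1] le[of 2] le[of 3] le[of 4] le[of 5] le[of 6] le[of 7] le[of 8] by (simp_all add: alpha8_def)
  note n = nonneg[of 1] nonneg[of 2] nonneg[of 3] nonneg[of 4] nonneg[of 5] nonneg[of 6] nonneg[of 7] nonneg[of 8]
  have q: "b 1 * b 1 + b 2 * b 2 + b 3 * b 3 + b 4 * b 4 + b 5 * b 5 + b 6 * b 6 + b 7 * b 7 + b 8 * b 8
     - b 4 * (b 1 + b 2 + b 3) - b 4 * b 5 - b 5 * (b 6 + b 7 + b 8) = 1"
    using real by (simp add: ringel_form_quiver8 algebra_simps)
  show ?thesis
  proof (cases "m = 1")
    case True
    define B where "B = b 1 + b 2 + b 3"
    define t where "t = b 7 + b 8"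
    define r where "r = ringel_form quiver8 alpha8 b"
    \<comment> \<open>Two nonnegative integers with sum \<open>m = 1\<close>, so each is 0 or
      1.\<close>
    have r01: "r \<in> set [0..1]"
      using l assms(4) True unfolding m sym_form_def r_def by auto
    have sq: "b 1 * b 1 = b 1" "b 2 * b 2 = b 2" "b 3 * b 3 = b 3"
    proof -
      have "b 1 = 0 \<or> b 1 = 1" "b 2 = 0 \<or> b 2 = 1" "b 3 = 0 \<or> b 3 = 1"
        using le'(1-3) n(1-3) unfolding True by linarith+
      then show "b 1 * b 1 = b 1" "b 2 * b 2 = b 2" "b 3 * b 3 = b 3" by auto
    qed
    have B: "B \<in> set [0..3]" "b 5 \<in> set [0..12]" "b 6 \<in> set [0..2]" "b 7 \<in> set [0..7]"
      using le' n True by (simp_all add: B_def)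
    have t4: "b 4 = 1 + 6 * B + 8 * b 6 - 2 * t"
      using ms True unfolding B_def t_def by (simp add: algebra_simps)
    have "r = B + 5 * b 4 + 4 * b 5 - 10 * b 6 - 5 * t"
      using rf unfolding B_def t_def r_def by (simp add: algebra_simps)
    \<comment> \<open>Substituting the formula for \<open>b 4\<close> into that for \<open>r\<close>
      leaves \<open>t\<close> with coefficient 15, hence the divisibility test in the
      search.\<close>
    then have "31 * B + 5 + 30 * b 6 + 4 * b 5 - r = 15 * t"
      unfolding t4 by (simp add: algebra_simps)
    note t = this t4
    have "B + b 4 * b 4 + b 5 * b 5 + b 6 * b 6 + b 7 * b 7 + (t - b 7) * (t - b 7)
        - b 4 * (B + b 5) - b 5 * (b 6 + t) = 1"
      using q unfolding sq B_def t_def by (simp add: algebra_simps)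
    moreover have "t - b 7 \<le> 7" "b 7 \<le> t" using le' n True by (simp_all add: t_def)
    ultimately have False
      using no_reduction_by_one[rule_format, OF B(1-3) r01] B(4) n(4)
      unfolding t(1) Let_def by (auto simp flip: t(2))
    then show ?thesis ..
  next
    case False
    with m1 have m2: "2 \<le> m" by simp
    \<comment> \<open>From \<open>2 * b i \<le> m * b i \<le> alpha8 i\<close> the entries bounded
      by 1 vanish and the other bounds are halved.\<close>
    have two: "2 * b i \<le> m * b i" for i using m2 nonneg by (intro mult_right_mono) auto
    have z: "b 1 = 0" "b 2 = 0" "b 3 = 0" using two[of 1] two[of 2] two[of 3] le'(1-3) n(1-3) by linarith+
    have B: "b 4 \<in> set [0..4]" "b 5 \<in> set [0..6]" "b 6 \<in> set [0..1]" "b 7 \<in> set [0..3]" "b 8 \<in> set [0..3]"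
      using two[of 4] two[of 5] two[of 6] two[of 7] two[of 8] le' n by auto
    have "(b 4, b 5, b 6, b 7, b 8) = (1, 2, 0, 1, 1)"
      by (rule reductions_by_more[rule_format, OF B]) (use q l r m2 lf rf ms z in auto)
    then show ?thesis using z ms by simp
  qed
qed

section \<open>The root as a word of reflections applied to a coordinate vector\<close>

lemma foldr_reflection_weyl_group:
  assumes "set is \<subseteq> verts Q"
  shows "foldr (reflection Q) is \<in> weyl_group Q"
  using assms by (induction "is") (auto intro: weyl_group.intros)

definition vec8 :: "int list \<Rightarrow> nat \<Rightarrow> int" where
  "vec8 xs i = (if i \<in> {1..8} then xs ! (i - 1) else 0)"

lemma fun8_eqI:
  fixes v w :: "nat \<Rightarrow> int"
  assumes "\<And>i. i \<notin> {1..8} \<Longrightarrow> v i = w i"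
    "v 1 = w 1" "v 2 = w 2" "v 3 = w 3" "v 4 = w 4" "v 5 = w 5" "v 6 = w 6" "v 7 = w 7" "v 8 = w 8"
  shows "v = w"
proof
  fix i :: nat
  have "i \<notin> {1..8} \<or> i \<in> {1, 2, 3, 4, 5, 6, 7, 8}" by auto
  then show "v i = w i" using assms by auto
qed

text \<open>Rewrite rules that let the simplifier evaluate a word of reflections on explicit
  coordinates.\<close>

lemma reflection_vec8:
  "reflection quiver8 1 (vec8 [a, b, c, d, e, f, g, h]) = vec8 [d - a, b, c, d, e, f, g, h]"
  "reflection quiver8 2 (vec8 [a, b, c, d, e, f, g, h]) = vec8 [a, d - b, c, d, e, f, g, h]"
  "reflection quiver8 3 (vec8 [a, b, c, d, e, f, g, h]) = vec8 [a, b, d - c, d, e, f, g, h]"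
  "reflection quiver8 4 (vec8 [a, b, c, d, e, f, g, h]) = vec8 [a, b, c, a + b + c + e - d, e, f, g, h]"
  "reflection quiver8 5 (vec8 [a, b, c, d, e, f, g, h]) = vec8 [a, b, c, d, d + f + g + h - e, f, g, h]"
  "reflection quiver8 6 (vec8 [a, b, c, d, e, f, g, h]) = vec8 [a, b, c, d, e, e - f, g, h]"
  "reflection quiver8 7 (vec8 [a, b, c, d, e, f, g, h]) = vec8 [a, b, c, d, e, f, e - g, h]"
  "reflection quiver8 8 (vec8 [a, b, c, d, e, f, g, h]) = vec8 [a, b, c, d, e, f, g, e - h]"
  by (rule fun8_eqI; auto simp: reflection_quiver8[unfolded quiver8_def pre_digraph.simps, folded quiver8_def] vec8_def)+

lemma positive_real_root_alpha8: "positive_real_root quiver8 alpha8"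
proof -
  have a: "alpha8 = vec8 [1, 1, 1, 8, 12, 2, 7, 7]" by (auto simp: alpha8_def vec8_def)
  \<comment> \<open>Read from the left, the word lowers one coordinate of \<open>alpha8\<close> at
    each step until \<open>coord_vec 4\<close> remains. As reflections are involutions,
    \<open>foldr\<close>, which starts at the right end, rebuilds \<open>alpha8\<close>.\<close>
  let ?is = "[4, 5, 7, 5, 4, 8, 5, 4, 7, 5, 6, 8, 5, 4, 1, 2, 3 :: nat]"
  have e: "coord_vec 4 = vec8 [0, 0, 0, 1, 0, 0, 0, 0]"
    by (rule fun8_eqI) (auto simp: coord_vec_def vec8_def)
  have "alpha8 = foldr (reflection quiver8) ?is (coord_vec 4)"
    unfolding a e by (simp add: reflection_vec8 del: One_nat_def)
  moreover have "foldr (reflection quiver8) ?is \<in> weyl_group quiver8"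
    by (rule foldr_reflection_weyl_group) (auto simp: quiver8_def)
  moreover have "0 \<le> alpha8 i" for i
  proof -
    have "i \<notin> {1..8} \<or> i \<in> {1, 2, 3, 4, 5, 6, 7, 8}" by auto
    then show ?thesis by (auto simp: alpha8_def)
  qed
  moreover have "alpha8 1 \<noteq> 0" by (simp add: alpha8_def)
  moreover have "4 \<in> verts quiver8" by (simp add: quiver8_def)
  ultimately show ?thesis unfolding positive_real_root_def by blast
qed

section \<open>The root is not a Schur root\<close>

text \<open>There are more unknowns, the entries of \<open>v\<close> and \<open>w\<close>, than
  scalar equations, one for each row. Vectors are encoded as matrices with one column, so that a
  column times a row is an ordinary matrix product.\<close>

lemma common_kernel_pair:
  fixes Ms :: "('k::field mat \<times> 'k mat) list"
  assumes dims: "\<And>M N. (M, N) \<in> set Ms \<Longrightarrow> dim_row N = dim_row M \<and> dim_col M = n \<and> dim_col N = m"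
    and less: "(\<Sum>(M, N)\<leftarrow>Ms. dim_row M) < n + m"
  shows "\<exists>v\<in>carrier_mat n 1. \<exists>w\<in>carrier_mat m 1. (v \<noteq> 0\<^sub>m n 1 \<or> w \<noteq> 0\<^sub>m m 1) \<and>
    (\<forall>(M, N)\<in>set Ms. M * v + N * w = 0\<^sub>m (dim_row M) 1)"
proof -
  define J where "J = (SIGMA k:{..<length Ms}. {..<dim_row (fst (Ms ! k))})"
  define I :: "(nat + nat) set" where "I = {..<n} <+> {..<m}"
  define a where "a = (\<lambda>(k, p) u. case u of Inl l \<Rightarrow> fst (Ms ! k) $$ (p, l) | Inr l \<Rightarrow> snd (Ms ! k) $$ (p, l))"
  have "card J = (\<Sum>(M, N)\<leftarrow>Ms. dim_row M)"
    by (simp add: J_def sum_list_sum_nth atLeast0LessThan split_def)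
  then have "finite J" "finite I" "card J < card I"
    using less by (auto simp: J_def I_def card_Plus)
  from homogeneous_system_nontrivial_solution[OF this, of a] obtain x where x: "\<exists>i\<in>I. x i \<noteq> 0"
    and eq: "\<And>k p. (k, p) \<in> J \<Longrightarrow> (\<Sum>i\<in>I. a (k, p) i * x i) = 0" by blast
  define v w where "v = mat n 1 (\<lambda>(p, q). x (Inl p))" and "w = mat m 1 (\<lambda>(p, q). x (Inr p))"
  have vw: "v \<in> carrier_mat n 1" "w \<in> carrier_mat m 1" by (auto simp: v_def w_def)
  have "v \<noteq> 0\<^sub>m n 1 \<or> w \<noteq> 0\<^sub>m m 1"
  proof (rule ccontr)
    assume "\<not> (v \<noteq> 0\<^sub>m n 1 \<or> w \<noteq> 0\<^sub>m m 1)"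
    then have vw0: "v = 0\<^sub>m n 1" "w = 0\<^sub>m m 1" by auto
    have "x (Inl p) = 0" if "p < n" for p using arg_cong[OF vw0(1), of "\<lambda>M. M $$ (p, 0)"] that by (simp add: v_def)
    moreover have "x (Inr p) = 0" if "p < m" for p using arg_cong[OF vw0(2), of "\<lambda>M. M $$ (p, 0)"] that by (simp add: w_def)
    ultimately show False using x by (auto simp: I_def)
  qed
  moreover have "M * v + N * w = 0\<^sub>m (dim_row M) 1" if MN: "(M, N) \<in> set Ms" for M N
  proof (rule eq_matI)
    have M: "M \<in> carrier_mat (dim_row M) n" and N: "N \<in> carrier_mat (dim_row M) m" using dims[OF MN] by auto
    obtain k where k: "k < length Ms" "Ms ! k = (M, N)" using MN by (auto simp: in_set_conv_nth)
    fix p q assume "p < dim_row (0\<^sub>m (dim_row M) 1 :: 'k mat)" "q < dim_col (0\<^sub>m (dim_row M) 1 :: 'k mat)"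
    then have pq: "p < dim_row M" "q < 1" by auto
    have "(M * v + N * w) $$ (p, q) = (M * v) $$ (p, q) + (N * w) $$ (p, q)"
      by (rule index_add_mat(1)) (use pq dims[OF MN] in \<open>auto simp: w_def\<close>)
    also have "\<dots> = (\<Sum>i\<in>I. a (k, p) i * x i)"
      unfolding index_mult_mat_sum[OF M vw(1) pq] index_mult_mat_sum[OF N vw(2) pq]
      using pq by (simp add: I_def sum.Plus a_def k v_def w_def)
    also have "\<dots> = 0" using k pq by (intro eq) (simp add: J_def)
    finally show "(M * v + N * w) $$ (p, q) = 0\<^sub>m (dim_row M) 1 $$ (p, q)" using pq by simp
  qed (use dims[OF MN] in \<open>auto simp: w_def\<close>)
  ultimately show ?thesis using vw by blast
qed

lemma common_left_kernel_pair:
  fixes Ms :: "('k::field mat \<times> 'k mat) list"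
  assumes dims: "\<And>M N. (M, N) \<in> set Ms \<Longrightarrow> dim_col N = dim_col M \<and> dim_row M = n \<and> dim_row N = m"
    and less: "(\<Sum>(M, N)\<leftarrow>Ms. dim_col M) < n + m"
  shows "\<exists>v\<in>carrier_mat 1 n. \<exists>w\<in>carrier_mat 1 m. (v \<noteq> 0\<^sub>m 1 n \<or> w \<noteq> 0\<^sub>m 1 m) \<and>
    (\<forall>(M, N)\<in>set Ms. v * M + w * N = 0\<^sub>m 1 (dim_col M))"
proof -
  let ?Ms = "map (\<lambda>(M, N). (transpose_mat M, transpose_mat N)) Ms"
  have s: "(\<Sum>(M, N)\<leftarrow>?Ms. dim_row M) = (\<Sum>(M, N)\<leftarrow>Ms. dim_col M)"
    by (simp add: o_def split_def)
  have "\<exists>v\<in>carrier_mat n 1. \<exists>w\<in>carrier_mat m 1. (v \<noteq> 0\<^sub>m n 1 \<or> w \<noteq> 0\<^sub>m m 1) \<and>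
    (\<forall>(M, N)\<in>set ?Ms. M * v + N * w = 0\<^sub>m (dim_row M) 1)"
    by (rule common_kernel_pair) (use dims less s in auto)
  then obtain v w where vw: "v \<in> carrier_mat n 1" "w \<in> carrier_mat m 1" "v \<noteq> 0\<^sub>m n 1 \<or> w \<noteq> 0\<^sub>m m 1"
    and k: "\<forall>(M, N)\<in>set ?Ms. M * v + N * w = 0\<^sub>m (dim_row M) 1" by blast
  have "transpose_mat v * M + transpose_mat w * N = 0\<^sub>m 1 (dim_col M)" if MN: "(M, N) \<in> set Ms" for M N
  proof -
    obtain r where M: "M \<in> carrier_mat n r" and N: "N \<in> carrier_mat m r"
      using dims[OF MN] by (metis carrier_matI)
    have "(transpose_mat M, transpose_mat N) \<in> set ?Ms" using MN by force
    from bspec[OF k this] have z: "transpose_mat M * v + transpose_mat N * w = 0\<^sub>m r 1"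
      using M by simp
    have "transpose_mat (transpose_mat M * v + transpose_mat N * w) =
        transpose_mat (transpose_mat M * v) + transpose_mat (transpose_mat N * w)"
      by (rule transpose_add[of _ r 1]) (use M N vw in auto)
    also have "transpose_mat (transpose_mat M * v) = transpose_mat v * transpose_mat (transpose_mat M)"
      by (rule transpose_mult[of _ r n _ 1]) (use M vw in auto)
    also have "transpose_mat (transpose_mat N * w) = transpose_mat w * transpose_mat (transpose_mat N)"
      by (rule transpose_mult[of _ r m _ 1]) (use N vw in auto)
    finally have "transpose_mat v * M + transpose_mat w * N = 0\<^sub>m 1 r"
      unfolding z transpose_transpose zero_transpose_mat by (rule sym)
    then show ?thesis using M by simp
  qed
  moreover have "transpose_mat v \<noteq> 0\<^sub>m 1 n \<or> transpose_mat w \<noteq> 0\<^sub>m 1 m"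
  proof -
    have "v = 0\<^sub>m n 1" if "transpose_mat v = 0\<^sub>m 1 n" using arg_cong[OF that, of transpose_mat] by simp
    moreover have "w = 0\<^sub>m m 1" if "transpose_mat w = 0\<^sub>m 1 m" using arg_cong[OF that, of transpose_mat] by simp
    ultimately show ?thesis using vw(3) by blast
  qed
  ultimately show ?thesis using vw(1,2) by (intro bexI[of _ "transpose_mat v"] bexI[of _ "transpose_mat w"]) auto
qed

text \<open>The pair version with an empty second block of unknowns.\<close>

lemma common_left_kernel:
  fixes Ms :: "'k::field mat list"
  assumes dims: "\<And>M. M \<in> set Ms \<Longrightarrow> dim_row M = n" and less: "(\<Sum>M\<leftarrow>Ms. dim_col M) < n"
  shows "\<exists>v\<in>carrier_mat 1 n. v \<noteq> 0\<^sub>m 1 n \<and> (\<forall>M\<in>set Ms. v * M = 0\<^sub>m 1 (dim_col M))"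
proof -
  let ?Ms = "map (\<lambda>M. (M, 0\<^sub>m 0 (dim_col M))) Ms"
  have "\<exists>v\<in>carrier_mat 1 n. \<exists>w\<in>carrier_mat 1 0. (v \<noteq> 0\<^sub>m 1 n \<or> w \<noteq> 0\<^sub>m 1 0) \<and>
    (\<forall>(M, N)\<in>set ?Ms. v * M + w * N = 0\<^sub>m 1 (dim_col M))"
    by (rule common_left_kernel_pair) (use dims less in \<open>auto simp: o_def\<close>)
  then obtain v w where vw: "v \<in> carrier_mat 1 n" "w \<in> carrier_mat 1 0" "v \<noteq> 0\<^sub>m 1 n \<or> w \<noteq> 0\<^sub>m 1 0"
    and k: "\<And>M. M \<in> set Ms \<Longrightarrow> v * M + w * 0\<^sub>m 0 (dim_col M) = 0\<^sub>m 1 (dim_col M)" by auto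
  have w: "w = 0\<^sub>m 1 0" using vw(2) by (intro eq_matI) auto
  have "v * M = 0\<^sub>m 1 (dim_col M)" if "M \<in> set Ms" for M
  proof -
    obtain r where r: "dim_col M = r" by blast
    then have "v * M \<in> carrier_mat 1 r" using vw(1) by auto
    then show ?thesis using k[OF that] unfolding w r by simp
  qed
  with vw w show ?thesis by auto
qed

text \<open>Turns the vanishing of a component of an endomorphism into the vanishing of one of its
  factors: a nonzero entry of \<open>w\<close> can be cancelled.\<close>

lemma column_times_row_eq_0:
  fixes v w :: "'k::field mat"
  assumes v: "v \<in> carrier_mat n 1" and w: "w \<in> carrier_mat 1 m" and z: "v * w = 0\<^sub>m n m"
  shows "v = 0\<^sub>m n 1 \<or> w = 0\<^sub>m 1 m"
proof (rule disjCI)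
  assume "w \<noteq> 0\<^sub>m 1 m"
  then obtain q where q: "q < m" "w $$ (0, q) \<noteq> 0" using w by (auto simp: mat_eq_iff)
  have "v $$ (p, 0) = 0" if "p < n" for p
  proof -
    have "(v * w) $$ (p, q) = v $$ (p, 0) * w $$ (0, q)"
      using index_mult_mat_sum[OF v w that q(1)] by simp
    then show ?thesis using z that q by simp
  qed
  then show "v = 0\<^sub>m n 1" using v by (intro eq_matI) auto
qed

section \<open>Endomorphisms of a representation whose dimension vector is the root\<close>

lemma vdim_of_dimvec_alpha8:
  assumes "dimvec quiver8 X = alpha8"
  shows "vdim X 1 = 1" "vdim X 2 = 1" "vdim X 3 = 1" "vdim X 4 = 8" "vdim X 5 = 12" "vdim X 6 = 2"
    "vdim X 7 = 7" "vdim X 8 = 7"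
proof -
  have "int (vdim X i) = alpha8 i" if "i \<in> {1..8}" for i
    using fun_cong[OF assms, of i] that by (simp add: dimvec_def quiver8_def)
  from this[of 1] this[of 2] this[of 3] this[of 4] this[of 5] this[of 6] this[of 7] this[of 8]
  show "vdim X 1 = 1" "vdim X 2 = 1" "vdim X 3 = 1" "vdim X 4 = 8" "vdim X 5 = 12" "vdim X 6 = 2"
    "vdim X 7 = 7" "vdim X 8 = 7"
    by (simp_all add: alpha8_def)
qed

text \<open>The maps at the vertices \<open>1\<close>, \<open>2\<close>, \<open>3\<close>, \<open>6\<close> are taken to be \<open>0\<close>, which forces the scalar to be \<open>0\<close>.\<close>

lemma endomorphism_alpha8_eq_0:
  fixes X :: "(nat, nat \<times> nat, 'k::field) quiver_rep"
  assumes X: "is_rep quiver8 X" and dim: "dimvec quiver8 X = alpha8" and End: "end_is_field quiver8 X"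
    and c: "E4 \<in> carrier_mat 8 8" "E5 \<in> carrier_mat 12 12" "E7 \<in> carrier_mat 7 7" "E8 \<in> carrier_mat 7 7"
    and W: "\<And>i. i \<in> {1, 2, 3} \<Longrightarrow> E4 * amap X (i, 4) = 0\<^sub>m 8 1"
    and A: "amap X (4, 5) * E4 = E5 * amap X (4, 5)" and B: "amap X (5, 6) * E5 = 0\<^sub>m 2 12"
    and C: "amap X (5, 7) * E5 = E7 * amap X (5, 7)" and D: "amap X (5, 8) * E5 = E8 * amap X (5, 8)"
  shows "E4 = 0\<^sub>m 8 8" "E5 = 0\<^sub>m 12 12" "E7 = 0\<^sub>m 7 7" "E8 = 0\<^sub>m 7 7"
proof -
  note d = vdim_of_dimvec_alpha8[OF dim]
  have v: "verts quiver8 = {1, 2, 3, 4, 5, 6, 7, 8}" by (auto simp: quiver8_def)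
  have ac: "amap X (1, 4) \<in> carrier_mat 8 1" "amap X (2, 4) \<in> carrier_mat 8 1" "amap X (3, 4) \<in> carrier_mat 8 1"
    "amap X (4, 5) \<in> carrier_mat 12 8" "amap X (5, 6) \<in> carrier_mat 2 12"
    using X d by (auto simp: is_rep_def quiver8_def)
  define f where "f = (\<lambda>i::nat. if i = 4 then E4 else if i = 5 then E5 else if i = 7 then E7
    else if i = 8 then E8 else 0\<^sub>m (vdim X i) (vdim X i))"
  have f: "f 1 = 0\<^sub>m 1 1" "f 2 = 0\<^sub>m 1 1" "f 3 = 0\<^sub>m 1 1" "f 4 = E4" "f 5 = E5" "f 6 = 0\<^sub>m 2 2" "f 7 = E7" "f 8 = E8"
    by (simp_all only: f_def d) simp_all
  have "f \<in> qhom quiver8 X X"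
    unfolding qhom_def
  proof (intro CollectI conjI)
    show "\<forall>i\<in>verts quiver8. f i \<in> carrier_mat (vdim X i) (vdim X i)"
      unfolding v by (simp only: ball_simps f d c zero_carrier_mat simp_thms)
    have W': "E4 * amap X (1, 4) = 0\<^sub>m 8 1" "E4 * amap X (2, 4) = 0\<^sub>m 8 1" "E4 * amap X (3, 4) = 0\<^sub>m 8 1"
      by (rule W; simp)+
    have "amap X (1, 4) * 0\<^sub>m 1 1 = E4 * amap X (1, 4)" "amap X (2, 4) * 0\<^sub>m 1 1 = E4 * amap X (2, 4)"
      "amap X (3, 4) * 0\<^sub>m 1 1 = E4 * amap X (3, 4)" "amap X (5, 6) * E5 = 0\<^sub>m 2 2 * amap X (5, 6)"
      unfolding B W'
        right_mult_zero_mat[OF ac(1)] right_mult_zero_mat[OF ac(2)] right_mult_zero_mat[OF ac(3)]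
        left_mult_zero_mat[OF ac(5)] by (rule refl)+
    with A C D show "\<forall>a\<in>arcs quiver8. amap X a * f (tail quiver8 a) = f (head quiver8 a) * amap X a"
      unfolding quiver8_def pre_digraph.simps by (simp only: ball_simps fst_conv snd_conv f simp_thms)
  qed
  then obtain e where e: "\<And>i. i \<in> verts quiver8 \<Longrightarrow> f i = e \<cdot>\<^sub>m 1\<^sub>m (vdim X i)"
    using End unfolding end_is_field_def by blast
  have e': "f 4 = e \<cdot>\<^sub>m 1\<^sub>m 8" "f 5 = e \<cdot>\<^sub>m 1\<^sub>m 12" "f 6 = e \<cdot>\<^sub>m 1\<^sub>m 2" "f 7 = e \<cdot>\<^sub>m 1\<^sub>m 7" "f 8 = e \<cdot>\<^sub>m 1\<^sub>m 7"
    using e[of 4] e[of 5] e[of 6] e[of 7] e[of 8] unfolding v d by simp_all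
  have "(e \<cdot>\<^sub>m 1\<^sub>m 2) $$ (0, 0) = (0\<^sub>m 2 2 :: 'k mat) $$ (0, 0)"
    using e'(3) unfolding f by simp
  then have "e = 0" by simp
  moreover have "0 \<cdot>\<^sub>m 1\<^sub>m n = (0\<^sub>m n n :: 'k mat)" for n by (intro eq_matI) auto
  ultimately show "E4 = 0\<^sub>m 8 8" "E5 = 0\<^sub>m 12 12" "E7 = 0\<^sub>m 7 7" "E8 = 0\<^sub>m 7 7"
    using e' unfolding f by simp_all
qed

text \<open>The hypotheses are the commuting squares for the components named in the conclusion. The
  equations for \<open>q\<close> and \<open>p\<close> keep the columns \<open>C * y\<close> and
  \<open>D * x\<close> as factors, so the rows are unconstrained when these columns vanish.\<close>

lemma rank_one_endomorphism_alpha8: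
  fixes X :: "(nat, nat \<times> nat, 'k::field) quiver_rep"
  assumes X: "is_rep quiver8 X" and dim: "dimvec quiver8 X = alpha8" and End: "end_is_field quiver8 X"
    and Xc: "A \<in> carrier_mat 12 8" "B \<in> carrier_mat 2 12" "C \<in> carrier_mat 7 12" "D \<in> carrier_mat 7 12"
    and XW: "\<forall>i\<in>{1, 2, 3}. amap X (i, 4) \<in> carrier_mat 8 1"
    and maps: "amap X (4, 5) = A" "amap X (5, 6) = B" "amap X (5, 7) = C" "amap X (5, 8) = D"
    and col: "u \<in> carrier_mat 8 1" "x \<in> carrier_mat 12 1" "y \<in> carrier_mat 12 1"
    and row: "\<phi>4 \<in> carrier_mat 1 8" "p \<in> carrier_mat 1 12" "q \<in> carrier_mat 1 12"
      "\<phi>7 \<in> carrier_mat 1 7" "\<phi>8 \<in> carrier_mat 1 7"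
    and W: "\<forall>i\<in>{1, 2, 3}. \<phi>4 * amap X (i, 4) = 0\<^sub>m 1 1"
    and A: "(A * u) * \<phi>4 = x * (p * A) + y * (q * A)"
    and B: "B * x = 0\<^sub>m 2 1" "B * y = 0\<^sub>m 2 1"
    and C: "C * x = 0\<^sub>m 7 1" "(C * y) * q = (C * y) * (\<phi>7 * C)"
    and D: "D * y = 0\<^sub>m 7 1" "(D * x) * p = (D * x) * (\<phi>8 * D)"
  shows "u * \<phi>4 = 0\<^sub>m 8 8" "x * p + y * q = 0\<^sub>m 12 12" "(C * y) * \<phi>7 = 0\<^sub>m 7 7" "(D * x) * \<phi>8 = 0\<^sub>m 7 7"
proof -
  note cs = Xc col row
  note dims = cs[THEN carrier_matD(1)] cs[THEN carrier_matD(2)]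
  have E: "u * \<phi>4 \<in> carrier_mat 8 8" "x * p + y * q \<in> carrier_mat 12 12"
    "(C * y) * \<phi>7 \<in> carrier_mat 7 7" "(D * x) * \<phi>8 \<in> carrier_mat 7 7"
    using cs by auto
  have eW: "(u * \<phi>4) * amap X (i, 4) = 0\<^sub>m 8 1" if "i \<in> {1, 2, 3}" for i
    using assoc_mult_mat[OF col(1) row(1) bspec[OF XW that]] bspec[OF W that] col(1) by simp
  have eA: "amap X (4, 5) * (u * \<phi>4) = (x * p + y * q) * amap X (4, 5)"
    unfolding maps using A by (simp add: dims mat_distrib_dim mat_mult_assoc_dim)
  have "B * (x * p + y * q) = (B * x) * p + (B * y) * q" by (simp add: dims mat_distrib_dim mat_mult_assoc_dim)
  then have eB: "amap X (5, 6) * (x * p + y * q) = 0\<^sub>m 2 12"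
    unfolding maps B using row by simp
  have "C * (x * p + y * q) = (C * x) * p + (C * y) * q" by (simp add: dims mat_distrib_dim mat_mult_assoc_dim)
  also have "\<dots> = (C * y) * (\<phi>7 * C)" unfolding C using cs mult_carrier_mat[OF mult_carrier_mat[OF Xc(3) col(3)] mult_carrier_mat[OF row(4) Xc(3)]]
    by simp
  finally have eC: "amap X (5, 7) * (x * p + y * q) = ((C * y) * \<phi>7) * amap X (5, 7)"
    unfolding maps by (simp add: dims mat_mult_assoc_dim)
  have "D * (x * p + y * q) = (D * x) * p + (D * y) * q" by (simp add: dims mat_distrib_dim mat_mult_assoc_dim)
  also have "\<dots> = (D * x) * (\<phi>8 * D)" unfolding D using cs mult_carrier_mat[OF mult_carrier_mat[OF Xc(4) col(2)] mult_carrier_mat[OF row(5) Xc(4)]]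
    by simp
  finally have eD: "amap X (5, 8) * (x * p + y * q) = ((D * x) * \<phi>8) * amap X (5, 8)"
    unfolding maps by (simp add: dims mat_mult_assoc_dim)
  show "u * \<phi>4 = 0\<^sub>m 8 8" "x * p + y * q = 0\<^sub>m 12 12" "(C * y) * \<phi>7 = 0\<^sub>m 7 7" "(D * x) * \<phi>8 = 0\<^sub>m 7 7"
    using endomorphism_alpha8_eq_0[OF X dim End E eW eA eB eC eD] by blast+
qed


theorem no_schur_representation_of_alpha8:
  fixes X :: "(nat, nat \<times> nat, 'k::field) quiver_rep"
  assumes X: "is_rep quiver8 X" and dim: "dimvec quiver8 X = alpha8"
  shows "\<not> end_is_field quiver8 X"
proof
  assume End: "end_is_field quiver8 X"
  note d = vdim_of_dimvec_alpha8[OF dim]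
  obtain A B C D where maps: "amap X (4, 5) = A" "amap X (5, 6) = B" "amap X (5, 7) = C" "amap X (5, 8) = D"
    by blast
  have Xc: "A \<in> carrier_mat 12 8" "B \<in> carrier_mat 2 12" "C \<in> carrier_mat 7 12" "D \<in> carrier_mat 7 12"
    and Wc: "amap X (1, 4) \<in> carrier_mat 8 1" "amap X (2, 4) \<in> carrier_mat 8 1" "amap X (3, 4) \<in> carrier_mat 8 1"
    using X d maps by (auto simp: is_rep_def quiver8_def)
  have XW: "\<forall>i\<in>{1, 2, 3}. amap X (i, 4) \<in> carrier_mat 8 1"
    using Wc by auto
  note no_endo = rank_one_endomorphism_alpha8[OF X dim End Xc XW maps]
  have AW: "C * A * amap X (i, 4) \<in> carrier_mat 7 1" "D * A * amap X (i, 4) \<in> carrier_mat 7 1"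
    if "i \<in> {1, 2, 3}" for i
    using Xc bspec[OF XW that] by auto
  note XD = Xc[THEN carrier_matD(1)] Xc[THEN carrier_matD(2)]
  have WD: "dim_row (amap X (i, 4)) = 8" "dim_col (amap X (i, 4)) = 1" if "i \<in> {1, 2, 3}" for i
    using bspec[OF XW that] by auto
  have W1: "1 \<in> {1, 2, 3 :: nat}" "2 \<in> {1, 2, 3 :: nat}" "3 \<in> {1, 2, 3 :: nat}" by auto
  note WDs = WD[OF W1(1)] WD[OF W1(2)] WD[OF W1(3)]
  have ker: "z = 0\<^sub>m 12 1" if z: "z \<in> carrier_mat 12 1" "B * z = 0\<^sub>m 2 1" "C * z = 0\<^sub>m 7 1" "D * z = 0\<^sub>m 7 1" for z
  proof -
    \<comment> \<open>The 8 columns of \<open>A\<close> leave a nonzero row \<open>p\<close> among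
      12 unknowns with \<open>p * A = 0\<close>. Then \<open>z * p\<close> alone at vertex 5 is an
      endomorphism, since all outgoing maps kill \<open>z\<close>.\<close>
    obtain p where p: "p \<in> carrier_mat 1 12" "p \<noteq> 0\<^sub>m 1 12" "p * A = 0\<^sub>m 1 8"
      using common_left_kernel[of "[A]" 12] Xc by auto
    have "z * p + 0\<^sub>m 12 1 * 0\<^sub>m 1 12 = 0\<^sub>m 12 12"
      by (rule no_endo(2)[of "0\<^sub>m 8 1" z "0\<^sub>m 12 1" "0\<^sub>m 1 8" p "0\<^sub>m 1 12" "0\<^sub>m 1 7" "0\<^sub>m 1 7"])
        (use z p Xc Wc in auto)
    moreover have "z * p \<in> carrier_mat 12 12" using z p by auto
    ultimately have "z * p = 0\<^sub>m 12 12" by simp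
    then show ?thesis using column_times_row_eq_0[OF z(1) p(1)] p(2) by blast
  qed
  have left_ker: "\<exists>\<phi>\<in>carrier_mat 1 7. \<phi> \<noteq> 0\<^sub>m 1 7 \<and> (\<forall>i\<in>{1, 2, 3}. \<phi> * (M * amap X (i, 4)) = 0\<^sub>m 1 1)"
    if M: "M \<in> carrier_mat 7 8" for M
  proof -
    let ?Ns = "[M * amap X (1, 4), M * amap X (2, 4), M * amap X (3, 4)]"
    have "\<exists>\<phi>\<in>carrier_mat 1 7. \<phi> \<noteq> 0\<^sub>m 1 7 \<and> (\<forall>N\<in>set ?Ns. \<phi> * N = 0\<^sub>m 1 (dim_col N))"
      by (rule common_left_kernel) (use M WDs in auto)
    then show ?thesis using M WDs by auto
  qed
  \<comment> \<open>18 equations in the 20 unknowns \<open>(u, x)\<close>, with \<open>y = A u - x\<close>\<close>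
  let ?Ms = "[(B * A, 0\<^sub>m 2 12), (0\<^sub>m 2 8, B), (0\<^sub>m 7 8, C), (D * A, - D)]"
  have "\<exists>u\<in>carrier_mat 8 1. \<exists>x\<in>carrier_mat 12 1. (u \<noteq> 0\<^sub>m 8 1 \<or> x \<noteq> 0\<^sub>m 12 1) \<and>
    (\<forall>(M, N)\<in>set ?Ms. M * u + N * x = 0\<^sub>m (dim_row M) 1)"
    by (rule common_kernel_pair) (auto simp: XD)
  then obtain u x where u: "u \<in> carrier_mat 8 1" and x: "x \<in> carrier_mat 12 1"
    and ux: "u \<noteq> 0\<^sub>m 8 1 \<or> x \<noteq> 0\<^sub>m 12 1"
    and eqs: "B * A * u + 0\<^sub>m 2 12 * x = 0\<^sub>m 2 1" "0\<^sub>m 2 8 * u + B * x = 0\<^sub>m 2 1"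
      "0\<^sub>m 7 8 * u + C * x = 0\<^sub>m 7 1" "D * A * u + - D * x = 0\<^sub>m 7 1"
    by (auto simp: XD)
  define y where "y = A * u - x"
  have y: "y \<in> carrier_mat 12 1" using x by (simp add: y_def minus_carrier_mat)
  have Au: "A * u = x + y" using Xc u x by (intro eq_matI) (auto simp: y_def)
  have pc: "B * x \<in> carrier_mat 2 1" "C * x \<in> carrier_mat 7 1" "B * (A * u) \<in> carrier_mat 2 1"
    "D * (A * u) \<in> carrier_mat 7 1" "D * x \<in> carrier_mat 7 1" "D * y \<in> carrier_mat 7 1" "C * y \<in> carrier_mat 7 1"
    using Xc u x y by auto
  have Bx: "B * x = 0\<^sub>m 2 1" using eqs(2) pc u by simp
  have Cx: "C * x = 0\<^sub>m 7 1" using eqs(3) pc u by simp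
  have "B * (A * u) = 0\<^sub>m 2 1" using eqs(1) pc x assoc_mult_mat[OF Xc(2,1) u] by simp
  then have By: "B * y = 0\<^sub>m 2 1"
    using Bx mult_minus_distrib_mat[OF Xc(2) mult_carrier_mat[OF Xc(1) u] x] by (simp add: y_def)
  have "D * (A * u) + - (D * x) = 0\<^sub>m 7 1"
    using eqs(4) assoc_mult_mat[OF Xc(4,1) u] Xc x by simp
  then have "D * (A * u) - D * x = 0\<^sub>m 7 1"
    using pc add_uminus_minus_mat[OF pc(4,5)] by simp
  then have Dy: "D * y = 0\<^sub>m 7 1"
    using mult_minus_distrib_mat[OF Xc(4) mult_carrier_mat[OF Xc(1) u] x] by (simp add: y_def)
  \<comment> \<open>\<open>x\<close> is killed by \<open>B\<close> and \<open>C\<close>, and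
    \<open>y\<close> by \<open>B\<close> and \<open>D\<close>; a nonzero one cannot also be killed
    by the third map.\<close>
  have Dx: "D * x \<noteq> 0\<^sub>m 7 1" if "x \<noteq> 0\<^sub>m 12 1" using ker[OF x Bx Cx] that by blast
  have Cy: "C * y \<noteq> 0\<^sub>m 7 1" if "y \<noteq> 0\<^sub>m 12 1" using ker[OF y By _ Dy] that by blast
  note endo = no_endo[OF u x y _ _ _ _ _ _ _ Bx By Cx _ Dy]
  show False
  proof (cases "x = 0\<^sub>m 12 1"; cases "y = 0\<^sub>m 12 1")
    assume x0: "x = 0\<^sub>m 12 1" and y0: "y = 0\<^sub>m 12 1"
    have u0: "u \<noteq> 0\<^sub>m 8 1" using ux x0 by blast
    \<comment> \<open>Here \<open>u\<close> is a nonzero vector of the kernel of \<open>A\<close>.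
      Three conditions on 8 unknowns leave a row \<open>\<phi>\<close> that kills the incoming maps,
      and \<open>u * \<phi>\<close> is an endomorphism supported at 4.\<close>
    obtain \<phi> where \<phi>: "\<phi> \<in> carrier_mat 1 8" "\<phi> \<noteq> 0\<^sub>m 1 8"
      and \<phi>W: "\<phi> * amap X (1, 4) = 0\<^sub>m 1 1" "\<phi> * amap X (2, 4) = 0\<^sub>m 1 1" "\<phi> * amap X (3, 4) = 0\<^sub>m 1 1"
      using common_left_kernel[of "[amap X (1, 4), amap X (2, 4), amap X (3, 4)]" 8] WDs by auto
    have Au0: "A * u = 0\<^sub>m 12 1" unfolding Au x0 y0 by simp
    have "u * \<phi> = 0\<^sub>m 8 8"
      by (rule endo(1)[of \<phi> "0\<^sub>m 1 12" "0\<^sub>m 1 12" "0\<^sub>m 1 7" "0\<^sub>m 1 7"])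
        (use \<phi> \<phi>W Xc Au0 pc x y in auto)
    then show False using column_times_row_eq_0[OF u \<phi>(1)] u0 \<phi>(2) by blast
  next
    assume x0: "x = 0\<^sub>m 12 1" and y0: "y \<noteq> 0\<^sub>m 12 1"
    \<comment> \<open>Now \<open>A * u = y\<close>, so the rows \<open>\<phi> * C\<close> at 5 and
      \<open>\<phi> * C * A\<close> at 4 make the squares commute once the latter kills the three
      incoming maps.\<close>
    obtain \<phi> where \<phi>: "\<phi> \<in> carrier_mat 1 7" "\<phi> \<noteq> 0\<^sub>m 1 7"
      and \<phi>W: "\<forall>i\<in>{1, 2, 3}. \<phi> * (C * A * amap X (i, 4)) = 0\<^sub>m 1 1"
      using left_ker[OF mult_carrier_mat[OF Xc(3,1)]] by blast
    have \<phi>D: "dim_row \<phi> = 1" "dim_col \<phi> = 7" using \<phi> by auto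
    have "(C * y) * \<phi> = 0\<^sub>m 7 7"
    proof (rule endo(3)[of "\<phi> * C * A" "0\<^sub>m 1 12" "\<phi> * C" \<phi> "0\<^sub>m 1 7"])
      show "\<forall>i\<in>{1, 2, 3}. \<phi> * C * A * amap X (i, 4) = 0\<^sub>m 1 1"
        using \<phi>W WD by (simp add: mat_mult_assoc_dim \<phi>D XD del: One_nat_def insert_iff)
      have "y * (\<phi> * C * A) \<in> carrier_mat 12 8" using y \<phi> Xc by auto
      then show "A * u * (\<phi> * C * A) = x * (0\<^sub>m 1 12 * A) + y * (\<phi> * C * A)"
        unfolding Au x0 using y Xc by simp
    qed (use \<phi> Xc pc in auto)
    then show False using column_times_row_eq_0[OF pc(7) \<phi>(1)] Cy y0 \<phi>(2) by blast
  next
    assume x0: "x \<noteq> 0\<^sub>m 12 1" and y0: "y = 0\<^sub>m 12 1"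
    \<comment> \<open>The previous case with the roles of \<open>C\<close> and \<open>D\<close>, and
      of \<open>x\<close> and \<open>y\<close>, exchanged.\<close>
    obtain \<phi> where \<phi>: "\<phi> \<in> carrier_mat 1 7" "\<phi> \<noteq> 0\<^sub>m 1 7"
      and \<phi>W: "\<forall>i\<in>{1, 2, 3}. \<phi> * (D * A * amap X (i, 4)) = 0\<^sub>m 1 1"
      using left_ker[OF mult_carrier_mat[OF Xc(4,1)]] by blast
    have \<phi>D: "dim_row \<phi> = 1" "dim_col \<phi> = 7" using \<phi> by auto
    have "(D * x) * \<phi> = 0\<^sub>m 7 7"
    proof (rule endo(4)[of "\<phi> * D * A" "\<phi> * D" "0\<^sub>m 1 12" "0\<^sub>m 1 7" \<phi>])
      show "\<forall>i\<in>{1, 2, 3}. \<phi> * D * A * amap X (i, 4) = 0\<^sub>m 1 1"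
        using \<phi>W WD by (simp add: mat_mult_assoc_dim \<phi>D XD del: One_nat_def insert_iff)
      have "x * (\<phi> * D * A) \<in> carrier_mat 12 8" using x \<phi> Xc by auto
      then show "A * u * (\<phi> * D * A) = x * (\<phi> * D * A) + y * (0\<^sub>m 1 12 * A)"
        unfolding Au y0 using x Xc by simp
    qed (use \<phi> Xc pc in auto)
    then show False using column_times_row_eq_0[OF pc(5) \<phi>(1)] Dx x0 \<phi>(2) by blast
  next
    assume x0: "x \<noteq> 0\<^sub>m 12 1" and y0: "y \<noteq> 0\<^sub>m 12 1"
    \<comment> \<open>11 equations in the 14 unknowns \<open>(\<phi>, \<psi>)\<close>\<close>
    let ?Ns = "[(C * A, - (D * A)), (C * A * amap X (1, 4), 0\<^sub>m 7 1), (C * A * amap X (2, 4), 0\<^sub>m 7 1),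
      (C * A * amap X (3, 4), 0\<^sub>m 7 1)]"
    have "\<exists>\<phi>\<in>carrier_mat 1 7. \<exists>\<psi>\<in>carrier_mat 1 7. (\<phi> \<noteq> 0\<^sub>m 1 7 \<or> \<psi> \<noteq> 0\<^sub>m 1 7) \<and>
      (\<forall>(M, N)\<in>set ?Ns. \<phi> * M + \<psi> * N = 0\<^sub>m 1 (dim_col M))"
      by (rule common_left_kernel_pair) (use WDs in \<open>auto simp: XD\<close>)
    then obtain \<phi> \<psi> where \<phi>: "\<phi> \<in> carrier_mat 1 7" and \<psi>: "\<psi> \<in> carrier_mat 1 7"
      and ne: "\<phi> \<noteq> 0\<^sub>m 1 7 \<or> \<psi> \<noteq> 0\<^sub>m 1 7" and e: "\<phi> * (C * A) + \<psi> * - (D * A) = 0\<^sub>m 1 8"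
      and eW: "\<phi> * (C * A * amap X (1, 4)) + \<psi> * 0\<^sub>m 7 1 = 0\<^sub>m 1 1" "\<phi> * (C * A * amap X (2, 4)) + \<psi> * 0\<^sub>m 7 1 = 0\<^sub>m 1 1"
        "\<phi> * (C * A * amap X (3, 4)) + \<psi> * 0\<^sub>m 7 1 = 0\<^sub>m 1 1"
      using WDs by (auto simp: XD)
    have \<phi>D: "dim_row \<phi> = 1" "dim_col \<phi> = 7" "dim_row \<psi> = 1" "dim_col \<psi> = 7" using \<phi> \<psi> by auto
    have c: "\<phi> * (C * A) \<in> carrier_mat 1 8" "\<psi> * (D * A) \<in> carrier_mat 1 8" "D * A \<in> carrier_mat 7 8"
      using \<phi> \<psi> Xc by auto
    have "\<phi> * (C * A) + - (\<psi> * (D * A)) = 0\<^sub>m 1 8"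
      using e by (simp add: \<phi>D XD)
    then have z: "(\<phi> * (C * A) - \<psi> * (D * A)) = 0\<^sub>m 1 8"
      using add_uminus_minus_mat[OF c(1,2)] by simp
    have "M = N" if "M \<in> carrier_mat 1 8" "N \<in> carrier_mat 1 8" "M - N = 0\<^sub>m 1 8" for M N :: "'k mat"
    proof (rule eq_matI)
      fix i j assume "i < dim_row N" "j < dim_col N"
      then show "M $$ (i, j) = N $$ (i, j)"
        using arg_cong[OF that(3), of "\<lambda>M. M $$ (i, j)"] that(1,2) by simp
    qed (use that in auto)
    \<comment> \<open>With \<open>p = \<psi> * D\<close> and \<open>q = \<phi> * C\<close>, this
      common value serves as the row at 4: it lets \<open>A * u = x + y\<close> be multiplied
      through to give the square from 4 to 5.\<close>
    from this[OF c(1,2) z] have eq: "\<phi> * (C * A) = \<psi> * (D * A)" .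
    have h: "(C * y) * \<phi> = 0\<^sub>m 7 7 \<and> (D * x) * \<psi> = 0\<^sub>m 7 7"
    proof -
      have hW: "\<forall>i\<in>{1, 2, 3}. \<phi> * C * A * amap X (i, 4) = 0\<^sub>m 1 1"
      proof
        fix i :: nat assume that: "i \<in> {1, 2, 3}"
        have "\<phi> * (C * A * amap X (i, 4)) + \<psi> * 0\<^sub>m 7 1 = 0\<^sub>m 1 1" using that eW by auto
        moreover have "\<phi> * (C * A * amap X (i, 4)) \<in> carrier_mat 1 1" using \<phi> AW[OF that] by auto
        ultimately show "\<phi> * C * A * amap X (i, 4) = 0\<^sub>m 1 1"
          using \<psi> by (simp add: mat_mult_assoc_dim \<phi>D XD WD[OF that])
      qed
      have eq': "\<phi> * C * A = \<psi> * D * A" using eq by (simp add: mat_mult_assoc_dim \<phi>D XD)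
      have hA: "A * u * (\<phi> * C * A) = x * (\<psi> * D * A) + y * (\<phi> * C * A)"
        unfolding Au eq' using x y \<psi> Xc by (intro add_mult_distrib_mat) auto
      have r: "\<phi> * C * A \<in> carrier_mat 1 8" "\<psi> * D \<in> carrier_mat 1 12" "\<phi> * C \<in> carrier_mat 1 12"
        using \<phi> \<psi> Xc by auto
      show ?thesis
        using endo(3)[OF r \<phi> \<psi> hW hA refl refl] endo(4)[OF r \<phi> \<psi> hW hA refl refl] by blast
    qed
    show False
      using h column_times_row_eq_0[OF pc(7) \<phi>] column_times_row_eq_0[OF pc(5) \<psi>] Cy y0 Dx x0 ne by blast
  qed
qed

section \<open>No reduction by a universal extension\<close>

lemma ringel_form_add_scaled:
  "ringel_form Q \<alpha> (\<lambda>i. \<beta> i + k * \<gamma> i) = ringel_form Q \<alpha> \<beta> + k * ringel_form Q \<alpha> \<gamma>"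
  "ringel_form Q (\<lambda>i. \<beta> i + k * \<gamma> i) \<alpha> = ringel_form Q \<beta> \<alpha> + k * ringel_form Q \<gamma> \<alpha>"
  by (simp_all add: ringel_form_def sum.distrib sum_distrib_left algebra_simps)

text \<open>A vector killed by the map \<open>4 \<rightarrow> 5\<close> of \<open>Y\<close> spans a simple subrepresentation at \<open>4\<close>, which is also a
  quotient of \<open>S\<close> because \<open>S\<close> vanishes at the sources \<open>1, 2, 3\<close>.\<close>

lemma nonzero_hom_through_simple_at_4:
  fixes S Y :: "(nat, nat \<times> nat, 'k::field) quiver_rep"
  assumes S: "is_rep quiver8 S" and Y: "is_rep quiver8 Y"
    and dS: "vdim S 1 = 0" "vdim S 2 = 0" "vdim S 3 = 0" "vdim S 4 = 1"
    and dY: "vdim Y 5 < vdim Y 4"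
  shows "\<not> qhom_zero quiver8 S Y"
proof
  assume zero: "qhom_zero quiver8 S Y"
  have ac: "amap Z (1, 4) \<in> carrier_mat (vdim Z 4) (vdim Z 1)" "amap Z (2, 4) \<in> carrier_mat (vdim Z 4) (vdim Z 2)"
    "amap Z (3, 4) \<in> carrier_mat (vdim Z 4) (vdim Z 3)" "amap Z (4, 5) \<in> carrier_mat (vdim Z 5) (vdim Z 4)"
    "amap Z (5, 6) \<in> carrier_mat (vdim Z 6) (vdim Z 5)" "amap Z (5, 7) \<in> carrier_mat (vdim Z 7) (vdim Z 5)"
    "amap Z (5, 8) \<in> carrier_mat (vdim Z 8) (vdim Z 5)"
    if "is_rep quiver8 Z" for Z :: "(nat, nat \<times> nat, 'k::field) quiver_rep"
    using that by (auto simp: is_rep_def quiver8_def)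
  note Sc = ac[OF S, unfolded dS] and Yc = ac[OF Y]
  \<comment> \<open>The second block has no columns, so this asks for a nonzero vector killed by the
    map 4 -> 5, which exists because the target has smaller dimension.\<close>
  let ?Ms = "[(amap Y (4, 5), 0\<^sub>m (vdim Y 5) 0)]"
  have "\<exists>v\<in>carrier_mat (vdim Y 4) 1. \<exists>w\<in>carrier_mat 0 1. (v \<noteq> 0\<^sub>m (vdim Y 4) 1 \<or> w \<noteq> 0\<^sub>m 0 1) \<and>
    (\<forall>(M, N)\<in>set ?Ms. M * v + N * w = 0\<^sub>m (dim_row M) 1)"
    by (rule common_kernel_pair) (use Yc dY in auto)
  then obtain v w where v: "v \<in> carrier_mat (vdim Y 4) 1" and w: "w \<in> carrier_mat 0 1"
    and vw: "v \<noteq> 0\<^sub>m (vdim Y 4) 1 \<or> w \<noteq> 0\<^sub>m 0 1"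
    and e: "amap Y (4, 5) * v + 0\<^sub>m (vdim Y 5) 0 * w = 0\<^sub>m (vdim Y 5) 1"
    using Yc by auto
  have w0: "w = 0\<^sub>m 0 1" using w by (intro eq_matI) auto
  have ker: "amap Y (4, 5) * v = 0\<^sub>m (vdim Y 5) 1"
    using e mult_carrier_mat[OF Yc(4) v] unfolding w0 by simp
  define f where "f = (\<lambda>i::nat. if i = 4 then v else 0\<^sub>m (vdim Y i) (vdim S i))"
  have f: "f 4 = v" "f 1 = 0\<^sub>m (vdim Y 1) 0" "f 2 = 0\<^sub>m (vdim Y 2) 0" "f 3 = 0\<^sub>m (vdim Y 3) 0"
    "f 5 = 0\<^sub>m (vdim Y 5) (vdim S 5)" "f 6 = 0\<^sub>m (vdim Y 6) (vdim S 6)" "f 7 = 0\<^sub>m (vdim Y 7) (vdim S 7)"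
    "f 8 = 0\<^sub>m (vdim Y 8) (vdim S 8)"
    by (simp_all only: f_def dS) simp_all
  \<comment> \<open>At the arrows out of 1, 2, 3 both sides of the square have no columns, as
    \<open>S\<close> vanishes there, and thus agree.\<close>
  have e0: "M = N" if "M \<in> carrier_mat n 0" "N \<in> carrier_mat n 0" for M N :: "'k mat" and n
    using that by (intro eq_matI) auto
  have "f \<in> qhom quiver8 S Y"
    unfolding qhom_def
  proof (intro CollectI conjI)
    have "f i \<in> carrier_mat (vdim Y i) (vdim S i)" for i
      using v dS by (cases "i = 4") (simp_all add: f_def)
    then show "\<forall>i\<in>verts quiver8. f i \<in> carrier_mat (vdim Y i) (vdim S i)" by blast
    have "amap Y (1, 4) * f 1 = f 4 * amap S (1, 4)" unfolding f
      by (rule e0[OF mult_carrier_mat[OF Yc(1) zero_carrier_mat] mult_carrier_mat[OF v Sc(1)]])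
    moreover have "amap Y (2, 4) * f 2 = f 4 * amap S (2, 4)" unfolding f
      by (rule e0[OF mult_carrier_mat[OF Yc(2) zero_carrier_mat] mult_carrier_mat[OF v Sc(2)]])
    moreover have "amap Y (3, 4) * f 3 = f 4 * amap S (3, 4)" unfolding f
      by (rule e0[OF mult_carrier_mat[OF Yc(3) zero_carrier_mat] mult_carrier_mat[OF v Sc(3)]])
    moreover have "amap Y (4, 5) * f 4 = f 5 * amap S (4, 5)"
      unfolding f ker left_mult_zero_mat[OF Sc(4)] ..
    moreover have "amap Y (5, 6) * f 5 = f 6 * amap S (5, 6)"
      unfolding f right_mult_zero_mat[OF Yc(5)] left_mult_zero_mat[OF Sc(5)] ..
    moreover have "amap Y (5, 7) * f 5 = f 7 * amap S (5, 7)"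
      unfolding f right_mult_zero_mat[OF Yc(6)] left_mult_zero_mat[OF Sc(6)] ..
    moreover have "amap Y (5, 8) * f 5 = f 8 * amap S (5, 8)"
      unfolding f right_mult_zero_mat[OF Yc(7)] left_mult_zero_mat[OF Sc(7)] ..
    ultimately show "\<forall>a\<in>arcs quiver8. amap Y a * f (tail quiver8 a) = f (head quiver8 a) * amap S a"
      unfolding quiver8_def pre_digraph.simps by (simp only: ball_simps fst_conv snd_conv simp_thms)
  qed
  moreover have "4 \<in> verts quiver8" by (simp add: quiver8_def)
  ultimately have "f 4 = 0\<^sub>m (vdim Y 4) (vdim S 4)" using zero unfolding qhom_zero_def by blast
  then show False using vw w0 unfolding f(1) dS by simp
qed

text \<open>The reflection at \<open>b\<close> is an involution because \<open>b\<close> has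
  quadratic form 1, so \<open>y\<close> is recovered from \<open>alpha8\<close>. Unless it fixes
  \<open>alpha8\<close>, the numerical search and a nonzero map from \<open>S\<close> to
  \<open>Y\<close> give a contradiction.\<close>

theorem universal_ext_alpha8_trivial:
  fixes S Y U :: "(nat, nat \<times> nat, 'k::field) quiver_rep"
  assumes U: "universal_ext quiver8 S Y U" and dU: "dimvec quiver8 U = alpha8"
    and root: "positive_real_root quiver8 (dimvec quiver8 S)"
  shows "dimvec quiver8 Y = alpha8"
proof -
  define b y where "b = dimvec quiver8 S" and "y = dimvec quiver8 Y"
  define k where "k = sym_form quiver8 y b"
  note re = dimvec_universal_ext[OF fin_digraph_quiver8 U, folded b_def y_def]
  note b1 = positive_real_root_quiver8[OF root, folded b_def]
  have y: "y = (\<lambda>i. alpha8 i + k * b i)"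
  proof
    fix i
    have "alpha8 i = y i - k * b i" using fun_cong[OF re(3), of i] unfolding dU k_def .
    then show "y i = alpha8 i + k * b i" by simp
  qed
  have rf: "ringel_form quiver8 b y = ringel_form quiver8 b alpha8 + k"
    "ringel_form quiver8 y b = ringel_form quiver8 alpha8 b + k"
    unfolding y ringel_form_add_scaled b1(1) by simp_all
  moreover have "k = ringel_form quiver8 y b + ringel_form quiver8 b y" by (simp only: k_def sym_form_def)
  ultimately have k: "k = - sym_form quiver8 alpha8 b" unfolding sym_form_def by linarith
  have nonneg: "0 \<le> y i" for i by (simp add: y_def dimvec_def)
  show ?thesis
  proof (cases "k = 0")
    case True
    then show ?thesis using y unfolding y_def by simp
  next
    case False
    have "sym_form quiver8 alpha8 b = 5 \<and> b 1 = 0 \<and> b 2 = 0 \<and> b 3 = 0 \<and> b 4 = 1 \<and> b 5 = 2"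
    proof (rule numerical_reduction_of_alpha8[OF b1(2,1)])
      \<comment> \<open>Reflecting swaps the two forms up to sign: the form of \<open>b\<close> with
        \<open>alpha8\<close> is minus that of \<open>y\<close> with \<open>b\<close>, and similarly
        on the other side.\<close>
      show "0 \<le> ringel_form quiver8 b alpha8" "0 \<le> ringel_form quiver8 alpha8 b"
        using re(1,2) rf k unfolding sym_form_def by linarith+
      show "sym_form quiver8 alpha8 b * b i \<le> alpha8 i" for i
        using nonneg[of i] k unfolding y by simp
    qed (use False k in auto)
    then have b: "b 1 = 0" "b 2 = 0" "b 3 = 0" "b 4 = 1" "b 5 = 2" and k5: "k = - 5" using k by auto
    have "int (vdim S i) = b i" "int (vdim Y i) = y i" if "i \<in> {1..8}" for i
      using that by (simp_all add: b_def y_def dimvec_def quiver8_def)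
    \<comment> \<open>Subtracting \<open>5 b\<close> leaves dimension 8 - 5 = 3 at vertex 4 and 12 -
      10 = 2 at vertex 5.\<close>
    from this[of 1] this[of 2] this[of 3] this[of 4] this[of 5]
    have "vdim S 1 = 0" "vdim S 2 = 0" "vdim S 3 = 0" "vdim S 4 = 1" "vdim Y 5 < vdim Y 4"
      using b unfolding y k5 by (simp_all add: alpha8_def)
    moreover have "is_rep quiver8 S" "is_rep quiver8 Y" "qhom_zero quiver8 S Y"
      using U by (auto simp: universal_ext_def M_up_down_def M_up_def M_down_def)
    ultimately have False using nonzero_hom_through_simple_at_4 by blast
    then show ?thesis ..
  qed
qed

text \<open>Universal extensions are relations, so the intermediate results are quantified as
  \<open>Y i\<close>: the sequence starts at \<open>Y 1 = S 1\<close> and ends at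
  \<open>Y n\<close>, isomorphic to the representation of the root.\<close>

theorem mainTheorem2:
  fixes K :: "'k::field itself"
  shows "positive_real_root quiver8 alpha8 \<and>
    \<not> real_schur_root K quiver8 alpha8 \<and>
    \<not> (\<exists>(n::nat) (\<beta> :: nat \<Rightarrow> nat \<Rightarrow> int)
          (S :: nat \<Rightarrow> (nat, nat \<times> nat, 'k) quiver_rep)
          (Y :: nat \<Rightarrow> (nat, nat \<times> nat, 'k) quiver_rep)
          (X :: (nat, nat \<times> nat, 'k) quiver_rep).
        n \<ge> 2 \<and>
        (\<forall>i\<in>{1..n}. real_schur_root K quiver8 (\<beta> i) \<and> is_root_rep quiver8 (\<beta> i) (S i)) \<and>
        Y 1 = S 1 \<and>
        (\<forall>i\<in>{2..n}. universal_ext quiver8 (S i) (Y (i - 1)) (Y i)) \<and>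
        is_root_rep quiver8 alpha8 X \<and> qiso quiver8 X (Y n))"
proof (intro conjI notI)
  show "positive_real_root quiver8 alpha8" by (rule positive_real_root_alpha8)
  have not_schur: "\<not> real_schur_root K quiver8 alpha8"
    using no_schur_representation_of_alpha8
    unfolding real_schur_root_def is_root_rep_def indecomposable_def by blast
  then show False if "real_schur_root K quiver8 alpha8" using that by blast
  assume "\<exists>(n::nat) (\<beta> :: nat \<Rightarrow> nat \<Rightarrow> int)
          (S :: nat \<Rightarrow> (nat, nat \<times> nat, 'k) quiver_rep)
          (Y :: nat \<Rightarrow> (nat, nat \<times> nat, 'k) quiver_rep)
          (X :: (nat, nat \<times> nat, 'k) quiver_rep).
        n \<ge> 2 \<and>
        (\<forall>i\<in>{1..n}. real_schur_root K quiver8 (\<beta> i) \<and> is_root_rep quiver8 (\<beta> i) (S i)) \<and>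
        Y 1 = S 1 \<and>
        (\<forall>i\<in>{2..n}. universal_ext quiver8 (S i) (Y (i - 1)) (Y i)) \<and>
        is_root_rep quiver8 alpha8 X \<and> qiso quiver8 X (Y n)"
  then obtain n \<beta> and S Y :: "nat \<Rightarrow> (nat, nat \<times> nat, 'k) quiver_rep" and X :: "(nat, nat \<times> nat, 'k) quiver_rep"
    where n: "n \<ge> 2"
      and roots: "\<And>i. i \<in> {1..n} \<Longrightarrow> real_schur_root K quiver8 (\<beta> i) \<and> is_root_rep quiver8 (\<beta> i) (S i)"
      and Y1: "Y 1 = S 1"
      and ext: "\<And>i. i \<in> {2..n} \<Longrightarrow> universal_ext quiver8 (S i) (Y (i - 1)) (Y i)"
      and X: "is_root_rep quiver8 alpha8 X" "qiso quiver8 X (Y n)"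
    by blast
  have \<beta>: "dimvec quiver8 (S i) = \<beta> i" "positive_real_root quiver8 (\<beta> i)" if "i \<in> {1..n}" for i
    using roots[OF that] by (auto simp: is_root_rep_def real_schur_root_def)
  \<comment> \<open>Descent from \<open>Y n\<close> to \<open>Y 1\<close>; the bound
    \<open>j < n\<close> keeps the index at least 1. At the end \<open>S 1\<close> has dimension
    vector \<open>alpha8\<close>, which would make \<open>alpha8\<close> a real Schur root.\<close>
  have "dimvec quiver8 (Y (n - j)) = alpha8" if "j < n" for j
    using that
  proof (induction j)
    case 0
    have "dimvec quiver8 (Y n) = dimvec quiver8 X" using qiso_dimvec_eq[OF X(2)] by simp
    then show ?case using X(1) by (simp add: is_root_rep_def)
  next
    case (Suc j)
    then have i: "n - j \<in> {2..n}" "n - j \<in> {1..n}" "n - j - 1 = n - Suc j" by auto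
    have "dimvec quiver8 (Y (n - j)) = alpha8" using Suc by simp
    then have "dimvec quiver8 (Y (n - j - 1)) = alpha8"
      using universal_ext_alpha8_trivial[OF ext[OF i(1)]] \<beta>[OF i(2)] by simp
    then show ?case unfolding i(3) .
  qed
  from this[of "n - 1"] have "dimvec quiver8 (S 1) = alpha8" using n Y1 by simp
  moreover have "1 \<in> {1..n}" using n by simp
  ultimately show False using \<beta>(1)[of 1] roots[of 1] not_schur by simp
qed

end
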